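(* Suppose that $G$ is a sigma compact totally disconnected locally compact group and $H$ is a closed subgroup of $G$. (1) If $H$ has finite covolume in $G$, then $\mathrm{rk}_{BC}(H)=\mathrm{rk}_{BC}(G)$. (2) If $H$ is cocompact in $G$, then $\mathrm{rk}_{BC}(H)=\mathrm{rk}_{BC}(G)$. In particular, if $\Gamma$ and $\Delta$ are any two lattices in $G$, then $\mathrm{rk}_{BC}(\Gamma)=\mathrm{rk}_{BC}(G)=\mathrm{rk}_{BC}(\Delta)$.
   Context: A locally compact group is sigma compact if it is a countable union of compact sets. A closed subgroup $H$ of a locally compact group $G$ is cocompact if the coset space $G/H$ is compact; it has finite covolume if $G/H$ admits a $G$-invariant Borel probability measure, where $G$ acts by left multiplication. A lattice of $G$ is a discrete subgroup of finite covolume. For a topological group $G$, a subgroup $H\leq G$ and $g\in G$, write $g^H=\{hgh^{-1}\mid h\in H\}$; the BC-centralizer of $H$ in $G$ is $\mathrm{BC}_G(H)=\{g\in G\mid g^H\text{ is relatively compact in } G\}$, which is a subgroup of $G$. For $G$ a totally disconnected locally compact group, a closed subgroup $A\leq G$ is thin on $G$ if $A$ normalizes some compact open subgroup of $G$ and $\mathrm{BC}_G(A)$ is a finite index open subgroup of $G$. A locally compact group is regionally compact if every finite subset generates a relatively compact subgroup. Every locally compact group $A$ has a unique largest regionally compact normal subgroup, the regionally compact radical, denoted $\mathrm{Rad}_{\mathcal{RC}}(A)$. The thin rank $\mathrm{rk}_t(A)$ of a closed subgroup $A$ that is thin on $G$ is the supremum of the ranks of free abelian subgroups of $A/\mathrm{Rad}_{\mathcal{RC}}(A)$.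 The bounded conjugacy rank $\mathrm{rk}_{BC}(G)\in\{0,1,2,\dots\}\cup\{\infty\}$ of a totally disconnected locally compact group $G$ is the supremum of $\mathrm{rk}_t(A)$ as $A$ ranges over all compactly generated closed subgroups of $G$ that are thin on $G$. *)

theory Defs
  imports
    "HOL-Probability.Probability_Measure"
    "HOL-Algebra.Free_Abelian_Groups"
    "HOL-Library.Extended_Nat"
begin

section \<open>Topological groups\<close>

locale topological_group = group G for G (structure) and T :: "'a topology" +
  assumes topspace_eq_carrier: "topspace T = carrier G"
    and continuous_mult: "continuous_map (prod_topology T T) T (\<lambda>(x, y). x \<otimes> y)"
    and continuous_inv: "continuous_map T T (\<lambda>x. inv x)"

text \<open>As usual, locally compact groups are Hausdorff. For totally disconnected groups this is
  automatic.\<close>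

locale locally_compact_group = topological_group +
  assumes locally_compact: "locally_compact_space T"
    and Hausdorff: "Hausdorff_space T"

definition totally_disconnected_space :: "'a topology \<Rightarrow> bool" where
  "totally_disconnected_space T \<longleftrightarrow> (\<forall>S. connectedin T S \<longrightarrow> (\<exists>x. S \<subseteq> {x}))"

locale tdlc_group = locally_compact_group +
  assumes totally_disconnected: "totally_disconnected_space T"

definition sigma_compact_space :: "'a topology \<Rightarrow> bool" where
  "sigma_compact_space T \<longleftrightarrow>
     (\<exists>\<K>. countable \<K> \<and> (\<forall>K\<in>\<K>. compactin T K) \<and> \<Union>\<K> = topspace T)"

definition relatively_compactin :: "'a topology \<Rightarrow> 'a set \<Rightarrow> bool" where
  "relatively_compactin T S \<longleftrightarrow> S \<subseteq> topspace T \<and> compactin T (T closure_of S)"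

text \<open>A subgroup \<open>H\<close> of the topological group \<open>(G, T)\<close> is regarded as a topological group in its
  own right as \<open>(G\<lparr>carrier := H\<rparr>, subtopology T H)\<close>.\<close>

definition closed_subgroup :: "'a set \<Rightarrow> ('a, 'b) monoid_scheme \<Rightarrow> 'a topology \<Rightarrow> bool" where
  "closed_subgroup H G T \<longleftrightarrow> subgroup H G \<and> closedin T H"

definition compactly_generated_subgroup ::
    "'a set \<Rightarrow> ('a, 'b) monoid_scheme \<Rightarrow> 'a topology \<Rightarrow> bool" where
  "compactly_generated_subgroup A G T \<longleftrightarrow> (\<exists>K. compactin T K \<and> generate G K = A)"

section \<open>Coset spaces, cocompactness, finite covolume, lattices\<close>

definition quotient_topology :: "'a topology \<Rightarrow> ('a \<Rightarrow> 'c) \<Rightarrow> 'c topology" where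
  "quotient_topology T f =
     topology (\<lambda>V. V \<subseteq> f ` topspace T \<and> openin T {x \<in> topspace T. f x \<in> V})"

lemma openin_quotient_topology:
  "openin (quotient_topology T f) V \<longleftrightarrow>
     V \<subseteq> f ` topspace T \<and> openin T {x \<in> topspace T. f x \<in> V}"
proof -
  have "istopology (\<lambda>V. V \<subseteq> f ` topspace T \<and> openin T {x \<in> topspace T. f x \<in> V})"
    unfolding istopology_def
  proof (intro conjI allI impI)
    fix U V
    assume U: "U \<subseteq> f ` topspace T \<and> openin T {x \<in> topspace T. f x \<in> U}"
      and V: "V \<subseteq> f ` topspace T \<and> openin T {x \<in> topspace T. f x \<in> V}"
    show "U \<inter> V \<subseteq> f ` topspace T" using U by blast
    have "{x \<in> topspace T. f x \<in> U \<inter> V} =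
        {x \<in> topspace T. f x \<in> U} \<inter> {x \<in> topspace T. f x \<in> V}" by blast
    then show "openin T {x \<in> topspace T. f x \<in> U \<inter> V}" using U V by auto
  next
    fix \<V>
    assume V: "\<forall>V\<in>\<V>. V \<subseteq> f ` topspace T \<and> openin T {x \<in> topspace T. f x \<in> V}"
    show "\<Union>\<V> \<subseteq> f ` topspace T" using V by blast
    have "{x \<in> topspace T. f x \<in> \<Union>\<V>} = (\<Union>V\<in>\<V>. {x \<in> topspace T. f x \<in> V})" by blast
    then show "openin T {x \<in> topspace T. f x \<in> \<Union>\<V>}" using V by auto
  qed
  then show ?thesis by (simp add: quotient_topology_def topology_inverse')
qed

lemma topspace_quotient_topology [simp]: "topspace (quotient_topology T f) = f ` topspace T"
proof -
  have "{x \<in> topspace T. f x \<in> f ` topspace T} = topspace T" by blast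
  then have "openin (quotient_topology T f) (f ` topspace T)"
    by (simp add: openin_quotient_topology)
  then show ?thesis
    by (meson openin_quotient_topology openin_subset openin_topspace subset_antisym)
qed

lemma quotient_map_quotient_topology: "quotient_map T (quotient_topology T f) f"
  by (auto simp: quotient_map_def openin_quotient_topology)

text \<open>The space \<open>G/H\<close> of left cosets \<open>gH\<close>.\<close>

definition coset_space :: "('a, 'b) monoid_scheme \<Rightarrow> 'a topology \<Rightarrow> 'a set \<Rightarrow> 'a set topology" where
  "coset_space G T H = quotient_topology T (\<lambda>g. g <#\<^bsub>G\<^esub> H)"

definition cocompact :: "'a set \<Rightarrow> ('a, 'b) monoid_scheme \<Rightarrow> 'a topology \<Rightarrow> bool" where
  "cocompact H G T \<longleftrightarrow> compact_space (coset_space G T H)"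

text \<open>The type class based \<open>borel\<close> is not applicable to an explicitly given topology.\<close>

definition borel_measure_on :: "'a topology \<Rightarrow> 'a measure \<Rightarrow> bool" where
  "borel_measure_on X M \<longleftrightarrow>
     space M = topspace X \<and> sets M = sigma_sets (topspace X) {U. openin X U}"

definition finite_covolume :: "'a set \<Rightarrow> ('a, 'b) monoid_scheme \<Rightarrow> 'a topology \<Rightarrow> bool" where
  "finite_covolume H G T \<longleftrightarrow>
     (\<exists>M. borel_measure_on (coset_space G T H) M \<and> prob_space M \<and>
        (\<forall>g\<in>carrier G. \<forall>B\<in>sets M. emeasure M ((\<lambda>C. g <#\<^bsub>G\<^esub> C) ` B) = emeasure M B))"

definition discrete_subgroup :: "'a set \<Rightarrow> ('a, 'b) monoid_scheme \<Rightarrow> 'a topology \<Rightarrow> bool" where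
  "discrete_subgroup H G T \<longleftrightarrow> subgroup H G \<and> subtopology T H = discrete_topology H"

definition lattice_subgroup :: "'a set \<Rightarrow> ('a, 'b) monoid_scheme \<Rightarrow> 'a topology \<Rightarrow> bool" where
  "lattice_subgroup \<Gamma> G T \<longleftrightarrow> discrete_subgroup \<Gamma> G T \<and> finite_covolume \<Gamma> G T"

section \<open>Thin subgroups\<close>

definition BC_centralizer :: "('a, 'b) monoid_scheme \<Rightarrow> 'a topology \<Rightarrow> 'a set \<Rightarrow> 'a set" where
  "BC_centralizer G T H =
     {g \<in> carrier G. relatively_compactin T {h \<otimes>\<^bsub>G\<^esub> g \<otimes>\<^bsub>G\<^esub> inv\<^bsub>G\<^esub> h | h. h \<in> H}}"

definition thin_on :: "'a set \<Rightarrow> ('a, 'b) monoid_scheme \<Rightarrow> 'a topology \<Rightarrow> bool" where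
  "thin_on A G T \<longleftrightarrow>
     closed_subgroup A G T \<and>
     (\<exists>U. subgroup U G \<and> compactin T U \<and> openin T U \<and>
        (\<forall>a\<in>A. a <#\<^bsub>G\<^esub> U #>\<^bsub>G\<^esub> inv\<^bsub>G\<^esub> a = U)) \<and>
     subgroup (BC_centralizer G T A) G \<and>
     openin T (BC_centralizer G T A) \<and>
     finite (rcosets\<^bsub>G\<^esub> (BC_centralizer G T A))"

section \<open>The regionally compact radical and ranks\<close>

definition regionally_compact :: "('a, 'b) monoid_scheme \<Rightarrow> 'a topology \<Rightarrow> bool" where
  "regionally_compact G T \<longleftrightarrow>
     locally_compact_group G T \<and>
     (\<forall>F. finite F \<longrightarrow> F \<subseteq> carrier G \<longrightarrow> relatively_compactin T (generate G F))"

definition RC_radical :: "('a, 'b) monoid_scheme \<Rightarrow> 'a topology \<Rightarrow> 'a set" where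
  "RC_radical G T =
     (GREATEST N. N \<lhd> G \<and> regionally_compact (G\<lparr>carrier := N\<rparr>) (subtopology T N))"

definition ecard :: "'a set \<Rightarrow> enat" where
  "ecard X = (if finite X then enat (card X) else \<infinity>)"

text \<open>A basis of a free abelian subgroup of \<open>Q\<close> is a subset of \<open>carrier Q\<close>, so letting the index
  sets \<open>X\<close> range over sets of elements of \<open>Q\<close> loses no rank.\<close>

definition free_abelian_subgroup_rank :: "('a, 'b) monoid_scheme \<Rightarrow> enat" where
  "free_abelian_subgroup_rank Q =
     Sup {ecard X | (B :: 'a set) (X :: 'a set).
            subgroup B Q \<and> Q\<lparr>carrier := B\<rparr> \<cong> free_Abelian_group X}"

definition thin_rank :: "('a, 'b) monoid_scheme \<Rightarrow> 'a topology \<Rightarrow> 'a set \<Rightarrow> enat" where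
  "thin_rank G T A =
     free_abelian_subgroup_rank
       (G\<lparr>carrier := A\<rparr> Mod RC_radical (G\<lparr>carrier := A\<rparr>) (subtopology T A))"

definition BC_rank :: "('a, 'b) monoid_scheme \<Rightarrow> 'a topology \<Rightarrow> enat" where
  "BC_rank G T = Sup {thin_rank G T A | A. thin_on A G T \<and> compactly_generated_subgroup A G T}"

end

theory Submission
  imports Defs
begin

text \<open>
  A thin family of size \<open>n\<close> consists of elements \<open>a\<^sub>1, ..., a\<^sub>n\<close> that normalize a compact open subgroup \<open>U\<close>,
  commute and are independent modulo \<open>U\<close>, and whose BC-centralizer is open of finite index. For \<open>n > 0\<close> such
  a family exists iff \<open>n\<close> is at most the bounded conjugacy rank.

  Cocompactness and finite covolume of \<open>H\<close> enter only through recurrence: for every sequence \<open>g\<^sub>k\<close> in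
  \<open>G\<close> and generic \<open>x\<close> there is a compact \<open>K\<close> with \<open>g\<^sub>k x\<close> in \<open>K H\<close> for infinitely many \<open>k\<close>.

  From \<open>G\<close> to \<open>H\<close>: two returns of \<open>a\<^sub>i\<^sup>k x\<close> with \<open>x\<close> in \<open>U\<close> give an element of \<open>H\<close> in \<open>U a\<^sub>i\<^sup>m\<close> with \<open>m > 0\<close>,
  and these elements form a thin family of \<open>H\<close>.

  From \<open>H\<close> to \<open>G\<close>: a finite index subgroup \<open>B\<close> of \<open>H\<close> has bounded orbits under conjugation by each member \<open>a\<close>
  of a thin family of \<open>H\<close>. Let \<open>W\<close> be a compact open subgroup of \<open>G\<close> that is tidy for \<open>a\<close> in the sense of
  Willis. For generic \<open>u\<close> in \<open>W\<close>, comparing two returns of \<open>a\<^sup>k u a\<^sup>-\<^sup>k\<close> to \<open>K B\<close> shows that the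
  expanding component of \<open>u\<close> has a bounded orbit. Hence \<open>W\<close> has no expanding part, and \<open>a\<close> normalizes \<open>W\<close>.
  Schlichting's theorem produces a compact open subgroup normalized by the whole family; it makes the
  BC-centralizer open, and recurrence makes the index finite.
\<close>

section \<open>Bounded sets, conjugation and topological groups\<close>

text \<open>A thin closed subgroup of \<open>G\<close> has no direct counterpart in
  \<open>H\<close>, and its radical is awkward to follow. Finitely many elements and one compact
  open subgroup can be moved, so the rank is translated into that language. Size \<open>0\<close> is
  set apart because an empty supremum is \<open>0\<close>. The difficulty is one-sided. A compact
  open subgroup of \<open>G\<close> meets \<open>H\<close> in a compact open subgroup of
  \<open>H\<close>, so descending to \<open>H\<close> only requires elements of \<open>H\<close>. In
  the other direction the elements are given, but the subgroup that they normalize is merely compact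
  in \<open>G\<close>, and conjugation by an element of \<open>H\<close> might expand
  \<open>G\<close> transversally to \<open>H\<close>. Willis' theory makes this a question about
  orbits: an element of the expanding part of a tidy subgroup whose forward orbit returns infinitely
  often to a compact set stays in the tidy subgroup for all time. Recurrence yields such returns
  only modulo \<open>H\<close>; the bounded orbits on a finite index subgroup of \<open>H\<close>
  control this error. Different members of a family may normalize different compact open subgroups
  of \<open>G\<close>. They are reconciled one member at a time, which is where Schlichting's
  theorem enters.\<close>

definition bdd_in :: "'a topology \<Rightarrow> 'a set \<Rightarrow> bool" where
  "bdd_in T S \<longleftrightarrow> (\<exists>K. compactin T K \<and> S \<subseteq> K)"

lemma bdd_in_subset: "bdd_in T S \<Longrightarrow> R \<subseteq> S \<Longrightarrow> bdd_in T R"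
  by (auto simp: bdd_in_def)

lemma compactin_imp_bdd_in: "compactin T S \<Longrightarrow> bdd_in T S"
  by (auto simp: bdd_in_def)

lemma bdd_in_Un: "bdd_in T R \<Longrightarrow> bdd_in T S \<Longrightarrow> bdd_in T (R \<union> S)"
  by (meson Un_mono bdd_in_def compactin_Un)

lemma bdd_in_UN:
  assumes "finite I" "\<And>i. i \<in> I \<Longrightarrow> bdd_in T (S i)"
  shows "bdd_in T (\<Union>i\<in>I. S i)"
  using assms by (induction I) (auto intro: bdd_in_Un compactin_imp_bdd_in[OF compactin_empty])

text \<open>A compact set containing \<open>S\<close> is closed, so it contains the closure of
  \<open>S\<close>. Containment in a compact set passes to subsets and products without computing
  closures.\<close>

lemma relatively_compactin_iff_bdd_in:
  assumes "Hausdorff_space T"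
  shows "relatively_compactin T S \<longleftrightarrow> bdd_in T S"
proof
  assume "relatively_compactin T S"
  then show "bdd_in T S"
    unfolding relatively_compactin_def bdd_in_def using closure_of_subset by blast
next
  assume "bdd_in T S"
  then obtain K where K: "compactin T K" "S \<subseteq> K" by (auto simp: bdd_in_def)
  then have "T closure_of S \<subseteq> K"
    using assms closure_of_minimal compactin_imp_closedin by blast
  then show "relatively_compactin T S"
    unfolding relatively_compactin_def
    using K closed_compactin compactin_subset_topspace by (metis closedin_closure_of subset_trans)
qed

text \<open>In the compact Hausdorff neighbourhood \<open>K\<close> components and quasi-components
  coincide, so \<open>{x}\<close> is a quasi-component and is separated from the compact set
  \<open>K - U\<close> by a clopen partition of \<open>K\<close>. The piece containing
  \<open>x\<close> lies in \<open>U\<close>, which makes it open in the whole space and not only in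
  \<open>K\<close>.\<close>

lemma compact_open_neighbourhood:
  assumes lc: "locally_compact_space T" and H: "Hausdorff_space T"
    and td: "totally_disconnected_space T" and x: "x \<in> topspace T"
  obtains C where "compactin T C" "openin T C" "x \<in> C"
proof -
  obtain U K where UK: "openin T U" "compactin T K" "x \<in> U" "U \<subseteq> K"
    using lc x unfolding locally_compact_space_def by blast
  define Y where "Y = subtopology T K"
  have Kt: "K \<subseteq> topspace T" using UK compactin_subset_topspace by blast
  have Yt: "topspace Y = K" using Kt by (auto simp: Y_def)
  have Yc: "compact_space Y" using UK by (simp add: Y_def compact_space_subtopology)
  have YH: "Hausdorff_space Y" using H by (simp add: Y_def Hausdorff_space_subtopology)
  have xK: "x \<in> K" using UK by auto
  have comp: "connected_component_of_set Y x = {x}"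
  proof -
    have "connectedin Y (connected_component_of_set Y x)" by (rule connectedin_connected_component_of)
    then have "connectedin T (connected_component_of_set Y x)"
      by (simp add: Y_def connectedin_subtopology)
    moreover have "x \<in> connected_component_of_set Y x"
      using xK Yt by (simp add: connected_component_of_refl)
    ultimately show ?thesis using td unfolding totally_disconnected_space_def by blast
  qed
  have quasi: "quasi_component_of_set Y x = {x}"
    using comp quasi_eq_connected_component_of[of Y x] Yc YH by simp
  then have C: "{x} \<in> quasi_components_of Y"
    unfolding quasi_components_of_def using xK Yt by (intro image_eqI[of _ _ x]) auto
  have "openin Y (K \<inter> U)"
    unfolding Y_def using UK(1) by (metis inf_commute openin_subtopology_Int)
  then have "closedin Y (K - U)"
    using Yt by (metis Diff_Int_distrib2 Diff_Int closedin_def Diff_cancel Un_empty_left closedin_diff closedin_topspace)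
  then have comp: "compactin Y (K - U)" using Yc by (simp add: closedin_compact_space)
  have "separated_between Y {x} (K - U)"
    using separated_between_quasi_component_compact[OF C comp] UK(3) by (simp add: disjnt_iff)
  then obtain A B where AB: "openin Y A" "openin Y B" "A \<union> B = K" "disjnt A B" "x \<in> A" "K - U \<subseteq> B"
    unfolding separated_between_def Yt by auto
  have AU: "A \<subseteq> U" using AB by (auto simp: disjnt_iff)
  have "A = K - B" using AB by (auto simp: disjnt_iff)
  then have "closedin Y A" using AB Yt by (metis closedin_diff closedin_topspace)
  then have "compactin Y A" using Yc by (simp add: closedin_compact_space)
  then have "compactin T A" by (simp add: Y_def compactin_subtopology)
  moreover have "openin T A"
  proof -
    obtain O' where "openin T O'" "A = O' \<inter> K" using AB(1) by (auto simp: Y_def openin_subtopology)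
    then have "A = O' \<inter> U" using AU UK(4) by auto
    then show ?thesis using \<open>openin T O'\<close> UK(1) by auto
  qed
  ultimately show thesis using that AB(5) by blast
qed

section \<open>Conjugation and cosets in abstract groups\<close>

definition (in group) conjby :: "'a \<Rightarrow> 'a \<Rightarrow> 'a" where
  "conjby g x = g \<otimes> x \<otimes> inv g"

context group
begin

lemma inv_mult_cancel [simp]: "x \<in> carrier G \<Longrightarrow> y \<in> carrier G \<Longrightarrow> inv x \<otimes> (x \<otimes> y) = y"
  by (simp flip: m_assoc)

lemma mult_inv_cancel [simp]: "x \<in> carrier G \<Longrightarrow> y \<in> carrier G \<Longrightarrow> x \<otimes> (inv x \<otimes> y) = y"
  by (simp flip: m_assoc)

lemmas group_nf = m_assoc inv_mult_group

lemma conjby_closed [simp]: "g \<in> carrier G \<Longrightarrow> x \<in> carrier G \<Longrightarrow> conjby g x \<in> carrier G"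
  by (simp add: conjby_def)

lemma conjby_mult: "g \<in> carrier G \<Longrightarrow> x \<in> carrier G \<Longrightarrow> y \<in> carrier G \<Longrightarrow> conjby g (x \<otimes> y) = conjby g x \<otimes> conjby g y"
  by (simp add: conjby_def group_nf)

lemma conjby_inv: "g \<in> carrier G \<Longrightarrow> x \<in> carrier G \<Longrightarrow> conjby g (inv x) = inv (conjby g x)"
  by (simp add: conjby_def group_nf)

lemma conjby_one_right [simp]: "g \<in> carrier G \<Longrightarrow> conjby g \<one> = \<one>"
  by (simp add: conjby_def)

lemma conjby_one_left [simp]: "x \<in> carrier G \<Longrightarrow> conjby \<one> x = x"
  by (simp add: conjby_def)

lemma conjby_conjby: "g \<in> carrier G \<Longrightarrow> h \<in> carrier G \<Longrightarrow> x \<in> carrier G \<Longrightarrow> conjby g (conjby h x) = conjby (g \<otimes> h) x"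
  by (simp add: conjby_def group_nf)

lemma conjby_inv_cancel [simp]:
  "g \<in> carrier G \<Longrightarrow> x \<in> carrier G \<Longrightarrow> conjby g (conjby (inv g) x) = x"
  "g \<in> carrier G \<Longrightarrow> x \<in> carrier G \<Longrightarrow> conjby (inv g) (conjby g x) = x"
  by (simp_all add: conjby_conjby)

lemma mem_conjby_image_iff:
  assumes "g \<in> carrier G" "S \<subseteq> carrier G" "x \<in> carrier G"
  shows "x \<in> conjby g ` S \<longleftrightarrow> conjby (inv g) x \<in> S"
proof
  assume "x \<in> conjby g ` S"
  then show "conjby (inv g) x \<in> S" using assms by (auto simp: conjby_conjby subset_iff)
next
  assume "conjby (inv g) x \<in> S"
  then show "x \<in> conjby g ` S" using assms by (intro image_eqI[of _ _ "conjby (inv g) x"]) auto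
qed

lemma conjby_image_comp:
  "g \<in> carrier G \<Longrightarrow> h \<in> carrier G \<Longrightarrow> S \<subseteq> carrier G \<Longrightarrow> conjby g ` conjby h ` S = conjby (g \<otimes> h) ` S"
  by (auto simp: conjby_conjby subset_iff image_iff) 

lemma conjby_image_one [simp]: "S \<subseteq> carrier G \<Longrightarrow> conjby \<one> ` S = S"
  by (auto simp: subset_iff image_iff)

lemma conjby_image_subset_carrier: "g \<in> carrier G \<Longrightarrow> S \<subseteq> carrier G \<Longrightarrow> conjby g ` S \<subseteq> carrier G"
  by auto

lemma subgroup_conjby_image:
  assumes "g \<in> carrier G" "subgroup S G"
  shows "subgroup (conjby g ` S) G"
proof -
  have S: "S \<subseteq> carrier G" using assms subgroup.subset by blast
  show ?thesis
  proof
    show "conjby g ` S \<subseteq> carrier G" using S assms by auto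
    show "x \<otimes> y \<in> conjby g ` S" if "x \<in> conjby g ` S" "y \<in> conjby g ` S" for x y
      using that S assms by (auto simp: subset_iff subgroup.m_closed simp flip: conjby_mult)
    show "\<one> \<in> conjby g ` S" using assms by (intro image_eqI[of _ _ \<one>]) (auto simp: subgroup.one_closed)
    show "inv x \<in> conjby g ` S" if "x \<in> conjby g ` S" for x
      using that S assms by (auto simp: subset_iff subgroup.m_inv_closed simp flip: conjby_inv)
  qed
qed

lemma l_coset_r_coset_eq_conjby_image:
  assumes "g \<in> carrier G" "S \<subseteq> carrier G"
  shows "g <# S #> inv g = conjby g ` S"
  by (auto simp: l_coset_def r_coset_def conjby_def)

lemma set_mult_iff: "x \<in> S <#> R \<longleftrightarrow> (\<exists>s\<in>S. \<exists>r\<in>R. x = s \<otimes> r)"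
  by (auto simp: set_mult_def)

lemma l_coset_iff: "x \<in> g <# R \<longleftrightarrow> (\<exists>r\<in>R. x = g \<otimes> r)"
  by (auto simp: l_coset_def)

lemma mem_l_coset_iff:
  assumes "g \<in> carrier G" "S \<subseteq> carrier G" "x \<in> carrier G"
  shows "x \<in> g <# S \<longleftrightarrow> inv g \<otimes> x \<in> S"
  using assms by (force simp: l_coset_iff subset_iff)

end

section \<open>Translates, products and finite coset covers in topological groups\<close>

context topological_group
begin

lemma carrier_topspace [simp]: "topspace T = carrier G"
  by (rule topspace_eq_carrier)

lemma openin_subset_carrier: "openin T U \<Longrightarrow> U \<subseteq> carrier G"
  using openin_subset by fastforce

lemma compactin_subset_carrier: "compactin T U \<Longrightarrow> U \<subseteq> carrier G"
  using compactin_subset_topspace by fastforce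

lemma continuous_map_mult:
  assumes "continuous_map X T f" "continuous_map X T g"
  shows "continuous_map X T (\<lambda>x. f x \<otimes> g x)"
proof -
  have "continuous_map X (prod_topology T T) (\<lambda>x. (f x, g x))"
    using assms by (simp add: continuous_map_pairedI)
  from continuous_map_compose[OF this continuous_mult] show ?thesis
    by (simp add: o_def)
qed

lemma continuous_map_lmult: "g \<in> carrier G \<Longrightarrow> continuous_map T T (\<lambda>x. g \<otimes> x)"
  by (intro continuous_map_mult) auto

lemma continuous_map_rmult: "g \<in> carrier G \<Longrightarrow> continuous_map T T (\<lambda>x. x \<otimes> g)"
  by (intro continuous_map_mult) auto

lemma continuous_map_conjby: "g \<in> carrier G \<Longrightarrow> continuous_map T T (conjby g)"
  unfolding conjby_def[abs_def] by (intro continuous_map_mult) auto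

lemma openin_preimage: "continuous_map T T f \<Longrightarrow> openin T U \<Longrightarrow> openin T {x \<in> carrier G. f x \<in> U}"
  using openin_continuous_map_preimage by fastforce

lemma closedin_preimage: "continuous_map T T f \<Longrightarrow> closedin T U \<Longrightarrow> closedin T {x \<in> carrier G. f x \<in> U}"
  using closedin_continuous_map_preimage by fastforce

lemma conjby_image_eq_preimage:
  assumes "g \<in> carrier G" "S \<subseteq> carrier G"
  shows "conjby g ` S = {x \<in> carrier G. conjby (inv g) x \<in> S}"
  using assms by (auto simp: subset_iff image_iff) (metis conjby_closed conjby_inv_cancel(1) inv_closed)

lemma openin_conjby: "g \<in> carrier G \<Longrightarrow> openin T U \<Longrightarrow> openin T (conjby g ` U)"
  using openin_preimage[OF continuous_map_conjby[of "inv g"]]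
  by (simp add: conjby_image_eq_preimage openin_subset_carrier)

lemma compactin_conjby: "g \<in> carrier G \<Longrightarrow> compactin T U \<Longrightarrow> compactin T (conjby g ` U)"
  using continuous_map_conjby image_compactin by blast

lemma openin_l_coset: "g \<in> carrier G \<Longrightarrow> openin T U \<Longrightarrow> openin T (g <# U)"
proof -
  assume a: "g \<in> carrier G" "openin T U"
  have "g <# U = {x \<in> carrier G. inv g \<otimes> x \<in> U}"
    using a openin_subset_carrier[OF a(2)] by (auto simp: mem_l_coset_iff l_coset_iff subset_iff)
       (metis inv_closed inv_inv inv_mult_cancel)
  then show ?thesis using openin_preimage[OF continuous_map_lmult[of "inv g"]] a by simp
qed

lemma openin_rmult: "g \<in> carrier G \<Longrightarrow> openin T U \<Longrightarrow> openin T ((\<lambda>x. x \<otimes> g) ` U)"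
proof -
  assume a: "g \<in> carrier G" "openin T U"
  have "(\<lambda>x. x \<otimes> g) ` U = {x \<in> carrier G. x \<otimes> inv g \<in> U}"
    using a openin_subset_carrier[OF a(2)] by (force simp: m_assoc subset_iff image_iff)
  then show ?thesis using openin_preimage[OF continuous_map_rmult[of "inv g"]] a by simp
qed

lemma openin_set_mult_right:
  assumes "S \<subseteq> carrier G" "openin T U" shows "openin T (S <#> U)"
proof -
  have "S <#> U = (\<Union>s\<in>S. s <# U)" by (auto simp: set_mult_def l_coset_def)
  moreover have "openin T (s <# U)" if "s \<in> S" for s using that assms openin_l_coset by blast
  ultimately show ?thesis by auto
qed

lemma openin_set_mult_left:
  assumes "S \<subseteq> carrier G" "openin T U" shows "openin T (U <#> S)"
proof -
  have "U <#> S = (\<Union>s\<in>S. (\<lambda>x. x \<otimes> s) ` U)" by (auto simp: set_mult_def)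
  moreover have "openin T ((\<lambda>x. x \<otimes> s) ` U)" if "s \<in> S" for s using that assms openin_rmult by blast
  ultimately show ?thesis by auto
qed

lemma compactin_set_mult:
  assumes "compactin T K" "compactin T L" shows "compactin T (K <#> L)"
proof -
  have "compactin (prod_topology T T) (K \<times> L)" using assms by (simp add: compactin_Times)
  from image_compactin[OF this continuous_mult]
  have "compactin T ((\<lambda>(x, y). x \<otimes> y) ` (K \<times> L))" .
  moreover have "(\<lambda>(x, y). x \<otimes> y) ` (K \<times> L) = K <#> L" by (auto simp: set_mult_def)
  ultimately show ?thesis by simp
qed

lemma bdd_in_set_mult: "bdd_in T K \<Longrightarrow> bdd_in T L \<Longrightarrow> bdd_in T (K <#> L)"
  unfolding bdd_in_def by (meson compactin_set_mult mono_set_mult)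

lemma compactin_inv_image: "compactin T K \<Longrightarrow> compactin T ((\<lambda>x. inv x) ` K)"
  using continuous_inv image_compactin by blast

lemma bdd_in_inv_image: "bdd_in T K \<Longrightarrow> bdd_in T ((\<lambda>x. inv x) ` K)"
  unfolding bdd_in_def by (meson compactin_inv_image image_mono)

lemma bdd_in_singleton: "g \<in> carrier G \<Longrightarrow> bdd_in T {g}"
  by (intro compactin_imp_bdd_in) simp

lemma openin_subgroup_of_open:
  assumes P: "subgroup P G" and U: "openin T U" "U \<noteq> {}" "U \<subseteq> P"
  shows "openin T P"
proof -
  have eq: "P <#> U = P"
  proof
    show "P <#> U \<subseteq> P" using subgroup.m_closed[OF P] U by (auto simp: set_mult_iff subset_iff)
    obtain u where u: "u \<in> U" using U by blast
    show "P \<subseteq> P <#> U"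
    proof
      fix x assume x: "x \<in> P"
      have "x = (x \<otimes> inv u) \<otimes> u" using x u P U by (simp add: m_assoc subgroup.mem_carrier subset_iff)
      then show "x \<in> P <#> U" using x u P U unfolding set_mult_iff
        by (meson subgroup.m_closed subgroup.m_inv_closed subset_iff)
    qed
  qed
  have "openin T (P <#> U)" by (rule openin_set_mult_right[OF subgroup.subset[OF P] U(1)])
  then show ?thesis by (simp only: eq)
qed

lemma closedin_open_subgroup:
  assumes U: "subgroup U G" "openin T U" shows "closedin T U"
proof -
  have eq: "(carrier G - U) <#> U = carrier G - U"
  proof
    show "carrier G - U \<subseteq> (carrier G - U) <#> U"
      unfolding set_mult_iff subset_iff using subgroup.one_closed[OF U(1)] r_one by (metis Diff_iff)
    show "(carrier G - U) <#> U \<subseteq> carrier G - U"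
    proof
      fix x assume "x \<in> (carrier G - U) <#> U"
      then obtain s u where su: "s \<in> carrier G - U" "u \<in> U" "x = s \<otimes> u" by (auto simp: set_mult_iff)
      have uc: "u \<in> carrier G" using U su subgroup.mem_carrier by fast
      have "s = x \<otimes> inv u" using su uc by (simp add: m_assoc)
      then have "x \<notin> U" using su(1) subgroup.m_closed[OF U(1)] subgroup.m_inv_closed[OF U(1) su(2)] by auto
      then show "x \<in> carrier G - U" using su uc by auto
    qed
  qed
  have "openin T ((carrier G - U) <#> U)" by (rule openin_set_mult_right[OF Diff_subset U(2)])
  then have "openin T (carrier G - U)" by (simp only: eq)
  then show ?thesis using U by (simp add: closedin_def openin_subset_carrier)
qed

lemma compact_finite_cover:
  assumes K: "compactin T K" and U: "subgroup U G" "openin T U"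
  obtains F where "finite F" "F \<subseteq> K" "K \<subseteq> F <#> U"
proof -
  have Kc: "K \<subseteq> carrier G" by (rule compactin_subset_carrier[OF K])
  have op: "openin T V" if "V \<in> (\<lambda>x. x <# U) ` K" for V using that openin_l_coset U Kc by auto
  have cov: "K \<subseteq> \<Union>((\<lambda>x. x <# U) ` K)"
  proof
    fix x assume "x \<in> K"
    moreover have "x \<in> x <# U"
      unfolding l_coset_iff using \<open>x \<in> K\<close> Kc U by (metis r_one subgroup.one_closed subsetD)
    ultimately show "x \<in> \<Union>((\<lambda>x. x <# U) ` K)" by blast
  qed
  from compactinD[OF K op cov] obtain \<F> where \<F>: "finite \<F>" "\<F> \<subseteq> (\<lambda>x. x <# U) ` K" "K \<subseteq> \<Union>\<F>"
    by auto
  from finite_subset_image[OF this(1,2)]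
  obtain F where F: "finite F" "F \<subseteq> K" "\<F> = (\<lambda>x. x <# U) ` F"
    by auto
  have "K \<subseteq> F <#> U"
  proof
    fix x assume "x \<in> K"
    then obtain f where "f \<in> F" "x \<in> f <# U" using \<F>(3) F(3) by auto
    then show "x \<in> F <#> U" by (auto simp: l_coset_iff set_mult_iff)
  qed
  then show thesis using that F by blast
qed

text \<open>Finitely many cosets of \<open>U\<close> cover \<open>K\<close>. This turns a vague
  return to a compact set into an algebraic one: values in the same coset differ by an element of
  \<open>U\<close>.\<close>

lemma compact_pigeonhole:
  assumes K: "compactin T K" and U: "subgroup U G" "openin T U"
    and I: "infinite {n \<in> I. f n \<in> K}"
  obtains k where "k \<in> K" "infinite {n \<in> I. f n \<in> k <# U}"
proof -
  obtain F where F: "finite F" "F \<subseteq> K" "K \<subseteq> F <#> U" using compact_finite_cover[OF K U] .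
  have "{n \<in> I. f n \<in> K} \<subseteq> (\<Union>k\<in>F. {n \<in> I. f n \<in> k <# U})"
  proof
    fix n assume n: "n \<in> {n \<in> I. f n \<in> K}"
    then obtain k u where "k \<in> F" "u \<in> U" "f n = k \<otimes> u" using F(3) by (auto simp: set_mult_iff subset_iff)
    then show "n \<in> (\<Union>k\<in>F. {n \<in> I. f n \<in> k <# U})" using n by (auto simp: l_coset_iff)
  qed
  then have "\<exists>k\<in>F. infinite {n \<in> I. f n \<in> k <# U}"
    using I F(1) by (meson finite_UN finite_subset)
  then show thesis using that F by blast
qed

end

locale hausdorff_group = topological_group +
  assumes Hausdorff': "Hausdorff_space T"

sublocale locally_compact_group \<subseteq> hausdorff_group
  by unfold_locales (rule Hausdorff)

context hausdorff_group
begin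

lemma compactin_imp_closed: "compactin T K \<Longrightarrow> closedin T K"
  using Hausdorff' compactin_imp_closedin by blast

lemma bdd_in_closure: "bdd_in T S \<Longrightarrow> compactin T (T closure_of S)"
  using relatively_compactin_iff_bdd_in[OF Hausdorff'] unfolding relatively_compactin_def by blast

end

lemma subgroup_set_mult:
  fixes G (structure)
  assumes "group G" "subgroup U G" "subgroup V G" "\<And>v. v \<in> V \<Longrightarrow> group.conjby G v ` U \<subseteq> U"
  shows "subgroup (U <#> V) G" "U <#> V = V <#> U"
proof -
  interpret group G by fact
  have Uc: "U \<subseteq> carrier G" and Vc: "V \<subseteq> carrier G"
    using subgroup.subset[OF assms(2)] subgroup.subset[OF assms(3)] by auto
  have conjby: "conjby v u \<in> U" if "v \<in> V" "u \<in> U" for u v using assms that by auto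
  have iV: "inv v \<in> V" if "v \<in> V" for v using assms that by (simp add: subgroup.m_inv_closed)
  have a: "v \<otimes> u = conjby v u \<otimes> v" if "v \<in> V" "u \<in> U" for u v
    using that Uc Vc by (simp add: conjby_def subset_iff m_assoc)
  have b: "u \<otimes> v = v \<otimes> conjby (inv v) u" if "v \<in> V" "u \<in> U" for u v
    using that Uc Vc by (simp add: conjby_def subset_iff m_assoc)
  show eq: "U <#> V = V <#> U"
  proof
    show "U <#> V \<subseteq> V <#> U" unfolding set_mult_iff subset_iff using b conjby iV by metis
    show "V <#> U \<subseteq> U <#> V" unfolding set_mult_iff subset_iff using a conjby by metis
  qed
  show "subgroup (U <#> V) G"
  proof
    show "U <#> V \<subseteq> carrier G" using Uc Vc by (rule set_mult_closed)
    show "\<one> \<in> U <#> V" using assms unfolding set_mult_iff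
      by (metis one_closed r_one subgroup.one_closed)
    show "x \<otimes> y \<in> U <#> V" if xy: "x \<in> U <#> V" "y \<in> U <#> V" for x y
    proof -
      obtain u v u' v' where d: "u \<in> U" "v \<in> V" "x = u \<otimes> v" "u' \<in> U" "v' \<in> V" "y = u' \<otimes> v'"
        using xy by (auto simp: set_mult_iff)
      then have "x \<otimes> y = (u \<otimes> conjby v u') \<otimes> (v \<otimes> v')"
        using Uc Vc by (simp add: conjby_def subset_iff group_nf)
      moreover have "u \<otimes> conjby v u' \<in> U" "v \<otimes> v' \<in> V" using d conjby assms by (auto simp: subgroup.m_closed)
      ultimately show ?thesis by (auto simp: set_mult_iff)
    qed
    show "inv x \<in> U <#> V" if x: "x \<in> U <#> V" for x
    proof -
      obtain u v where d: "u \<in> U" "v \<in> V" "x = u \<otimes> v" using x by (auto simp: set_mult_iff)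
      then have "inv x = inv v \<otimes> inv u" using Uc Vc by (simp add: inv_mult_group subset_iff)
      moreover have "inv v \<in> V" "inv u \<in> U" using d assms by (auto simp: subgroup.m_inv_closed)
      ultimately show ?thesis unfolding eq by (auto simp: set_mult_iff)
    qed
  qed
qed

section \<open>Compact open subgroups\<close>
context group
begin

text \<open>The right stabilizer of \<open>C\<close>. For a compact open \<open>C\<close> containing
  the identity it is the compact open subgroup of van Dantzig's theorem.\<close>

lemma stabilizer_subgroup:
  assumes "C \<subseteq> carrier G"
  shows "subgroup {x \<in> carrier G. (\<forall>c\<in>C. c \<otimes> x \<in> C) \<and> (\<forall>c\<in>C. c \<otimes> inv x \<in> C)} G"
proof
  show "{x \<in> carrier G. (\<forall>c\<in>C. c \<otimes> x \<in> C) \<and> (\<forall>c\<in>C. c \<otimes> inv x \<in> C)} \<subseteq> carrier G" by auto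
  show "\<one> \<in> {x \<in> carrier G. (\<forall>c\<in>C. c \<otimes> x \<in> C) \<and> (\<forall>c\<in>C. c \<otimes> inv x \<in> C)}"
    using assms by (auto simp: subset_iff)
  fix x assume x: "x \<in> {x \<in> carrier G. (\<forall>c\<in>C. c \<otimes> x \<in> C) \<and> (\<forall>c\<in>C. c \<otimes> inv x \<in> C)}"
  then show "inv x \<in> {x \<in> carrier G. (\<forall>c\<in>C. c \<otimes> x \<in> C) \<and> (\<forall>c\<in>C. c \<otimes> inv x \<in> C)}" by auto
  fix y assume y: "y \<in> {x \<in> carrier G. (\<forall>c\<in>C. c \<otimes> x \<in> C) \<and> (\<forall>c\<in>C. c \<otimes> inv x \<in> C)}"
  have "c \<otimes> (x \<otimes> y) \<in> C" if "c \<in> C" for c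
  proof -
    have "c \<in> carrier G" using that assms by auto
    then have "c \<otimes> (x \<otimes> y) = (c \<otimes> x) \<otimes> y" using x y by (simp add: m_assoc)
    then show ?thesis using x y that by auto
  qed
  moreover have "c \<otimes> inv (x \<otimes> y) \<in> C" if "c \<in> C" for c
  proof -
    have "c \<in> carrier G" using that assms by auto
    then have "c \<otimes> inv (x \<otimes> y) = (c \<otimes> inv y) \<otimes> inv x" using x y by (simp add: group_nf)
    then show ?thesis using x y that by auto
  qed
  ultimately show "x \<otimes> y \<in> {x \<in> carrier G. (\<forall>c\<in>C. c \<otimes> x \<in> C) \<and> (\<forall>c\<in>C. c \<otimes> inv x \<in> C)}"
    using x y by auto
qed

end

definition (in topological_group) compact_open :: "'a set \<Rightarrow> bool" where
  "compact_open U \<longleftrightarrow> subgroup U G \<and> compactin T U \<and> openin T U"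

context topological_group
begin

lemma compact_openD: "compact_open U \<Longrightarrow> subgroup U G" "compact_open U \<Longrightarrow> compactin T U" "compact_open U \<Longrightarrow> openin T U"
  by (auto simp: compact_open_def)

lemma compact_open_subset: "compact_open U \<Longrightarrow> U \<subseteq> carrier G"
  by (simp add: compact_open_def subgroup.subset)

lemma compact_open_conjby: "g \<in> carrier G \<Longrightarrow> compact_open U \<Longrightarrow> compact_open (conjby g ` U)"
  by (simp add: compact_open_def subgroup_conjby_image compactin_conjby openin_conjby)

lemma compact_open_one: "compact_open U \<Longrightarrow> \<one> \<in> U"
  by (simp add: compact_open_def subgroup.one_closed)

text \<open>Two values in one left coset \<open>k <# U\<close> suffice: \<open>k\<close> cancels in
  \<open>inv (f p) \<otimes> f q\<close>.\<close>

lemma compact_returns: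
  fixes f :: "nat \<Rightarrow> 'a"
  assumes K: "compactin T K" and U: "compact_open U" and I: "infinite I" "\<And>n. n \<in> I \<Longrightarrow> f n \<in> K"
  obtains p q where "p \<in> I" "q \<in> I" "p < q" "inv (f p) \<otimes> f q \<in> U"
proof -
  have Us: "subgroup U G" by (rule compact_openD(1)[OF U])
  have "{n \<in> I. f n \<in> K} = I" using I(2) by auto
  then have "infinite {n \<in> I. f n \<in> K}" using I(1) by simp
  from compact_pigeonhole[OF K compact_openD(1,3)[OF U] this]
  obtain k where k: "k \<in> K" "infinite {n \<in> I. f n \<in> k <# U}" .
  have kc: "k \<in> carrier G" using k(1) compactin_subset_carrier[OF K] by blast
  obtain p where p: "p \<in> I" "f p \<in> k <# U" using infinite_imp_nonempty[OF k(2)] by blast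
  obtain q where q: "q > p" "q \<in> I" "f q \<in> k <# U" using k(2) unfolding infinite_nat_iff_unbounded by auto
  obtain u v where uv: "u \<in> U" "f p = k \<otimes> u" "v \<in> U" "f q = k \<otimes> v" using p q by (auto simp: l_coset_iff)
  have "u \<in> carrier G" "v \<in> carrier G" using uv compact_open_subset[OF U] by auto
  then have "inv (f p) \<otimes> f q = inv u \<otimes> v" unfolding uv(2,4) using kc by (simp add: group_nf)
  also have "\<dots> \<in> U" by (rule subgroup.m_closed[OF Us subgroup.m_inv_closed[OF Us uv(1)] uv(3)])
  finally show thesis using that p(1) q by blast
qed

end

context hausdorff_group
begin

lemma compact_open_Int: "compact_open U \<Longrightarrow> compact_open V \<Longrightarrow> compact_open (U \<inter> V)"
  unfolding compact_open_def
  by (meson compact_Int_closedin compactin_imp_closed openin_Int subgroups_Inter_pair)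

lemma compact_open_INT:
  assumes "finite I" "I \<noteq> {}" "\<And>i. i \<in> I \<Longrightarrow> compact_open (S i)"
  shows "compact_open (\<Inter>i\<in>I. S i)"
  using assms by (induction I rule: finite_ne_induct) (auto intro: compact_open_Int)

text \<open>\<open>W\<close> is the intersection of all conjugates of \<open>U\<close> by elements
  of \<open>L\<close>. If \<open>inv l = f \<otimes> u\<close> with \<open>u\<close> in
  \<open>U\<close>, then the condition at \<open>l\<close> is the one for the conjugate of
  \<open>U\<close> by \<open>f\<close>, so compactness of \<open>L\<close> leaves finitely many
  conjugates and the intersection stays open.\<close>

lemma core_compact:
  assumes L: "compactin T L" "subgroup L G" and U: "compact_open U"
  obtains W where "compact_open W" "W \<subseteq> U" "\<And>l. l \<in> L \<Longrightarrow> conjby l ` W = W"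
    "\<And>W'. W' \<subseteq> carrier G \<Longrightarrow> (\<And>l. l \<in> L \<Longrightarrow> conjby l ` W' \<subseteq> U) \<Longrightarrow> W' \<subseteq> W"
proof -
  have Lc: "L \<subseteq> carrier G" by (rule subgroup.subset[OF L(2)])
  have Uc: "U \<subseteq> carrier G" by (rule compact_open_subset[OF U])
  define W where "W = {x \<in> carrier G. \<forall>l\<in>L. conjby l x \<in> U}"
  obtain F where F: "finite F" "F \<subseteq> L" "L \<subseteq> F <#> U" 
    by (rule compact_finite_cover[OF L(1) compact_openD(1,3)[OF U]])
  have Fne: "F \<noteq> {}" 
  proof
    assume "F = {}"
    then have "L \<subseteq> {}" using F(3) by (simp add: set_mult_def)
    then show False using subgroup.one_closed[OF L(2)] by blast
  qed
  have WF: "W = (\<Inter>f\<in>F. conjby f ` U)"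
  proof
    show "W \<subseteq> (\<Inter>f\<in>F. conjby f ` U)"
    proof (intro subsetI INT_I)
      fix x f assume x: "x \<in> W" and f: "f \<in> F"
      then have "inv f \<in> L" using F(2) subgroup.m_inv_closed[OF L(2)] by blast
      then show "x \<in> conjby f ` U" using x f F Lc Uc by (subst mem_conjby_image_iff) (auto simp: W_def)
    qed
    show "(\<Inter>f\<in>F. conjby f ` U) \<subseteq> W"
    proof
      fix x assume x: "x \<in> (\<Inter>f\<in>F. conjby f ` U)"
      obtain f0 where f0: "f0 \<in> F" using Fne by blast
      then have "f0 \<in> carrier G" using F(2) Lc by blast
      then have xc: "x \<in> carrier G" using conjby_image_subset_carrier[OF _ Uc] x f0 by blast
      have "conjby l x \<in> U" if l: "l \<in> L" for l
      proof -
        have "inv l \<in> L" using l subgroup.m_inv_closed[OF L(2)] by blast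
        then obtain f u where fu: "f \<in> F" "u \<in> U" "inv l = f \<otimes> u" using F by (auto simp: set_mult_iff subset_iff)
        have c: "f \<in> carrier G" "u \<in> carrier G" "l \<in> carrier G" using fu F Lc Uc l by auto
        have "l = inv u \<otimes> inv f" using fu(3) c by (metis inv_inv inv_mult_group)
        then have "conjby l x = conjby (inv u) (conjby (inv f) x)" using c xc by (simp add: conjby_conjby)
        moreover have "conjby (inv f) x \<in> U" using x fu c xc Uc by (subst mem_conjby_image_iff[symmetric]) auto
        ultimately show ?thesis using fu U c by (simp add: conjby_def compact_open_def subgroup.m_closed subgroup.m_inv_closed)
      qed
      then show "x \<in> W" using xc by (auto simp: W_def)
    qed
  qed
  have A1: "compact_open W" unfolding WF using F Fne Lc U by (intro compact_open_INT) (auto intro: compact_open_conjby)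
  have A2: "W \<subseteq> U"
  proof
    fix x assume x: "x \<in> W"
    then have "conjby \<one> x \<in> U" using subgroup.one_closed[OF L(2)] unfolding W_def by blast
    then show "x \<in> U" using x by (simp add: W_def)
  qed
  have sub: "conjby l ` W \<subseteq> W" if "l \<in> L" for l
  proof
    fix y assume "y \<in> conjby l ` W"
    then obtain x where x: "x \<in> W" "y = conjby l x" by auto
    have "conjby m y \<in> U" if "m \<in> L" for m
    proof -
      have "m \<otimes> l \<in> L" using that \<open>l \<in> L\<close> subgroup.m_closed[OF L(2)] by blast
      then have "conjby (m \<otimes> l) x \<in> U" using x by (auto simp: W_def)
      then show ?thesis using x that \<open>l \<in> L\<close> Lc by (auto simp: W_def conjby_conjby subset_iff)
    qed
    then show "y \<in> W" using x that Lc by (auto simp: W_def)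
  qed
  have A3: "conjby l ` W = W" if "l \<in> L" for l
  proof
    show "conjby l ` W \<subseteq> W" by (rule sub[OF that])
    show "W \<subseteq> conjby l ` W"
    proof
      fix x assume x: "x \<in> W"
      have "inv l \<in> L" using that subgroup.m_inv_closed[OF L(2)] by blast
      then have "conjby (inv l) x \<in> W" using sub x by blast
      then show "x \<in> conjby l ` W" using x that Lc by (subst mem_conjby_image_iff) (auto simp: W_def)
    qed
  qed
  have A4: "W' \<subseteq> W" if "W' \<subseteq> carrier G" "\<And>l. l \<in> L \<Longrightarrow> conjby l ` W' \<subseteq> U" for W'
    using that by (auto simp: W_def)
  show thesis by (rule that[OF A1 A2 A3 A4])
qed

text \<open>The core of \<open>U\<close> under \<open>V\<close> is normalized by \<open>V\<close>,
  so its product with \<open>V\<close> is a group; one factor makes it open, and both are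
  compact.\<close>

lemma compact_open_containing:
  assumes V: "compactin T V" "subgroup V G" and U: "compact_open U"
  obtains W where "compact_open W" "V \<subseteq> W"
proof -
  obtain W where W: "compact_open W" "W \<subseteq> U" "\<And>l. l \<in> V \<Longrightarrow> conjby l ` W = W"
    by (rule core_compact[OF V U]) blast
  have Vc: "V \<subseteq> carrier G" by (rule subgroup.subset[OF V(2)])
  have "subgroup (W <#> V) G"
    using subgroup_set_mult(1)[OF is_group, of W V] W V compact_openD by auto
  moreover have "compactin T (W <#> V)" using W V by (simp add: compactin_set_mult compact_openD)
  moreover have "openin T (W <#> V)" using W Vc by (simp add: openin_set_mult_left compact_openD)
  moreover have "V \<subseteq> W <#> V"
  proof
    fix v assume "v \<in> V"
    then show "v \<in> W <#> V" unfolding set_mult_iff using compact_open_one[OF W(1)] Vc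
      by (metis l_one subsetD)
  qed
  ultimately show thesis using that by (simp add: compact_open_def)
qed

end

context tdlc_group
begin

text \<open>Van Dantzig's theorem. Wallace's theorem, applied to the compact open \<open>C\<close>
  and the identity, gives a neighbourhood \<open>B\<close> of the identity with
  \<open>C <#> B\<close> inside \<open>C\<close>. The right stabilizer of \<open>C\<close> then
  contains the symmetric part of \<open>B\<close>, and it lies in \<open>C\<close> because
  \<open>C\<close> contains the identity.\<close>

lemma van_Dantzig: obtains U where "compact_open U"
proof -
  obtain C where C: "compactin T C" "openin T C" "\<one> \<in> C"
    by (rule compact_open_neighbourhood[OF locally_compact Hausdorff totally_disconnected, of \<one>]) auto
  have Cc: "C \<subseteq> carrier G" by (rule openin_subset_carrier[OF C(2)])
  define W where "W = {z \<in> topspace (prod_topology T T). (\<lambda>(x, y). x \<otimes> y) z \<in> C}"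
  have "openin (prod_topology T T) W"
    unfolding W_def by (rule openin_continuous_map_preimage[OF continuous_mult C(2)])
  moreover have "C \<times> {\<one>} \<subseteq> W" using Cc by (auto simp: W_def)
  ultimately obtain A B where AB: "openin T A" "openin T B" "C \<subseteq> A" "{\<one>} \<subseteq> B" "A \<times> B \<subseteq> W"
    using Wallace_theorem_prod_topology[of T C T "{\<one>}" W] C(1) by auto
  define P where "P = {x \<in> carrier G. (\<forall>c\<in>C. c \<otimes> x \<in> C) \<and> (\<forall>c\<in>C. c \<otimes> inv x \<in> C)}"
  have P: "subgroup P G" unfolding P_def by (rule stabilizer_subgroup[OF Cc])
  have m: "c \<otimes> b \<in> C" if "c \<in> C" "b \<in> B" for c b using AB(3,5) that by (auto simp: W_def subset_iff)
  define O' where "O' = B \<inter> {x \<in> carrier G. inv x \<in> B}"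
  have "openin T O'" unfolding O'_def using AB openin_preimage[OF continuous_inv] by auto
  moreover have "\<one> \<in> O'" using AB by (auto simp: O'_def)
  moreover have "O' \<subseteq> P" using m by (auto simp: O'_def P_def)
  ultimately have "openin T P" using openin_subgroup_of_open[OF P] by blast
  moreover have "P \<subseteq> C" using C(3) by (force simp: P_def)
  ultimately have "compact_open P"
    using P C(1) closedin_open_subgroup by (meson compact_open_def closed_compactin)
  then show thesis using that by blast
qed

end

section \<open>Tidy subgroups\<close>
lemma nested_compact_subset_open:
  assumes H: "Hausdorff_space X" and C: "\<And>n::nat. compactin X (C n)" and dec: "\<And>n. C (Suc n) \<subseteq> C n"
    and I: "(\<Inter>n. C n) \<subseteq> U" and U: "openin X U"
  obtains n where "C n \<subseteq> U"
proof -
  have anti: "C n \<subseteq> C m" if "m \<le> n" for m n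
    using lift_Suc_antimono_le[of C, OF dec that] .
  have op: "openin X V" if "V \<in> insert U (range (\<lambda>n. topspace X - C n))" for V
    using that U C[THEN compactin_imp_closedin[OF H]] by auto
  have cov: "C 0 \<subseteq> \<Union> (insert U (range (\<lambda>n. topspace X - C n)))"
    using I compactin_subset_topspace[OF C[of 0]] by auto
  from compactinD[OF C[of 0] op cov]
  obtain \<F> where F: "finite \<F>" "\<F> \<subseteq> insert U (range (\<lambda>n. topspace X - C n))" "C 0 \<subseteq> \<Union>\<F>"
    by auto
  have "finite (\<F> - {U})" "\<F> - {U} \<subseteq> range (\<lambda>n. topspace X - C n)" using F by auto
  from finite_subset_image[OF this] obtain M where M: "finite M" "\<F> - {U} = (\<lambda>n. topspace X - C n) ` M"
    by auto
  define N where "N = Max (insert 0 M)"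
  have "C N \<subseteq> U"
  proof
    fix x assume x: "x \<in> C N"
    have "x \<in> C m" if "m \<in> M" for m
    proof -
      have "m \<le> N" using that M(1) by (simp add: N_def)
      then show ?thesis using anti x by blast
    qed
    moreover have "x \<in> C 0" using anti[of 0 N] x by auto
    ultimately show "x \<in> U" using F(3) M(2) by blast
  qed
  then show thesis by (rule that)
qed

lemma nested_compact_nonempty:
  assumes "Hausdorff_space X" "\<And>n::nat. compactin X (C n)" "\<And>n. C (Suc n) \<subseteq> C n" "\<And>n. C n \<noteq> {}"
  shows "(\<Inter>n. C n) \<noteq> {}"
proof
  assume "(\<Inter>n. C n) = {}"
  then have "(\<Inter>n. C n) \<subseteq> {}" by simp
  from nested_compact_subset_open[OF assms(1-3) this openin_empty] assms(4) show False by blast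
qed

section \<open>Iterated conjugation and groups defined by orbits\<close>

definition (in group) conjpow :: "'a \<Rightarrow> int \<Rightarrow> 'a \<Rightarrow> 'a" where
  "conjpow a n = conjby (a [^] n)"

text \<open>In Willis' notation for conjugation by \<open>a\<close> this is \<open>W_-\<close>, the
  intersection of the preimages of \<open>W\<close> under all nonnegative powers, and
  \<open>forward (inv a) W\<close> is \<open>W_+\<close>.\<close>

definition (in group) forward :: "'a \<Rightarrow> 'a set \<Rightarrow> 'a set" where
  "forward a W = {x \<in> carrier G. \<forall>n::nat. conjpow a (int n) x \<in> W}"

text \<open>The group whose closure is the obstruction to Willis' tidiness below: its elements may
  leave \<open>W\<close> for finitely many times only.\<close>

definition (in group) tails :: "'a \<Rightarrow> 'a set \<Rightarrow> 'a set" where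
  "tails a W = {x \<in> carrier G. \<exists>M::nat. \<forall>n\<ge>M. conjpow a (int n) x \<in> W \<and> conjpow a (- int n) x \<in> W}"

context group
begin

lemma conjpow_closed [simp]: "a \<in> carrier G \<Longrightarrow> x \<in> carrier G \<Longrightarrow> conjpow a n x \<in> carrier G"
  by (simp add: conjpow_def)

lemma conjpow_conjpow [simp]: "a \<in> carrier G \<Longrightarrow> x \<in> carrier G \<Longrightarrow> conjpow a m (conjpow a n x) = conjpow a (m + n) x"
  by (simp add: conjpow_def conjby_conjby int_pow_mult)

lemma conjpow_0 [simp]: "x \<in> carrier G \<Longrightarrow> conjpow a 0 x = x"
  by (simp add: conjpow_def)

lemma conjpow_one [simp]: "a \<in> carrier G \<Longrightarrow> conjpow a n \<one> = \<one>"
  by (simp add: conjpow_def)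

lemma conjpow_mult: "a \<in> carrier G \<Longrightarrow> x \<in> carrier G \<Longrightarrow> y \<in> carrier G \<Longrightarrow> conjpow a n (x \<otimes> y) = conjpow a n x \<otimes> conjpow a n y"
  by (simp add: conjpow_def conjby_mult)

lemma conjpow_inv: "a \<in> carrier G \<Longrightarrow> x \<in> carrier G \<Longrightarrow> conjpow a n (inv x) = inv (conjpow a n x)"
  by (simp add: conjpow_def conjby_inv)

lemma conjpow_conjby: "a \<in> carrier G \<Longrightarrow> g \<in> carrier G \<Longrightarrow> x \<in> carrier G \<Longrightarrow> conjpow a n (conjby g x) = conjby (conjpow a n g) (conjpow a n x)"
  by (simp add: conjby_def conjpow_mult conjpow_inv)

lemma conjpow_inverse [simp]: "a \<in> carrier G \<Longrightarrow> conjpow (inv a) n x = conjpow a (- n) x"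
  by (simp add: conjpow_def int_pow_inv int_pow_neg)

lemma forward_subset: "forward a W \<subseteq> W"
proof
  fix x assume "x \<in> forward a W"
  then have "x \<in> carrier G" "conjpow a (int 0) x \<in> W" unfolding forward_def by blast+
  then show "x \<in> W" by simp
qed

lemma forward_carrier: "x \<in> forward a W \<Longrightarrow> x \<in> carrier G"
  by (simp add: forward_def)

lemma forward_D: "x \<in> forward a W \<Longrightarrow> 0 \<le> n \<Longrightarrow> conjpow a n x \<in> W"
  unfolding forward_def by (metis (mono_tags, lifting) mem_Collect_eq nonneg_int_cases)

lemma forward_inv_D: "a \<in> carrier G \<Longrightarrow> x \<in> forward (inv a) W \<Longrightarrow> n \<le> 0 \<Longrightarrow> conjpow a n x \<in> W"
  using forward_D[of x "inv a" W "-n"] by simp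

lemma conjpow_forward:
  assumes "a \<in> carrier G" "x \<in> forward a W" "0 \<le> n" shows "conjpow a n x \<in> forward a W"
proof -
  have xc: "x \<in> carrier G" by (rule forward_carrier[OF assms(2)])
  have "conjpow a (int m) (conjpow a n x) \<in> W" for m
    using forward_D[OF assms(2), of "int m + n"] assms(1,3) xc by simp
  then show ?thesis using assms(1) xc by (simp add: forward_def)
qed

lemma conjpow_forward_inv:
  assumes "a \<in> carrier G" "x \<in> forward (inv a) W" "n \<le> 0" shows "conjpow a n x \<in> forward (inv a) W"
  using conjpow_forward[of "inv a" x W "-n"] assms by simp

lemma subgroup_forward:
  assumes a: "a \<in> carrier G" and W: "subgroup W G" shows "subgroup (forward a W) G"
proof
  show "forward a W \<subseteq> carrier G" by (auto simp: forward_def)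
  show "\<one> \<in> forward a W" using a subgroup.one_closed[OF W] by (simp add: forward_def)
  show "inv x \<in> forward a W" if "x \<in> forward a W" for x
    using that a subgroup.m_inv_closed[OF W] by (simp add: forward_def conjpow_inv)
  show "x \<otimes> y \<in> forward a W" if "x \<in> forward a W" "y \<in> forward a W" for x y
    using that a subgroup.m_closed[OF W] by (simp add: forward_def conjpow_mult)
qed

lemma tails_inverse: "a \<in> carrier G \<Longrightarrow> tails (inv a) W = tails a W"
  by (auto simp: tails_def)

lemma tails_mono: "U \<subseteq> W \<Longrightarrow> tails a U \<subseteq> tails a W"
  unfolding tails_def by blast

lemma subgroup_tails:
  assumes a: "a \<in> carrier G" and W: "subgroup W G" shows "subgroup (tails a W) G"
proof
  show "tails a W \<subseteq> carrier G" by (auto simp: tails_def)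
  show "\<one> \<in> tails a W" using a subgroup.one_closed[OF W] by (simp add: tails_def)
  show "inv x \<in> tails a W" if "x \<in> tails a W" for x
    using that a subgroup.m_inv_closed[OF W] by (auto simp: tails_def conjpow_inv)
  show "x \<otimes> y \<in> tails a W" if xy: "x \<in> tails a W" "y \<in> tails a W" for x y
  proof -
    obtain M N where MN: "\<forall>n\<ge>M. conjpow a (int n) x \<in> W \<and> conjpow a (- int n) x \<in> W"
        "\<forall>n\<ge>N. conjpow a (int n) y \<in> W \<and> conjpow a (- int n) y \<in> W" and c: "x \<in> carrier G" "y \<in> carrier G"
      using xy by (auto simp: tails_def)
    have "\<forall>n\<ge>max M N. conjpow a (int n) (x \<otimes> y) \<in> W \<and> conjpow a (- int n) (x \<otimes> y) \<in> W"
      using MN a c by (simp add: conjpow_mult subgroup.m_closed[OF W])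
    then show ?thesis using c unfolding tails_def by blast
  qed
qed

lemma conjpow_tails:
  assumes a: "a \<in> carrier G" and x: "x \<in> tails a W" shows "conjpow a k x \<in> tails a W"
proof -
  obtain M where M: "\<And>n. n \<ge> M \<Longrightarrow> conjpow a (int n) x \<in> W \<and> conjpow a (- int n) x \<in> W" and c: "x \<in> carrier G"
    using x by (auto simp: tails_def)
  have "conjpow a (int n) (conjpow a k x) \<in> W \<and> conjpow a (- int n) (conjpow a k x) \<in> W" if n: "n \<ge> M + nat \<bar>k\<bar>" for n
  proof -
    have "int n + k = int (nat (int n + k))" "nat (int n + k) \<ge> M" 
      "- int n + k = - int (nat (int n - k))" "nat (int n - k) \<ge> M" using n by auto
    then show ?thesis using M[of "nat (int n + k)"] M[of "nat (int n - k)"] a c by simp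
  qed
  then have "\<exists>N. \<forall>n\<ge>N. conjpow a (int n) (conjpow a k x) \<in> W \<and> conjpow a (- int n) (conjpow a k x) \<in> W" by blast
  moreover have "conjpow a k x \<in> carrier G" using a c by simp
  ultimately show ?thesis unfolding tails_def by (intro CollectI conjI)
qed

end

context topological_group
begin

lemma continuous_map_conjpow: "a \<in> carrier G \<Longrightarrow> continuous_map T T (conjpow a n)"
  unfolding conjpow_def by (intro continuous_map_conjby) simp

lemma compactin_conjpow: "a \<in> carrier G \<Longrightarrow> compactin T C \<Longrightarrow> compactin T (conjpow a n ` C)"
  unfolding conjpow_def by (intro compactin_conjby) auto

lemma closedin_forward:
  assumes "a \<in> carrier G" "closedin T W" shows "closedin T (forward a W)"
proof -
  have "forward a W = (\<Inter>n. {x \<in> carrier G. conjpow a (int n) x \<in> W})" by (auto simp: forward_def)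
  then show ?thesis using assms by (auto intro!: closedin_preimage continuous_map_conjpow)
qed

lemma subgroup_closure_of:
  assumes S: "subgroup S G" shows "subgroup (T closure_of S) G"
proof
  have Sc: "S \<subseteq> carrier G" by (rule subgroup.subset[OF S])
  show "T closure_of S \<subseteq> carrier G" using closure_of_subset_topspace[of T S] by simp
  show "\<one> \<in> T closure_of S" using closure_of_subset[of S T] subgroup.one_closed[OF S] Sc by auto
  show "inv x \<in> T closure_of S" if x: "x \<in> T closure_of S" for x
  proof -
    have "(\<lambda>x. inv x) ` (T closure_of S) \<subseteq> T closure_of ((\<lambda>x. inv x) ` S)"
      by (rule continuous_map_image_closure_subset[OF continuous_inv])
    also have "\<dots> \<subseteq> T closure_of S"
      using subgroup.m_inv_closed[OF S] by (intro closure_of_mono) auto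
    finally show ?thesis using x by auto
  qed
  show "x \<otimes> y \<in> T closure_of S" if x: "x \<in> T closure_of S" "y \<in> T closure_of S" for x y
  proof -
    have "(\<lambda>(x, y). x \<otimes> y) ` ((prod_topology T T) closure_of (S \<times> S))
        \<subseteq> T closure_of ((\<lambda>(x, y). x \<otimes> y) ` (S \<times> S))"
      by (rule continuous_map_image_closure_subset[OF continuous_mult])
    also have "\<dots> \<subseteq> T closure_of S"
      using subgroup.m_closed[OF S] by (intro closure_of_mono) auto
    finally show ?thesis using x unfolding closure_of_Times by blast
  qed
qed

lemma conjby_closure_of:
  assumes "g \<in> carrier G" "\<And>x. x \<in> S \<Longrightarrow> conjby g x \<in> S" "x \<in> T closure_of S"
  shows "conjby g x \<in> T closure_of S"
proof -
  have "conjby g ` (T closure_of S) \<subseteq> T closure_of (conjby g ` S)"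
    by (rule continuous_map_image_closure_subset[OF continuous_map_conjby[OF assms(1)]])
  also have "\<dots> \<subseteq> T closure_of S" using assms(2) by (intro closure_of_mono) auto
  finally show ?thesis using assms(3) by blast
qed

end

context hausdorff_group
begin

lemma compact_open_closedin: "compact_open U \<Longrightarrow> closedin T U"
  by (simp add: compact_openD compactin_imp_closed)

lemma compactin_forward:
  assumes "a \<in> carrier G" "compact_open W" shows "compactin T (forward a W)"
  using closed_compactin[OF compact_openD(2)[OF assms(2)] forward_subset]
    closedin_forward[OF assms(1) compact_open_closedin[OF assms(2)]] by blast

text \<open>The hypothesis \<open>step\<close> is a factorization that works for one unit of time.
  Iterating it gives, for each \<open>n\<close>, a factor \<open>y\<close> with backward orbit in
  \<open>W\<close> such that \<open>inv y \<otimes> x\<close> stays in \<open>W\<close> up to time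
  \<open>n\<close>. The sets \<open>Y n\<close> of such factors are compact and decreasing, and a
  common point makes \<open>inv y \<otimes> x\<close> stay in \<open>W\<close> forever.\<close>

lemma tidy_above_criterion:
  assumes a: "a \<in> carrier G" and W: "compact_open W"
    and step: "\<And>x. x \<in> W \<Longrightarrow> \<exists>y\<in>forward (inv a) W. conjpow a 1 (inv y \<otimes> x) \<in> W"
  shows "W = forward (inv a) W <#> forward a W"
proof
  have Ws: "subgroup W G" and Wc: "W \<subseteq> carrier G" using W compact_openD(1) compact_open_subset by auto
  note cl = subgroup.m_closed[OF Ws] subgroup.m_inv_closed[OF Ws]
  have b: "inv a \<in> carrier G" using a by simp
  show "forward (inv a) W <#> forward a W \<subseteq> W" using cl(1) forward_subset by (fastforce simp: set_mult_iff)
  show "W \<subseteq> forward (inv a) W <#> forward a W"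
  proof
    fix x assume x: "x \<in> W"
    then have xc: "x \<in> carrier G" using subsetD[OF Wc] by blast
    define Y where "Y n = {y \<in> forward (inv a) W. \<forall>k\<le>n. conjpow a (int k) (inv y \<otimes> x) \<in> W}" for n :: nat
    have ne: "Y n \<noteq> {}" for n
    proof (induction n)
      case 0
      have "\<one> \<in> Y 0" using x xc subgroup.one_closed[OF subgroup_forward[OF b Ws]] by (simp add: Y_def)
      then show ?case by blast
    next
      case (Suc n)
      then obtain y where y: "y \<in> forward (inv a) W" "\<And>k. k \<le> n \<Longrightarrow> conjpow a (int k) (inv y \<otimes> x) \<in> W"
        by (auto simp: Y_def)
      define z where "z = inv y \<otimes> x"
      have yc: "y \<in> carrier G" using y forward_carrier by blast
      have zc: "z \<in> carrier G" using xc yc by (simp add: z_def)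
      have "conjpow a (int n) z \<in> W" using y(2) z_def by auto
      from step[OF this] obtain y' where y': "y' \<in> forward (inv a) W" "conjpow a 1 (inv y' \<otimes> conjpow a (int n) z) \<in> W"
        by blast
      have y'c: "y' \<in> carrier G" using y' forward_carrier by blast
      \<comment> \<open>The correction needed at time \<open>n\<close> is pulled back to time
        \<open>0\<close>. Since the whole backward orbit of \<open>y'\<close> lies in
        \<open>W\<close>, it does no harm at the earlier times \<open>k \<le> n\<close>.\<close>
      define y'' where "y'' = y \<otimes> conjpow a (- int n) y'"
      have y''c: "y'' \<in> carrier G" using y'c yc a by (simp add: y''_def)
      have mem: "y'' \<in> forward (inv a) W"
        unfolding y''_def
        by (rule subgroup.m_closed[OF subgroup_forward[OF b Ws] y(1) conjpow_forward_inv[OF a y'(1)]]) simp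
      have eq: "inv y'' \<otimes> x = conjpow a (- int n) (inv y') \<otimes> z"
        using xc yc y'c a by (simp add: y''_def z_def group_nf conjpow_inv)
      have "conjpow a (int k) (inv y'' \<otimes> x) \<in> W" if k: "k \<le> Suc n" for k
      proof (cases "k = Suc n")
        case True
        have "conjpow a (int k) (inv y'' \<otimes> x) = conjpow a 1 (inv y' \<otimes> conjpow a (int n) z)"
          unfolding eq True using a y'c zc by (simp add: conjpow_mult)
        then show ?thesis using y' by simp
      next
        case False
        then have k': "k \<le> n" using k by simp
        have "conjpow a (int k) (inv y'' \<otimes> x) = inv (conjpow a (int k - int n) y') \<otimes> conjpow a (int k) z"
          unfolding eq using a y'c zc by (simp add: conjpow_mult conjpow_inv)
        moreover have "conjpow a (int k - int n) y' \<in> W" using forward_inv_D[OF a y'(1)] k' by simp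
        moreover have "conjpow a (int k) z \<in> W" using y(2)[OF k'] z_def by simp
        ultimately show ?thesis using cl by simp
      qed
      then have "y'' \<in> Y (Suc n)" using mem by (simp add: Y_def)
      then show ?case by blast
    qed
    have comp: "compactin T (Y n)" for n
    proof -
      have "Y n = forward (inv a) W \<inter> (\<Inter>k\<in>{..n}. {y \<in> carrier G. conjpow a (int k) (inv y \<otimes> x) \<in> W})"
        by (auto simp: Y_def forward_carrier)
      moreover have "closedin T {y \<in> carrier G. conjpow a (int k) (inv y \<otimes> x) \<in> W}" for k
      proof (rule closedin_preimage[OF _ compact_open_closedin[OF W]])
        have "continuous_map T T (\<lambda>y. inv y \<otimes> x)"
          using xc by (intro continuous_map_mult continuous_inv) auto
        then show "continuous_map T T (\<lambda>y. conjpow a (int k) (inv y \<otimes> x))"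
          using continuous_map_compose[OF _ continuous_map_conjpow[OF a]] by (force simp: o_def)
      qed
      then have "closedin T (\<Inter>k\<in>{..n}. {y \<in> carrier G. conjpow a (int k) (inv y \<otimes> x) \<in> W})"
        by (intro closedin_INT) auto
      ultimately show ?thesis using compact_Int_closedin[OF compactin_forward[OF b W]] by simp
    qed
    have dec: "Y (Suc n) \<subseteq> Y n" for n by (auto simp: Y_def)
    from nested_compact_nonempty[of T Y, OF Hausdorff' comp dec ne] obtain y where y: "\<And>n. y \<in> Y n" by blast
    then have y0: "y \<in> forward (inv a) W" "\<And>k. conjpow a (int k) (inv y \<otimes> x) \<in> W" by (auto simp: Y_def)
    have yc: "y \<in> carrier G" using y0 forward_carrier by blast
    have "inv y \<otimes> x \<in> forward a W" using y0(2) yc xc by (simp add: forward_def)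
    moreover have "x = y \<otimes> (inv y \<otimes> x)" using xc yc by simp
    ultimately show "x \<in> forward (inv a) W <#> forward a W" using y0(1) unfolding set_mult_iff by blast
  qed
qed

text \<open>The subgroups \<open>W n\<close> decrease to \<open>Up\<close>, so by compactness the image of some \<open>W N\<close> already lies in the
  open neighbourhood \<open>conjpow a 1 ` Up <#> U\<close> of the image of \<open>Up\<close>.\<close>

lemma tidy_above_exists:
  assumes a: "a \<in> carrier G" and U: "compact_open U"
  obtains N where "compact_open {x \<in> carrier G. \<forall>k\<le>N::nat. conjpow a (- int k) x \<in> U}"
    "{x \<in> carrier G. \<forall>k\<le>N. conjpow a (- int k) x \<in> U} =
      forward (inv a) {x \<in> carrier G. \<forall>k\<le>N. conjpow a (- int k) x \<in> U} <#>
      forward a {x \<in> carrier G. \<forall>k\<le>N. conjpow a (- int k) x \<in> U}"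
proof -
  have Us: "subgroup U G" and Uc: "U \<subseteq> carrier G" using U compact_openD(1) compact_open_subset by auto
  have b: "inv a \<in> carrier G" using a by simp
  define W where "W n = {x \<in> carrier G. \<forall>k\<le>n. conjpow a (- int k) x \<in> U}" for n :: nat
  have Weq: "W n = (\<Inter>k\<in>{..n}. conjpow a (int k) ` U)" for n
  proof -
    have "x \<in> conjpow a (int k) ` U \<longleftrightarrow> x \<in> carrier G \<and> conjpow a (- int k) x \<in> U" for x k
      using a Uc by (auto simp: image_iff subset_iff) (metis add.right_inverse conjpow_0 conjpow_conjpow conjpow_closed)
    then show ?thesis by (auto simp: W_def)
  qed
  have Wco: "compact_open (W n)" for n
    unfolding Weq using U a by (intro compact_open_INT) (auto simp: conjpow_def intro: compact_open_conjby)
  have Wc: "W n \<subseteq> carrier G" for n by (auto simp: W_def)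
  define Up where "Up = forward (inv a) U"
  have Upc: "Up \<subseteq> carrier G" by (auto simp: Up_def forward_def)
  have Int_W: "(\<Inter>n. conjpow a 1 ` W n) \<subseteq> conjpow a 1 ` Up"
  proof
    fix x assume x: "x \<in> (\<Inter>n. conjpow a 1 ` W n)"
    then have "x \<in> conjpow a 1 ` W 0" by blast
    then have xc: "x \<in> carrier G" using a subsetD[OF Wc] by auto
    have "conjpow a (-1) x \<in> W n" for n
    proof -
      have "x \<in> conjpow a 1 ` W n" using x by blast
      then show ?thesis using a Wc[of n] by (auto simp: subset_iff)
    qed
    then have "conjpow a (-1) x \<in> Up" using a xc by (auto simp: Up_def forward_def W_def)
    then show "x \<in> conjpow a 1 ` Up" using a xc by (intro image_eqI[of _ _ "conjpow a (-1) x"]) auto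
  qed
  have sub: "conjpow a 1 ` Up \<subseteq> conjpow a 1 ` Up <#> U"
  proof
    fix x assume x: "x \<in> conjpow a 1 ` Up"
    then have "x \<in> carrier G" using Upc a by auto
    then show "x \<in> conjpow a 1 ` Up <#> U" using x subgroup.one_closed[OF Us] unfolding set_mult_iff by (metis r_one)
  qed
  have op: "openin T (conjpow a 1 ` Up <#> U)"
    using Upc a by (intro openin_set_mult_right compact_openD[OF U]) auto
  have comp: "compactin T (conjpow a 1 ` W n)" for n using Wco a compactin_conjpow compact_openD(2) by blast
  have dec: "conjpow a 1 ` W (Suc n) \<subseteq> conjpow a 1 ` W n" for n by (auto simp: W_def)
  obtain N where N: "conjpow a 1 ` W N \<subseteq> conjpow a 1 ` Up <#> U"
    by (rule nested_compact_subset_open[of T "\<lambda>n. conjpow a 1 ` W n", OF Hausdorff' comp dec subset_trans[OF Int_W sub] op])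
  have Up_W: "Up \<subseteq> forward (inv a) (W N)"
  proof
    fix y assume y: "y \<in> Up"
    have "conjpow a (- int n) y \<in> W N" for n
      using forward_inv_D[OF a y[unfolded Up_def]] y Upc a by (auto simp: W_def)
    then show "y \<in> forward (inv a) (W N)" using a y Upc by (auto simp: forward_def)
  qed
  have "W N = forward (inv a) (W N) <#> forward a (W N)"
  proof (rule tidy_above_criterion[OF a Wco])
    fix x assume x: "x \<in> W N"
    then have xc: "x \<in> carrier G" using subsetD[OF Wc] by blast
    have "conjpow a 1 x \<in> conjpow a 1 ` Up <#> U" using N x by blast
    then obtain y u where yu: "y \<in> Up" "u \<in> U" "conjpow a 1 x = conjpow a 1 y \<otimes> u" by (auto simp: set_mult_iff)
    have yc: "y \<in> carrier G" "u \<in> carrier G" using yu Upc Uc by auto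
    have yW: "y \<in> W N" using yu Up_W forward_subset by blast
    define z where "z = inv y \<otimes> x"
    have zW: "z \<in> W N" unfolding z_def
      using subgroup.m_closed[OF compact_openD(1)[OF Wco]] subgroup.m_inv_closed[OF compact_openD(1)[OF Wco]] x yW by blast
    have zc: "z \<in> carrier G" using zW subsetD[OF Wc] by blast
    have az: "conjpow a 1 z = u" using yu(3) a xc yc by (simp add: z_def conjpow_mult conjpow_inv)
    \<comment> \<open>The conditions shift by one: time \<open>0\<close> is membership of
      \<open>u\<close> in \<open>U\<close>, and time \<open>Suc j\<close> is the condition on
      \<open>z\<close> at time \<open>j\<close>.\<close>
    have "conjpow a (- int k) (conjpow a 1 z) \<in> U" if "k \<le> N" for k
    proof (cases k)
      case 0
      then show ?thesis using az yu yc by simp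
    next
      case (Suc j)
      then have "conjpow a (- int j) z \<in> U" using zW that by (simp add: W_def)
      then show ?thesis using Suc a zc by simp
    qed
    then have "conjpow a 1 z \<in> W N" using a zc by (simp add: W_def)
    then show "\<exists>y\<in>forward (inv a) (W N). conjpow a 1 (inv y \<otimes> x) \<in> W N" using Up_W yu(1) unfolding z_def by blast
  qed
  then show thesis using that[of N] Wco[of N] unfolding W_def by blast
qed

end

text \<open>\<open>Xp\<close> and \<open>Xm\<close> are the expanding and the contracting part of \<open>W\<close> under conjugation by \<open>a\<close>, and \<open>X0\<close> is
  the part that stays in \<open>W\<close> in both directions. The last two clauses play the role of Willis' tidiness
  below.\<close>

definition (in topological_group) tidy :: "'a \<Rightarrow> 'a set \<Rightarrow> 'a set \<Rightarrow> 'a set \<Rightarrow> 'a set \<Rightarrow> bool" where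
  "tidy a W Xp Xm X0 \<longleftrightarrow> compact_open W \<and> subgroup Xp G \<and> subgroup Xm G \<and> subgroup X0 G \<and>
     Xp \<subseteq> W \<and> Xm \<subseteq> W \<and> X0 \<subseteq> Xp \<and> X0 \<subseteq> Xm \<and> W = Xp <#> Xm \<and>
     (\<forall>x\<in>Xp. \<forall>n::nat. conjpow a (- int n) x \<in> Xp) \<and> (\<forall>x\<in>Xm. \<forall>n::nat. conjpow a (int n) x \<in> Xm) \<and>
     (\<forall>x\<in>X0. \<forall>n. conjpow a n x \<in> X0) \<and>
     (\<forall>x\<in>Xp. \<forall>C. compactin T C \<longrightarrow> infinite {n::nat. conjpow a (int n) x \<in> C} \<longrightarrow> x \<in> X0) \<and>
     (\<forall>x\<in>Xm. \<forall>C. compactin T C \<longrightarrow> infinite {n::nat. conjpow a (- int n) x \<in> C} \<longrightarrow> x \<in> X0)"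

text \<open>Inversion maps \<open>A <#> B\<close> onto \<open>B <#> A\<close> and preserves the
  subgroup \<open>W\<close>.\<close>

lemma (in group) set_mult_subgroups_commute:
  assumes A: "subgroup A G" and B: "subgroup B G" and W: "subgroup W G" "W = A <#> B"
  shows "W = B <#> A"
proof -
  have Ac: "A \<subseteq> carrier G" "B \<subseteq> carrier G" by (rule subgroup.subset[OF A], rule subgroup.subset[OF B])
  show ?thesis
  proof
    show "W \<subseteq> B <#> A"
    proof
      fix w assume w: "w \<in> W"
      then have wc: "w \<in> carrier G" by (rule subgroup.mem_carrier[OF W(1)])
      have "inv w \<in> A <#> B" using subgroup.m_inv_closed[OF W(1) w] W(2) by simp
      then obtain x y where xy: "x \<in> A" "y \<in> B" "inv w = x \<otimes> y" by (auto simp: set_mult_iff)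
      have "w = inv (inv w)" using wc by simp
      also have "\<dots> = inv y \<otimes> inv x" unfolding xy(3) using xy Ac by (intro inv_mult_group) auto
      finally show "w \<in> B <#> A"
        using subgroup.m_inv_closed[OF A xy(1)] subgroup.m_inv_closed[OF B xy(2)] unfolding set_mult_iff by blast
    qed
    show "B <#> A \<subseteq> W"
    proof
      fix w assume "w \<in> B <#> A"
      then obtain x y where xy: "x \<in> A" "y \<in> B" "w = y \<otimes> x" by (auto simp: set_mult_iff)
      have "inv w = inv x \<otimes> inv y" unfolding xy(3) using xy Ac by (intro inv_mult_group) auto
      then have "inv w \<in> W" unfolding W(2)
        using subgroup.m_inv_closed[OF A xy(1)] subgroup.m_inv_closed[OF B xy(2)] unfolding set_mult_iff by blast
      moreover have "w \<in> carrier G" using xy Ac by auto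
      ultimately show "w \<in> W" using subgroup.m_inv_closed[OF W(1), of "inv w"] by simp
    qed
  qed
qed

context topological_group
begin

lemma tidy_inverse:
  assumes a: "a \<in> carrier G" and t: "tidy a W Xp Xm X0" shows "tidy (inv a) W Xm Xp X0"
proof -
  have W: "compact_open W" "subgroup Xp G" "subgroup Xm G" "W = Xp <#> Xm" using t by (auto simp: tidy_def)
  have eq: "W = Xm <#> Xp" using set_mult_subgroups_commute[OF W(2,3) compact_openD(1)[OF W(1)] W(4)] .
  have "conjpow (inv a) n = conjpow a (- n)" for n using a by (simp add: conjpow_def int_pow_inv int_pow_neg)
  then show ?thesis using t unfolding tidy_def
    by (elim conjE, intro conjI eq) (assumption | simp only: minus_minus | blast)+
qed

end

context hausdorff_group
begin

text \<open>\<open>E k\<close> collects the tail elements whose backward orbit is in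
  \<open>W\<close> from time \<open>k\<close> on; every tail element lies in some
  \<open>E k\<close>. Finitely many representatives \<open>\<Lambda>\<close> lead from
  \<open>E 1\<close> to \<open>E 0\<close>, hence their conjugates by the \<open>k\<close>-th power
  of \<open>a\<close> lead from \<open>E (Suc k)\<close> to \<open>E k\<close>. The representatives
  are tail elements themselves, so for large \<open>k\<close> these conjugates lie in the compact
  group \<open>forward a W\<close>, and from then on the sets grow only by factors from it.\<close>

lemma bdd_in_tails:
  assumes a: "a \<in> carrier G" and W: "compact_open W"
  shows "bdd_in T (tails a W)"
proof -
  have b: "inv a \<in> carrier G" using a by simp
  have Ws: "subgroup W G" and Wc: "W \<subseteq> carrier G" using W compact_openD(1) compact_open_subset by auto
  define Wp where "Wp = forward (inv a) W"
  have Wps: "subgroup Wp G" unfolding Wp_def by (rule subgroup_forward[OF b Ws])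
  have fs: "subgroup (forward a W) G" by (rule subgroup_forward[OF a Ws])
  note Es = subgroup_tails[OF a Ws]
  define E where "E k = {x \<in> tails a W. conjpow a (- int k) x \<in> Wp}" for k :: nat
  have Ec: "x \<in> carrier G" if "x \<in> tails a W" for x using that by (auto simp: tails_def)
  have EW: "E 0 \<subseteq> W" using subsetD[OF forward_subset] Ec by (auto simp: E_def Wp_def)
  obtain F where F: "finite F" "F \<subseteq> conjpow a 1 ` Wp" "conjpow a 1 ` Wp \<subseteq> F <#> W"
    by (rule compact_finite_cover[OF compactin_conjpow[OF a compactin_forward[OF b W]] compact_openD(1,3)[OF W]])
      (auto simp: Wp_def)
  \<comment> \<open>One representative for each of the finitely many cosets of \<open>W\<close> that
    meets \<open>E 1\<close>. It is taken from \<open>E 1\<close> and not from \<open>F\<close>, so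
    that its forward orbit ends up in \<open>W\<close>.\<close>
  define \<Lambda> where "\<Lambda> = (\<lambda>f. SOME l. l \<in> E 1 \<and> l \<in> f <# W) ` {f \<in> F. \<exists>l. l \<in> E 1 \<and> l \<in> f <# W}"
  have "(SOME l. l \<in> E 1 \<and> l \<in> f <# W) \<in> E 1 \<and> (SOME l. l \<in> E 1 \<and> l \<in> f <# W) \<in> f <# W"
    if "\<exists>l. l \<in> E 1 \<and> l \<in> f <# W" for f
    using someI_ex[OF that] .
  note some = this
  have fin: "finite \<Lambda>" using F by (simp add: \<Lambda>_def)
  have \<Lambda>E: "\<Lambda> \<subseteq> E 1" using some by (auto simp: \<Lambda>_def)
  have \<Lambda>: "\<exists>l\<in>\<Lambda>. inv l \<otimes> x \<in> E 0" if x: "x \<in> E 1" for x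
  proof -
    have xe: "x \<in> tails a W" and xc: "x \<in> carrier G" and xp: "conjpow a (-1) x \<in> Wp" using x Ec by (auto simp: E_def)
    have "x \<in> conjpow a 1 ` Wp" using xp xc a by (intro image_eqI[of _ _ "conjpow a (-1) x"]) auto
    then have "x \<in> F <#> W" using F(3) by blast
    then obtain f where f: "f \<in> F" "x \<in> f <# W" by (auto simp: set_mult_iff l_coset_iff)
    then have ex: "\<exists>l. l \<in> E 1 \<and> l \<in> f <# W" using x by blast
    define l where "l = (SOME l. l \<in> E 1 \<and> l \<in> f <# W)"
    have l: "l \<in> \<Lambda>" "l \<in> E 1" "l \<in> f <# W" using some[OF ex] ex f(1) unfolding l_def \<Lambda>_def by auto
    have le: "l \<in> tails a W" and lc: "l \<in> carrier G" and lp: "conjpow a (-1) l \<in> Wp" using l Ec by (auto simp: E_def)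
    have fc: "f \<in> carrier G" using f F(2) a forward_carrier by (auto simp: Wp_def)
    obtain w1 w2 where w: "w1 \<in> W" "x = f \<otimes> w1" "w2 \<in> W" "l = f \<otimes> w2" using f(2) l(3) by (auto simp: l_coset_iff)
    have "inv l \<otimes> x = inv w2 \<otimes> w1" using w fc Wc by (simp add: group_nf subset_iff)
    then have in0: "inv l \<otimes> x \<in> W" using w subgroup.m_closed[OF Ws] subgroup.m_inv_closed[OF Ws] by simp
    have in1: "conjpow a (-1) (inv l \<otimes> x) \<in> Wp"
      using xp lp xc lc a by (simp add: conjpow_mult conjpow_inv subgroup.m_closed[OF Wps] subgroup.m_inv_closed[OF Wps])
    have "conjpow a (- int n) (inv l \<otimes> x) \<in> W" for n
    proof (cases n)
      case 0
      then show ?thesis using in0 xc lc by simp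
    next
      case (Suc m)
      then have e: "- int n = - int m + (-1)" by simp
      have "conjpow a (- int m) (conjpow a (-1) (inv l \<otimes> x)) \<in> W"
        using forward_inv_D[OF a in1[unfolded Wp_def], of "- int m"] by simp
      then show ?thesis unfolding e using xc lc a by (subst conjpow_conjpow[symmetric]) auto
    qed
    then have "conjpow a (- int 0) (inv l \<otimes> x) \<in> Wp" using xc lc a by (simp add: Wp_def forward_def)
    moreover have "inv l \<otimes> x \<in> tails a W"
      by (rule subgroup.m_closed[OF Es subgroup.m_inv_closed[OF Es le] xe])
    ultimately show ?thesis using l(1) unfolding E_def by blast
  qed
  have "\<forall>l\<in>\<Lambda>. \<exists>M. \<forall>n\<ge>M. conjpow a (int n) l \<in> W"
  proof
    fix l assume "l \<in> \<Lambda>"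
    then have "l \<in> tails a W" using \<Lambda>E by (auto simp: E_def)
    then show "\<exists>M. \<forall>n\<ge>M. conjpow a (int n) l \<in> W" unfolding tails_def by blast
  qed
  then obtain m where m: "\<And>l n. l \<in> \<Lambda> \<Longrightarrow> n \<ge> m l \<Longrightarrow> conjpow a (int n) l \<in> W" by metis
  \<comment> \<open>A time from which all representatives have their forward orbits in
    \<open>W\<close>; the inserted \<open>0\<close> keeps \<open>Max\<close> away from the empty
    set.\<close>
  define M where "M = Max (insert 0 (m ` \<Lambda>))"
  have M: "conjpow a (int k) l \<in> forward a W" if "l \<in> \<Lambda>" "k \<ge> M" for l k
  proof -
    have "m l \<le> M" using that(1) fin by (simp add: M_def)
    then have "conjpow a (int (n + k)) l \<in> W" for n using m[OF that(1), of "n + k"] that(2) by simp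
    moreover have "l \<in> carrier G" using that(1) \<Lambda>E Ec by (auto simp: E_def)
    ultimately show ?thesis using a by (simp add: forward_def)
  qed
  have decomp: "\<exists>l\<in>\<Lambda>. \<exists>y\<in>E k. x = conjpow a (int k) l \<otimes> y" if x: "x \<in> E (Suc k)" for x k
  proof -
    have xe: "x \<in> tails a W" and xc: "x \<in> carrier G" using x Ec by (auto simp: E_def)
    define x' where "x' = conjpow a (- int k) x"
    have "conjpow a (-1) x' = conjpow a (- int (Suc k)) x" using a xc by (simp add: x'_def)
    then have "x' \<in> E 1" using x conjpow_tails[OF a xe] by (simp add: E_def x'_def)
    then obtain l where l: "l \<in> \<Lambda>" "inv l \<otimes> x' \<in> E 0" using \<Lambda> by blast
    have lc: "l \<in> carrier G" using l \<Lambda>E Ec by (auto simp: E_def)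
    have x'c: "x' \<in> carrier G" using xc a by (simp add: x'_def)
    define y where "y = conjpow a (int k) (inv l \<otimes> x')"
    have "y \<in> E k" using l(2) conjpow_tails[OF a, of "inv l \<otimes> x'"] a lc x'c by (simp add: E_def y_def)
    moreover have "x = conjpow a (int k) l \<otimes> y" using a lc x'c xc by (simp add: y_def conjpow_mult conjpow_inv x'_def)
    ultimately show ?thesis using l(1) by blast
  qed
  have bE: "bdd_in T (E k)" for k
  proof (induction k)
    case 0
    show ?case by (rule bdd_in_subset[OF compactin_imp_bdd_in[OF compact_openD(2)[OF W]] EW])
  next
    case (Suc k)
    have "E (Suc k) \<subseteq> (\<Union>l\<in>\<Lambda>. {conjpow a (int k) l} <#> E k)"
      using decomp by (fastforce simp: set_mult_iff)
    moreover have "bdd_in T (\<Union>l\<in>\<Lambda>. {conjpow a (int k) l} <#> E k)"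
    proof (intro bdd_in_UN bdd_in_set_mult Suc.IH fin bdd_in_singleton)
      fix l assume "l \<in> \<Lambda>"
      then have "l \<in> carrier G" using \<Lambda>E Ec by (auto simp: E_def)
      then show "conjpow a (int k) l \<in> carrier G" using a by simp
    qed
    ultimately show ?case using bdd_in_subset by blast
  qed
  \<comment> \<open>From time \<open>M\<close> on the new left factor is absorbed by the group
    \<open>forward a W\<close>.\<close>
  have big: "E k \<subseteq> forward a W <#> E M" if "k \<ge> M" for k
    using that
  proof (induction k rule: dec_induct)
    case base
    show ?case
    proof
      fix x assume x: "x \<in> E M"
      then have "x = \<one> \<otimes> x" using Ec by (auto simp: E_def)
      then show "x \<in> forward a W <#> E M" using x subgroup.one_closed[OF fs] unfolding set_mult_iff by blast
    qed
  next
    case (step n)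
    show ?case
    proof
      fix x assume "x \<in> E (Suc n)"
      then obtain l y where ly: "l \<in> \<Lambda>" "y \<in> E n" "x = conjpow a (int n) l \<otimes> y" using decomp by blast
      obtain w z where wz: "w \<in> forward a W" "z \<in> E M" "y = w \<otimes> z" using step.IH ly(2) by (auto simp: set_mult_iff subset_iff)
      have c: "l \<in> carrier G" "w \<in> carrier G" "z \<in> carrier G"
        using ly wz \<Lambda>E Ec forward_carrier by (auto simp: E_def)
      have "x = (conjpow a (int n) l \<otimes> w) \<otimes> z" using ly wz c a by (simp add: m_assoc)
      moreover have "conjpow a (int n) l \<otimes> w \<in> forward a W"
        by (rule subgroup.m_closed[OF fs M[OF ly(1) step.hyps(1)] wz(1)])
      ultimately show "x \<in> forward a W <#> E M" using wz(2) unfolding set_mult_iff by blast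
    qed
  qed
  have "tails a W \<subseteq> forward a W <#> E M"
  proof
    fix x assume x: "x \<in> tails a W"
    then obtain N where N: "\<And>n. n \<ge> N \<Longrightarrow> conjpow a (- int n) x \<in> W" and xc: "x \<in> carrier G" by (auto simp: tails_def)
    have "conjpow a (- int n) (conjpow a (- int (max N M)) x) \<in> W" for n
      using N[of "n + max N M"] a xc by (simp add: algebra_simps)
    then have "conjpow a (- int (max N M)) x \<in> Wp" using a xc by (simp add: Wp_def forward_def)
    then have "x \<in> E (max N M)" using x by (simp add: E_def)
    then show "x \<in> forward a W <#> E M" using big[of "max N M"] by auto
  qed
  moreover have "bdd_in T (forward a W <#> E M)"
    by (intro bdd_in_set_mult bE compactin_imp_bdd_in compactin_forward a W)
  ultimately show ?thesis using bdd_in_subset by blast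
qed

text \<open>Two backward returns of \<open>u\<close> to a coset of \<open>U\<close> differ by an
  element of \<open>U\<close>, which splits as \<open>p \<otimes> m\<close> because \<open>U\<close>
  is tidy above. The factor \<open>p\<close> has both tails in \<open>U\<close>, hence lies in
  \<open>L\<close>. Up to an element of \<open>L\<close>, the backward orbit of \<open>u\<close> is
  therefore in \<open>U\<close> for the time between the two returns, and this time can be made
  arbitrarily long.\<close>

lemma recurrent_in_tidy_above:
  assumes a: "a \<in> carrier G" and U: "compact_open U" and tU: "U = forward (inv a) U <#> forward a U"
    and L: "compactin T L" "subgroup L G" and aL: "\<And>l n. l \<in> L \<Longrightarrow> conjpow a n l \<in> L"
    and eL: "tails a U \<subseteq> L" and nL: "\<And>l x. l \<in> L \<Longrightarrow> x \<in> U \<Longrightarrow> conjby l x \<in> U"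
    and u: "u \<in> forward a U" and C: "compactin T C" and inf: "infinite {n::nat. conjpow a (- int n) u \<in> C}"
  shows "u \<in> (forward a U \<inter> forward (inv a) U) <#> L"
proof -
  have b: "inv a \<in> carrier G" using a by simp
  have Us: "subgroup U G" and Uc: "U \<subseteq> carrier G" using U compact_openD(1) compact_open_subset by auto
  have Lc: "L \<subseteq> carrier G" by (rule subgroup.subset[OF L(2)])
  note Um = subgroup.m_closed[OF Us] and Ui = subgroup.m_inv_closed[OF Us]
  have fs: "subgroup (forward a U) G" by (rule subgroup_forward[OF a Us])
  have uc: "u \<in> carrier G" using u forward_carrier by blast
  have nf: "conjby l m \<in> forward a U" if "l \<in> L" "m \<in> forward a U" for l m
  proof -
    have c: "l \<in> carrier G" "m \<in> carrier G" using that Lc forward_carrier by auto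
    have "conjpow a (int n) (conjby l m) \<in> U" for n
      using nL[OF aL[OF that(1)] forward_D[OF that(2)]] a c by (simp add: conjpow_conjby)
    then show ?thesis using c by (simp add: forward_def)
  qed
  have "infinite {n \<in> UNIV. conjpow a (- int n) u \<in> C}" using inf by simp
  from compact_pigeonhole[OF C compact_openD(1,3)[OF U] this]
  obtain k where k: "k \<in> C" and J: "infinite {n::nat. conjpow a (- int n) u \<in> k <# U}" by auto
  have kc: "k \<in> carrier G" using k compactin_subset_carrier[OF C] by blast
  define J where "J = {n::nat. conjpow a (- int n) u \<in> k <# U}"
  obtain i where i: "i \<in> J" using J unfolding J_def by (metis infinite_imp_nonempty ex_in_conv)
  \<comment> \<open>\<open>l\<close> is \<open>p\<close> moved forward by \<open>j\<close> steps.
    Solving the relation between the two returns for \<open>u \<otimes> inv l\<close> leaves a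
    product of elements of \<open>forward a U\<close>, since conjugation by elements of
    \<open>L\<close> preserves that group.\<close>
  have key: "\<exists>l\<in>L. conjpow a (- int (j - i)) (u \<otimes> inv l) \<in> forward a U" if j: "j \<in> J" "i < j" for j
  proof -
    define v where "v = inv (conjpow a (- int i) u) \<otimes> conjpow a (- int j) u"
    have vc: "v \<in> carrier G" using a uc by (simp add: v_def)
    obtain w1 w2 where w: "w1 \<in> U" "conjpow a (- int i) u = k \<otimes> w1" "w2 \<in> U" "conjpow a (- int j) u = k \<otimes> w2"
      using i j by (auto simp: J_def l_coset_iff)
    have "v = inv w1 \<otimes> w2" using w kc Uc by (simp add: v_def group_nf subset_iff)
    then have "v \<in> U" using w Um Ui by simp
    then have "v \<in> forward (inv a) U <#> forward a U" by (simp only: tU[symmetric])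
    then obtain p m where pm: "p \<in> forward (inv a) U" "m \<in> forward a U" "v = p \<otimes> m" by (auto simp: set_mult_iff)
    have c: "p \<in> carrier G" "m \<in> carrier G" using pm forward_carrier by auto
    \<comment> \<open>The backward orbit is in \<open>U\<close> by the choice of \<open>p\<close>.
      In the forward direction, from time \<open>j\<close> on both \<open>v\<close> and
      \<open>m\<close> are in \<open>U\<close>, hence so is \<open>p\<close>.\<close>
    have "p \<in> tails a U"
    proof -
      have "conjpow a (int n) p \<in> U \<and> conjpow a (- int n) p \<in> U" if n: "n \<ge> j" for n
      proof
        have "conjpow a (int n) v = inv (conjpow a (int n - int i) u) \<otimes> conjpow a (int n - int j) u"
          using a uc by (simp add: v_def conjpow_mult conjpow_inv)
        then have "conjpow a (int n) v \<in> U" using Um Ui forward_D[OF u] n j(2) by simp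
        moreover have "conjpow a (int n) p = conjpow a (int n) v \<otimes> inv (conjpow a (int n) m)"
          unfolding pm(3) using c a by (simp add: conjpow_mult m_assoc)
        ultimately show "conjpow a (int n) p \<in> U" using Um Ui forward_D[OF pm(2), of "int n"] by simp
        show "conjpow a (- int n) p \<in> U" using forward_inv_D[OF a pm(1)] by simp
      qed
      then show ?thesis using c unfolding tails_def by blast
    qed
    then have pL: "p \<in> L" using eL by blast
    define l where "l = conjpow a (int j) p"
    have lL: "l \<in> L" using aL[OF pL] by (simp add: l_def)
    have lc: "l \<in> carrier G" using lL Lc by blast
    have "conjpow a (- int j) u = conjpow a (- int i) u \<otimes> (p \<otimes> m)"
      unfolding pm(3)[symmetric] v_def using a uc by simp
    then have "conjpow a (int j) (conjpow a (- int j) u) = conjpow a (int j) (conjpow a (- int i) u \<otimes> (p \<otimes> m))" by simp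
    then have eq: "u = conjpow a (int j - int i) u \<otimes> (l \<otimes> conjpow a (int j) m)"
      using a uc c by (simp add: conjpow_mult l_def)
    have "u \<otimes> inv l = (conjpow a (int j - int i) u \<otimes> (l \<otimes> conjpow a (int j) m)) \<otimes> inv l"
      by (rule arg_cong[OF eq, of "\<lambda>z. z \<otimes> inv l"])
    also have "\<dots> = conjpow a (int j - int i) u \<otimes> conjby l (conjpow a (int j) m)"
      using a uc c lc by (simp add: conjby_def m_assoc)
    finally have "u \<otimes> inv l = conjpow a (int j - int i) u \<otimes> conjby l (conjpow a (int j) m)" .
    then have "conjpow a (- int (j - i)) (u \<otimes> inv l) = u \<otimes> conjpow a (- int (j - i)) (conjby l (conjpow a (int j) m))"
      using a uc c lc j(2) by (simp add: conjpow_mult)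
    also have "conjpow a (- int (j - i)) (conjby l (conjpow a (int j) m)) = conjby (conjpow a (- int (j - i)) l) (conjpow a (int i) m)"
      using a c lc j(2) by (simp add: conjpow_conjby)
    finally have "conjpow a (- int (j - i)) (u \<otimes> inv l) = u \<otimes> conjby (conjpow a (- int (j - i)) l) (conjpow a (int i) m)" .
    moreover have "conjby (conjpow a (- int (j - i)) l) (conjpow a (int i) m) \<in> forward a U"
      using nf[OF aL[OF lL] conjpow_forward[OF a pm(2)]] by simp
    ultimately have "conjpow a (- int (j - i)) (u \<otimes> inv l) \<in> forward a U" using subgroup.m_closed[OF fs u] by (simp only:)
    then show ?thesis using lL by blast
  qed
  \<comment> \<open>The corrections in \<open>L\<close> that are good for \<open>N\<close> backward
    steps. By compactness of \<open>L\<close> one correction is good for all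
    \<open>N\<close>.\<close>
  define Y where "Y N = {l \<in> L. conjpow a (- int N) (u \<otimes> inv l) \<in> forward a U}" for N :: nat
  have dec: "Y (Suc N) \<subseteq> Y N" for N
  proof
    fix l assume l: "l \<in> Y (Suc N)"
    then have l': "l \<in> L" "conjpow a (- int (Suc N)) (u \<otimes> inv l) \<in> forward a U" unfolding Y_def by blast+
    then have lc: "l \<in> carrier G" using Lc by blast
    have "conjpow a 1 (conjpow a (- int (Suc N)) (u \<otimes> inv l)) \<in> forward a U" by (rule conjpow_forward[OF a l'(2)]) simp
    then show "l \<in> Y N" using l'(1) a uc lc by (simp add: Y_def)
  qed
  have ne: "Y N \<noteq> {}" for N
  proof -
    have "\<exists>j\<in>J. j > i + N" using J unfolding J_def[symmetric] by (meson infinite_nat_iff_unbounded)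
    then obtain j where j: "j \<in> J" "j > i + N" by blast
    then obtain l where "l \<in> Y (j - i)" using key[of j] by (auto simp: Y_def)
    moreover have "Y (j - i) \<subseteq> Y N" using lift_Suc_antimono_le[of Y, OF dec, of N "j - i"] j by simp
    ultimately show ?thesis by blast
  qed
  have comp: "compactin T (Y N)" for N
  proof -
    have "continuous_map T T (\<lambda>l. u \<otimes> inv l)" using uc by (intro continuous_map_mult continuous_inv) auto
    then have "continuous_map T T (\<lambda>l. conjpow a (- int N) (u \<otimes> inv l))"
      using continuous_map_compose[OF _ continuous_map_conjpow[OF a]] by (force simp: o_def)
    from closedin_preimage[OF this closedin_forward[OF a compact_open_closedin[OF U]]]
    have "closedin T {l \<in> carrier G. conjpow a (- int N) (u \<otimes> inv l) \<in> forward a U}" .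
    moreover have "Y N = L \<inter> {l \<in> carrier G. conjpow a (- int N) (u \<otimes> inv l) \<in> forward a U}"
      using Lc by (auto simp: Y_def)
    ultimately show ?thesis using compact_Int_closedin[OF L(1)] by simp
  qed
  from nested_compact_nonempty[of T Y, OF Hausdorff' comp dec ne] obtain l where l: "\<And>N. l \<in> Y N" by blast
  then have lL: "l \<in> L" and lN: "\<And>N. conjpow a (- int N) (u \<otimes> inv l) \<in> forward a U" by (auto simp: Y_def)
  have lc: "l \<in> carrier G" using lL Lc by blast
  have "u \<otimes> inv l \<in> forward a U" using lN[of 0] uc lc by simp
  moreover have "u \<otimes> inv l \<in> forward (inv a) U"
    using lN forward_subset uc lc a by (fastforce simp: forward_def[of "inv a"])
  moreover have "u = (u \<otimes> inv l) \<otimes> l" using uc lc by (simp add: m_assoc)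
  ultimately show ?thesis using lL unfolding set_mult_iff by blast
qed

text \<open>The orbit of the factor in \<open>L\<close> stays in the compact group \<open>L\<close>;
  dropping that factor merely enlarges \<open>C\<close> to \<open>C <#> L\<close>.\<close>

lemma recurrent_in_tidy_above_mult:
  assumes a: "a \<in> carrier G" and U: "compact_open U" and tU: "U = forward (inv a) U <#> forward a U"
    and L: "compactin T L" "subgroup L G" and aL: "\<And>l n. l \<in> L \<Longrightarrow> conjpow a n l \<in> L"
    and eL: "tails a U \<subseteq> L" and nL: "\<And>l x. l \<in> L \<Longrightarrow> x \<in> U \<Longrightarrow> conjby l x \<in> U"
    and x: "x \<in> forward a U <#> L" and C: "compactin T C" and inf: "infinite {n::nat. conjpow a (- int n) x \<in> C}"
  shows "x \<in> (forward a U \<inter> forward (inv a) U) <#> L"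
proof -
  have Lc: "L \<subseteq> carrier G" by (rule subgroup.subset[OF L(2)])
  obtain u l where ul: "u \<in> forward a U" "l \<in> L" "x = u \<otimes> l" using x by (auto simp: set_mult_iff)
  have c: "u \<in> carrier G" "l \<in> carrier G" using ul forward_carrier Lc by auto
  have "{n::nat. conjpow a (- int n) x \<in> C} \<subseteq> {n::nat. conjpow a (- int n) u \<in> C <#> L}"
  proof safe
    fix n :: nat assume n: "conjpow a (- int n) x \<in> C"
    have "conjpow a (- int n) u = conjpow a (- int n) x \<otimes> inv (conjpow a (- int n) l)"
      using ul c a by (simp add: conjpow_mult m_assoc)
    then show "conjpow a (- int n) u \<in> C <#> L"
      using n subgroup.m_inv_closed[OF L(2) aL[OF ul(2)]] unfolding set_mult_iff by blast
  qed
  then have "infinite {n::nat. conjpow a (- int n) u \<in> C <#> L}" using inf infinite_super by blast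
  from recurrent_in_tidy_above[OF a U tU L aL eL nL ul(1) compactin_set_mult[OF C L(1)] this]
  obtain m l' where m: "m \<in> forward a U \<inter> forward (inv a) U" "l' \<in> L" "u = m \<otimes> l'" by (auto simp: set_mult_iff)
  have "m \<in> carrier G" "l' \<in> carrier G" using m forward_carrier Lc by auto
  then have "x = m \<otimes> (l' \<otimes> l)" using m ul c by (simp add: m_assoc)
  then show ?thesis using m(1) subgroup.m_closed[OF L(2) m(2) ul(2)] unfolding set_mult_iff by blast
qed

text \<open>A tidy subgroup is \<open>W = U L\<close>, where \<open>L\<close> is the closure of the group of elements whose orbit tails
  in \<open>U0\<close> on both sides and \<open>U \<subseteq> U0\<close> is tidy above and normalized by \<open>L\<close>.\<close>

lemma tidy_exists:
  assumes a: "a \<in> carrier G" and U0: "compact_open U0"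
  obtains W Xp Xm X0 where "tidy a W Xp Xm X0"
proof -
  have b: "inv a \<in> carrier G" using a by simp
  \<comment> \<open>\<open>L\<close> is formed from \<open>U0\<close>, before \<open>U\<close> is
    chosen, because \<open>U\<close> has to be normalized by \<open>L\<close>. Passing to a smaller
    group only shrinks the tails, so \<open>L\<close> still contains those of
    \<open>U\<close>.\<close>
  define L where "L = T closure_of (tails a U0)"
  have Es: "subgroup (tails a U0) G" by (rule subgroup_tails[OF a compact_openD(1)[OF U0]])
  have L: "compactin T L" "subgroup L G"
    unfolding L_def by (rule bdd_in_closure[OF bdd_in_tails[OF a U0]], rule subgroup_closure_of[OF Es])
  have Lc: "L \<subseteq> carrier G" by (rule subgroup.subset[OF L(2)])
  have aL: "conjpow a n l \<in> L" if "l \<in> L" for l n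
  proof -
    have "conjby (a [^] n) l \<in> L" unfolding L_def
    proof (rule conjby_closure_of)
      show "conjby (a [^] n) x \<in> tails a U0" if "x \<in> tails a U0" for x
        using conjpow_tails[OF a that, of n] by (simp add: conjpow_def)
    qed (use that a L_def in auto)
    then show ?thesis by (simp add: conjpow_def)
  qed
  obtain U1 where U1: "compact_open U1" "U1 \<subseteq> U0" "\<And>l. l \<in> L \<Longrightarrow> conjby l ` U1 = U1"
    by (rule core_compact[OF L U0]) blast
  obtain N where N: "compact_open {x \<in> carrier G. \<forall>k\<le>N::nat. conjpow a (- int k) x \<in> U1}"
    "{x \<in> carrier G. \<forall>k\<le>N. conjpow a (- int k) x \<in> U1} =
      forward (inv a) {x \<in> carrier G. \<forall>k\<le>N. conjpow a (- int k) x \<in> U1} <#>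
      forward a {x \<in> carrier G. \<forall>k\<le>N. conjpow a (- int k) x \<in> U1}"
    by (rule tidy_above_exists[OF a U1(1)])
  define U where "U = {x \<in> carrier G. \<forall>k\<le>N. conjpow a (- int k) x \<in> U1}"
  have U: "compact_open U" and tU: "U = forward (inv a) U <#> forward a U"
    using N unfolding U_def by blast+
  have Us: "subgroup U G" by (rule compact_openD(1)[OF U])
  have UU0: "U \<subseteq> U0"
  proof
    fix x assume "x \<in> U"
    then have "x \<in> carrier G" "conjpow a (- int 0) x \<in> U1" unfolding U_def by blast+
    then show "x \<in> U0" using U1(2) by auto
  qed
  have "tails a U0 \<subseteq> L" unfolding L_def using subgroup.subset[OF Es] by (intro closure_of_subset) simp
  then have eL: "tails a U \<subseteq> L" using tails_mono[OF UU0] by (rule subset_trans[rotated])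
  \<comment> \<open>\<open>U\<close> is cut out of \<open>U1\<close> by conditions at several powers
    of \<open>a\<close>. They are respected because \<open>L\<close> is invariant under those powers
    and normalizes \<open>U1\<close>.\<close>
  have nL: "conjby l x \<in> U" if lx: "l \<in> L" "x \<in> U" for l x
  proof -
    have c: "l \<in> carrier G" "x \<in> carrier G" using lx Lc by (auto simp: U_def)
    have "conjpow a (- int k) (conjby l x) \<in> U1" if k: "k \<le> N" for k
    proof -
      have "conjpow a (- int k) x \<in> U1" using lx(2) k by (auto simp: U_def)
      then have "conjby (conjpow a (- int k) l) (conjpow a (- int k) x) \<in> U1" using U1(3)[OF aL[OF lx(1)]] by blast
      then show ?thesis using c a by (simp add: conjpow_conjby)
    qed
    then show ?thesis using c by (simp add: U_def)
  qed
  have nf: "conjby l x \<in> forward a' U" if "a' \<in> {a, inv a}" "l \<in> L" "x \<in> forward a' U" for l x a'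
  proof -
    have c: "l \<in> carrier G" "x \<in> carrier G" using that Lc forward_carrier by auto
    have a'c: "a' \<in> carrier G" using that a by auto
    have "conjpow a' n l \<in> L" for n using that aL[OF that(2)] a by (cases "a' = a") auto
    then have "conjpow a' (int n) (conjby l x) \<in> U" for n
      using nL forward_D[OF that(3)] a'c c by (simp add: conjpow_conjby)
    then show ?thesis using c a'c by (simp add: forward_def)
  qed
  have fs: "subgroup (forward a U) G" "subgroup (forward (inv a) U) G" by (rule subgroup_forward[OF a Us], rule subgroup_forward[OF b Us])
  define W where "W = U <#> L"
  define Xp where "Xp = forward (inv a) U <#> L"
  define Xm where "Xm = forward a U <#> L"
  define X0 where "X0 = (forward a U \<inter> forward (inv a) U) <#> L"
  have subs: "subgroup W G" "subgroup Xp G" "subgroup Xm G" "subgroup X0 G"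
    unfolding W_def Xp_def Xm_def X0_def
    using nf nL by (auto intro!: subgroup_set_mult(1)[OF is_group] Us L fs subgroups_Inter_pair)
  have W: "compact_open W"
    unfolding compact_open_def W_def
    using subs(1) compactin_set_mult[OF compact_openD(2)[OF U] L(1)] openin_set_mult_left[OF Lc compact_openD(3)[OF U]]
    by (simp add: W_def)
  have Lx: "x \<in> S <#> L" if "x \<in> S" "S \<subseteq> carrier G" for x S
    using that subgroup.one_closed[OF L(2)] unfolding set_mult_iff by (metis r_one subsetD)
  have xL: "l \<in> S <#> L" if "l \<in> L" "subgroup S G" for l S
    using that(1) subgroup.one_closed[OF that(2)] Lc unfolding set_mult_iff by (metis l_one subsetD)
  have sub: "Xp \<subseteq> W" "Xm \<subseteq> W" "X0 \<subseteq> Xp" "X0 \<subseteq> Xm"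
    unfolding Xp_def Xm_def X0_def W_def by (intro mono_set_mult forward_subset subset_refl Int_lower1 Int_lower2)+
  have WX: "W = Xp <#> Xm"
  proof
    show "Xp <#> Xm \<subseteq> W"
      using subgroup.m_closed[OF subs(1)] sub(1,2) by (auto simp: set_mult_iff subset_iff)
    show "W \<subseteq> Xp <#> Xm"
    proof
      fix w assume "w \<in> W"
      then obtain u l where ul: "u \<in> U" "l \<in> L" "w = u \<otimes> l" by (auto simp: W_def set_mult_iff)
      have "u \<in> forward (inv a) U <#> forward a U" using ul(1) by (simp only: tU[symmetric])
      then obtain p m where pm: "p \<in> forward (inv a) U" "m \<in> forward a U" "u = p \<otimes> m" by (auto simp: set_mult_iff)
      have c: "p \<in> carrier G" "m \<in> carrier G" "l \<in> carrier G" using pm forward_carrier ul Lc by auto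
      have "w = p \<otimes> (m \<otimes> l)" using ul pm c by (simp add: m_assoc)
      moreover have "p \<in> Xp" unfolding Xp_def by (rule Lx[OF pm(1) subgroup.subset[OF fs(2)]])
      moreover have "m \<otimes> l \<in> Xm" using pm ul unfolding Xm_def set_mult_iff by blast
      ultimately show "w \<in> Xp <#> Xm" unfolding set_mult_iff by blast
    qed
  qed
  have a1: "conjpow a n x \<in> S <#> L" if h: "x \<in> S <#> L" "\<And>s. s \<in> S \<Longrightarrow> conjpow a n s \<in> S" "S \<subseteq> carrier G" for x n S
  proof -
    obtain s l where sl: "s \<in> S" "l \<in> L" "x = s \<otimes> l" using h(1) by (auto simp: set_mult_iff)
    then have "conjpow a n x = conjpow a n s \<otimes> conjpow a n l" using a Lc h(3) by (auto simp: conjpow_mult subset_iff)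
    then show ?thesis using h(2)[OF sl(1)] aL[OF sl(2)] unfolding set_mult_iff by blast
  qed
  have s1: "conjpow a (- int n) x \<in> Xp" if "x \<in> Xp" for x n
    using that unfolding Xp_def by (rule a1) (auto intro: conjpow_forward_inv[OF a] subgroup.subset[OF fs(2), THEN subsetD])
  have s2: "conjpow a (int n) x \<in> Xm" if "x \<in> Xm" for x n
    using that unfolding Xm_def by (rule a1) (auto intro: conjpow_forward[OF a] subgroup.subset[OF fs(1), THEN subsetD])
  have s0: "conjpow a n s \<in> forward a U \<inter> forward (inv a) U" if "s \<in> forward a U \<inter> forward (inv a) U" for s n
  proof -
    have sc: "s \<in> carrier G" using that forward_carrier by blast
    have "conjpow a k s \<in> U" for k using that forward_D[of s a U k] forward_inv_D[OF a, of s U k] by (cases "k \<ge> 0") auto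
    then show ?thesis using sc a by (simp add: forward_def)
  qed
  have s3: "conjpow a n x \<in> X0" if "x \<in> X0" for x n
    using that unfolding X0_def
    by (rule a1) (use s0 subgroup.subset[OF fs(1)] in auto)
  have t1: "x \<in> X0" if "x \<in> Xm" "compactin T C" "infinite {n::nat. conjpow a (- int n) x \<in> C}" for x C
    using recurrent_in_tidy_above_mult[OF a U tU L aL eL nL that(1)[unfolded Xm_def] that(2,3)]
    by (simp add: X0_def)
  have t2: "x \<in> X0" if "x \<in> Xp" "compactin T C" "infinite {n::nat. conjpow a (int n) x \<in> C}" for x C
  proof -
    have "U = forward a U <#> forward (inv a) U" using set_mult_subgroups_commute[OF fs(2,1) Us tU] .
    then have tU': "U = forward (inv (inv a)) U <#> forward (inv a) U" by (simp only: inv_inv[OF a])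
    have aL': "conjpow (inv a) n l \<in> L" if "l \<in> L" for l n using aL[OF that] a by simp
    have eL': "tails (inv a) U \<subseteq> L" using eL a by (simp add: tails_inverse)
    have "infinite {n::nat. conjpow (inv a) (- int n) x \<in> C}" using that(3) a by simp
    from recurrent_in_tidy_above_mult[OF b U tU' L aL' eL' nL that(1)[unfolded Xp_def] that(2) this]
    show ?thesis using a by (simp add: X0_def Int_commute)
  qed
  have "tidy a W Xp Xm X0"
    unfolding tidy_def using W subs(2-4) sub s1 s2 s3 t1 t2 by (intro conjI WX) blast+
  then show thesis by (rule that)
qed

end

section \<open>Automorphisms with recurrent returns\<close>
definition (in topological_group) visits :: "'a set \<Rightarrow> (nat \<Rightarrow> 'a) \<Rightarrow> 'a \<Rightarrow> bool" where
  "visits H g x \<longleftrightarrow> (\<exists>K. compactin T K \<and> infinite {n. g n \<otimes> x \<in> K <#> H})"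

text \<open>The set \<open>K <#> H\<close> is the preimage of the image of \<open>K\<close> in
  \<open>G/H\<close>. The points with infinitely many visits need not form a group; asking for
  \<open>u\<close> and \<open>w \<otimes> u\<close> at once makes an arbitrary \<open>w\<close> a
  quotient of two such points.\<close>

definition (in topological_group) recurrent :: "'a set \<Rightarrow> bool" where
  "recurrent H \<longleftrightarrow> (\<forall>g U w. (\<forall>n. g n \<in> carrier G) \<longrightarrow> openin T U \<longrightarrow> U \<noteq> {} \<longrightarrow> w \<in> carrier G \<longrightarrow>
     (\<exists>u\<in>U. visits H g u \<and> visits H g (w \<otimes> u)))"

lemma (in group) set_multI: "s \<in> S \<Longrightarrow> r \<in> R \<Longrightarrow> s \<otimes> r \<in> S <#> R"
  by (auto simp: set_mult_iff)

context hausdorff_group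
begin

lemma tidy_plus:
  assumes "tidy a W Xp Xm X0" "x \<in> Xp" "bdd_in T C" "infinite {n::nat. conjpow a (int n) x \<in> C}"
  shows "x \<in> X0"
proof -
  obtain K where K: "compactin T K" "C \<subseteq> K" using assms(3) by (auto simp: bdd_in_def)
  have "{n::nat. conjpow a (int n) x \<in> C} \<subseteq> {n::nat. conjpow a (int n) x \<in> K}" using K by auto
  then have "infinite {n::nat. conjpow a (int n) x \<in> K}" using assms(4) infinite_super by blast
  then show ?thesis using assms(1,2) K(1) unfolding tidy_def by blast
qed

lemma tidy_minus:
  assumes "tidy a W Xp Xm X0" "x \<in> Xm" "bdd_in T C" "infinite {n::nat. conjpow a (- int n) x \<in> C}"
  shows "x \<in> X0"
proof -
  obtain K where K: "compactin T K" "C \<subseteq> K" using assms(3) by (auto simp: bdd_in_def)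
  have "{n::nat. conjpow a (- int n) x \<in> C} \<subseteq> {n::nat. conjpow a (- int n) x \<in> K}" using K by auto
  then have "infinite {n::nat. conjpow a (- int n) x \<in> K}" using assms(4) infinite_super by blast
  then show ?thesis using assms(1,2) K(1) unfolding tidy_def by blast
qed

lemma tidyD:
  assumes "tidy a W Xp Xm X0"
  shows "compact_open W" "subgroup Xp G" "subgroup Xm G" "subgroup X0 G"
    "Xp \<subseteq> W" "Xm \<subseteq> W" "X0 \<subseteq> Xp" "X0 \<subseteq> Xm"
    "w \<in> W \<Longrightarrow> \<exists>p\<in>Xp. \<exists>m\<in>Xm. w = p \<otimes> m" "w \<in> W \<Longrightarrow> \<exists>m\<in>Xm. \<exists>p\<in>Xp. w = m \<otimes> p"
    "x \<in> Xp \<Longrightarrow> conjpow a (- int n) x \<in> Xp" "x \<in> Xm \<Longrightarrow> conjpow a (int n) x \<in> Xm" "x \<in> X0 \<Longrightarrow> conjpow a k x \<in> X0"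
proof -
  show 1: "compact_open W" "subgroup Xp G" "subgroup Xm G" "subgroup X0 G"
    "Xp \<subseteq> W" "Xm \<subseteq> W" "X0 \<subseteq> Xp" "X0 \<subseteq> Xm"
    using assms unfolding tidy_def by blast+
  have eq: "W = Xp <#> Xm" using assms unfolding tidy_def by blast
  have eq': "W = Xm <#> Xp" using set_mult_subgroups_commute[OF 1(2,3) compact_openD(1)[OF 1(1)] eq] .
  show "\<exists>p\<in>Xp. \<exists>m\<in>Xm. w = p \<otimes> m" if "w \<in> W" using that unfolding eq set_mult_iff .
  show "\<exists>m\<in>Xm. \<exists>p\<in>Xp. w = m \<otimes> p" if "w \<in> W" using that unfolding eq' set_mult_iff .
  show "x \<in> Xp \<Longrightarrow> conjpow a (- int n) x \<in> Xp" "x \<in> Xm \<Longrightarrow> conjpow a (int n) x \<in> Xm" "x \<in> X0 \<Longrightarrow> conjpow a k x \<in> X0"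
    using assms unfolding tidy_def by blast+
qed

text \<open>Split \<open>z\<close> as \<open>p \<otimes> m\<close>. The forward orbit of
  \<open>m\<close> stays in \<open>W\<close>, so that of \<open>p\<close> is bounded and
  \<open>p\<close> lies in \<open>X0\<close>. Then the backward orbit of \<open>p\<close> stays in
  \<open>W\<close> too, which bounds that of \<open>m\<close>.\<close>

lemma tidy_bounded_orbit:
  assumes a: "a \<in> carrier G" and t: "tidy a W Xp Xm X0" and z: "z \<in> W" and C: "bdd_in T (range (\<lambda>n. conjpow a n z))"
  shows "z \<in> X0"
proof -
  note t' = tidyD[OF t]
  have Wc: "W \<subseteq> carrier G" by (rule compact_open_subset[OF t'(1)])
  have Ws: "subgroup W G" by (rule compact_openD(1)[OF t'(1)])
  have bW: "bdd_in T W" by (rule compactin_imp_bdd_in[OF compact_openD(2)[OF t'(1)]])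
  obtain p m where pm: "p \<in> Xp" "m \<in> Xm" "z = p \<otimes> m" using t'(9)[OF z] by blast
  have c: "p \<in> carrier G" "m \<in> carrier G" "z \<in> carrier G" using pm(1,2) t'(5,6) Wc z by auto
  have "conjpow a (int n) p \<in> range (\<lambda>n. conjpow a n z) <#> W" for n
  proof -
    have "conjpow a (int n) p = conjpow a (int n) z \<otimes> inv (conjpow a (int n) m)"
      unfolding pm(3) using c a by (simp add: conjpow_mult m_assoc)
    moreover have "inv (conjpow a (int n) m) \<in> W"
      using t'(12)[OF pm(2)] t'(6) subgroup.m_inv_closed[OF Ws] by blast
    ultimately show ?thesis by (auto intro!: set_multI)
  qed
  then have "{n::nat. conjpow a (int n) p \<in> range (\<lambda>n. conjpow a n z) <#> W} = UNIV" by auto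
  then have p0: "p \<in> X0" using tidy_plus[OF t pm(1) bdd_in_set_mult[OF C bW]] by simp
  have "conjpow a (- int n) m \<in> W <#> range (\<lambda>n. conjpow a n z)" for n
  proof -
    have "conjpow a (- int n) m = inv (conjpow a (- int n) p) \<otimes> conjpow a (- int n) z"
      unfolding pm(3) using c a by (simp add: conjpow_mult)
    moreover have "inv (conjpow a (- int n) p) \<in> W"
      using t'(13)[OF p0] t'(5,7) subgroup.m_inv_closed[OF Ws] by blast
    ultimately show ?thesis by (auto intro!: set_multI)
  qed
  then have "{n::nat. conjpow a (- int n) m \<in> W <#> range (\<lambda>n. conjpow a n z)} = UNIV" by auto
  then have "m \<in> X0" using tidy_minus[OF t pm(2) bdd_in_set_mult[OF bW C]] by simp
  then show ?thesis using p0 subgroup.m_closed[OF t'(4)] pm(3) by simp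
qed

text \<open>If the forward orbit of an element of the expanding part returns to \<open>K B\<close> infinitely often, where
  the elements of \<open>B\<close> have bounded orbits, then comparing two returns \<open>k w b\<close> and \<open>k w' b'\<close> bounds
  \<open>b'\<close> in terms of \<open>b\<close>.\<close>

lemma tidy_returns:
  assumes a: "a \<in> carrier G" and t: "tidy a W Xp Xm X0" and Bc: "B \<subseteq> carrier G"
    and B: "\<And>b. b \<in> B \<Longrightarrow> bdd_in T (range (\<lambda>n. conjpow a n b))"
    and x: "x \<in> Xp" and K: "compactin T K" and inf: "infinite {n::nat. conjpow a (int n) x \<in> K <#> B}"
  shows "x \<in> X0"
proof -
  note t' = tidyD[OF t]
  have Wc: "W \<subseteq> carrier G" by (rule compact_open_subset[OF t'(1)])
  have Ws: "subgroup W G" by (rule compact_openD(1)[OF t'(1)])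
  note Wm = subgroup.m_closed[OF Ws] and Wi = subgroup.m_inv_closed[OF Ws]
  have bW: "bdd_in T W" by (rule compactin_imp_bdd_in[OF compact_openD(2)[OF t'(1)]])
  have xc: "x \<in> carrier G" using x t'(5) Wc by auto
  define I where "I = {n::nat. conjpow a (int n) x \<in> K <#> B}"
  have "\<forall>n\<in>I. \<exists>k b. k \<in> K \<and> b \<in> B \<and> conjpow a (int n) x = k \<otimes> b" by (auto simp: I_def set_mult_iff)
  then obtain \<kappa> \<beta> where \<kappa>: "\<And>n. n \<in> I \<Longrightarrow> \<kappa> n \<in> K \<and> \<beta> n \<in> B \<and> conjpow a (int n) x = \<kappa> n \<otimes> \<beta> n" by metis
  have "{n \<in> I. \<kappa> n \<in> K} = I" using \<kappa> by auto
  then have "infinite {n \<in> I. \<kappa> n \<in> K}" using inf by (simp add: I_def)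
  from compact_pigeonhole[OF K compact_openD(1,3)[OF t'(1)] this]
  obtain k where k: "k \<in> K" "infinite {n \<in> I. \<kappa> n \<in> k <# W}" .
  have kc: "k \<in> carrier G" using k(1) compactin_subset_carrier[OF K] by blast
  define J where "J = {n \<in> I. \<kappa> n \<in> k <# W}"
  have J: "infinite J" using k(2) by (simp add: J_def)
  have "\<forall>n\<in>J. \<exists>w. w \<in> W \<and> \<kappa> n = k \<otimes> w" by (auto simp: J_def l_coset_iff)
  then obtain \<omega> where \<omega>: "\<And>n. n \<in> J \<Longrightarrow> \<omega> n \<in> W \<and> \<kappa> n = k \<otimes> \<omega> n" by metis
  have JD: "\<omega> n \<in> W" "\<beta> n \<in> B" "conjpow a (int n) x = k \<otimes> (\<omega> n \<otimes> \<beta> n)" if "n \<in> J" for n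
  proof -
    have nI: "n \<in> I" using that by (simp add: J_def)
    show *: "\<omega> n \<in> W" "\<beta> n \<in> B" using \<omega>[OF that] \<kappa>[OF nI] by auto
    show "conjpow a (int n) x = k \<otimes> (\<omega> n \<otimes> \<beta> n)"
      using \<omega>[OF that] \<kappa>[OF nI] * kc Wc Bc by (auto simp: m_assoc subset_iff)
  qed
  obtain i where i: "i \<in> J" using J by (metis infinite_imp_nonempty ex_in_conv)
  define Ci where "Ci = range (\<lambda>n. conjpow a n (\<beta> i))"
  have bCi: "bdd_in T Ci" unfolding Ci_def by (rule B[OF JD(2)[OF i]])
  define C' where "C' = W <#> Ci <#> W <#> W"
  have bC': "bdd_in T C'" unfolding C'_def by (intro bdd_in_set_mult bW bCi)
  have main: "\<beta> j \<in> C'" if j: "j \<in> J" "i < j" for j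
  proof -
    have c: "\<beta> i \<in> carrier G" "\<beta> j \<in> carrier G" "\<omega> i \<in> carrier G" "\<omega> j \<in> carrier G"
      using JD(1,2)[OF i] JD(1,2)[OF j(1)] Bc Wc by auto
    define Cj where "Cj = range (\<lambda>n. conjpow a n (\<beta> j))"
    have bCj: "bdd_in T Cj" unfolding Cj_def by (rule B[OF JD(2)[OF j(1)]])
    define y where "y = inv (conjpow a (int i) x) \<otimes> conjpow a (int j) x"
    define v where "v = inv (\<omega> i) \<otimes> \<omega> j"
    have yc: "y \<in> carrier G" using a xc by (simp add: y_def)
    have vW: "v \<in> W" unfolding v_def using JD(1)[OF i] JD(1)[OF j(1)] Wm Wi by simp
    have vc: "v \<in> carrier G" using vW Wc by auto
    have y: "y = inv (\<beta> i) \<otimes> (v \<otimes> \<beta> j)"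
      unfolding y_def JD(3)[OF i] JD(3)[OF j(1)] v_def using c kc by (simp add: group_nf)
    have v: "v = \<beta> i \<otimes> (y \<otimes> inv (\<beta> j))" unfolding y using c vc by (simp add: m_assoc)
    \<comment> \<open>From backward time \<open>j\<close> on, both factors of \<open>y\<close> are
      backward translates of \<open>x\<close> itself, and the expanding part is stable under
      those.\<close>
    have yXp: "conjpow a (- int m) y \<in> Xp" if "m \<ge> j" for m
    proof -
      have "conjpow a (- int m) y = inv (conjpow a (- int (m - i)) x) \<otimes> conjpow a (- int (m - j)) x"
        using that j(2) a xc by (simp add: y_def conjpow_mult conjpow_inv)
      then show ?thesis using t'(11)[OF x] subgroup.m_closed[OF t'(2)] subgroup.m_inv_closed[OF t'(2)] by simp
    qed
    \<comment> \<open>This bound still depends on \<open>\<beta> j\<close> through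
      \<open>Cj\<close>. It serves only to show that \<open>v\<close> lies in \<open>Xp\<close>;
      that conclusion no longer mentions the bound.\<close>
    have bv: "conjpow a (- int m) v \<in> Ci <#> (W <#> (\<lambda>x. inv x) ` Cj)" if "m \<ge> j" for m
    proof -
      have "conjpow a (- int m) v = conjpow a (- int m) (\<beta> i) \<otimes> (conjpow a (- int m) y \<otimes> inv (conjpow a (- int m) (\<beta> j)))"
        using c yc a by (subst v) (simp add: conjpow_mult conjpow_inv)
      moreover have "conjpow a (- int m) y \<in> W" using yXp[OF that] t'(5) by blast
      ultimately show ?thesis unfolding Ci_def Cj_def by (auto intro!: set_multI)
    qed
    obtain q p where qp: "q \<in> Xm" "p \<in> Xp" "v = q \<otimes> p" using t'(10)[OF vW] by blast
    have c': "q \<in> carrier G" "p \<in> carrier G" using qp t'(5,6) Wc by auto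
    have "{j..} \<subseteq> {m::nat. conjpow a (- int m) q \<in> Ci <#> (W <#> (\<lambda>x. inv x) ` Cj) <#> W}"
    proof safe
      fix m assume m: "m \<ge> j"
      have "conjpow a (- int m) q = conjpow a (- int m) v \<otimes> inv (conjpow a (- int m) p)"
        unfolding qp(3) using c' a by (simp add: conjpow_mult m_assoc)
      moreover have "inv (conjpow a (- int m) p) \<in> W" using t'(5,11) qp(2) Wi by blast
      ultimately show "conjpow a (- int m) q \<in> Ci <#> (W <#> (\<lambda>x. inv x) ` Cj) <#> W"
        using bv[OF m] by (simp add: set_multI)
    qed
    then have "infinite {m::nat. conjpow a (- int m) q \<in> Ci <#> (W <#> (\<lambda>x. inv x) ` Cj) <#> W}"
      using infinite_super infinite_Ici by blast
    then have "q \<in> X0"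
      by (rule tidy_minus[OF t qp(1), rotated]) (intro bdd_in_set_mult bCi bW bdd_in_inv_image bCj)
    then have vXp: "v \<in> Xp" using t'(7) qp subgroup.m_closed[OF t'(2)] by blast
    \<comment> \<open>With the backward orbit of \<open>v\<close> in \<open>W\<close>, the bound for
      \<open>\<beta> j\<close> is uniform in \<open>j\<close>, although only at backward times
      \<open>m \<ge> j\<close>.\<close>
    have far: "conjpow a (- int m) (\<beta> j) \<in> W <#> Ci <#> W" if "m \<ge> j" for m
    proof -
      have "\<beta> j = inv v \<otimes> \<beta> i \<otimes> y" unfolding y using c vc by (simp add: m_assoc)
      then have "conjpow a (- int m) (\<beta> j) = conjpow a (- int m) (inv v \<otimes> \<beta> i \<otimes> y)" by simp
      also have "\<dots> = inv (conjpow a (- int m) v) \<otimes> conjpow a (- int m) (\<beta> i) \<otimes> conjpow a (- int m) y"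
        using c vc yc a by (simp add: conjpow_mult conjpow_inv)
      finally have "conjpow a (- int m) (\<beta> j) = inv (conjpow a (- int m) v) \<otimes> conjpow a (- int m) (\<beta> i) \<otimes> conjpow a (- int m) y" .
      moreover have "inv (conjpow a (- int m) v) \<in> W" using t'(5,11) vXp Wi by blast
      moreover have "conjpow a (- int m) y \<in> W" using yXp[OF that] t'(5) by blast
      ultimately show ?thesis unfolding Ci_def by (auto intro!: set_multI)
    qed
    obtain Kj where Kj: "compactin T Kj" "Cj \<subseteq> Kj" using bCj by (auto simp: bdd_in_def)
    \<comment> \<open>The bound must be carried from time \<open>j\<close> or later back to time
      \<open>0\<close>. The bounded orbit of \<open>\<beta> j\<close> has approximate returns;
      sampling it at multiples of \<open>j\<close> makes every return time at least
      \<open>j\<close>, where \<open>far\<close> applies. The return costs one more factor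
      \<open>W\<close> in \<open>C'\<close>.\<close>
    define f where "f n = conjpow a (- int (n * j)) (\<beta> j)" for n :: nat
    have "f n \<in> Kj" for n using Kj(2) by (auto simp: f_def Cj_def)
    from compact_returns[where f = f, OF Kj(1) t'(1) infinite_UNIV_nat this]
    obtain n1 n2 where n2: "n1 < n2" and fW: "inv (f n1) \<otimes> f n2 \<in> W" .
    define z where "z = inv (f n1) \<otimes> f n2"
    have fc: "f n \<in> carrier G" for n using a c by (simp add: f_def)
    have zc: "z \<in> carrier G" using fc by (simp add: z_def)
    have zW: "z \<in> W" using fW by (simp add: z_def)
    have "range (\<lambda>n. conjpow a n z) \<subseteq> (\<lambda>x. inv x) ` Cj <#> Cj"
    proof safe
      fix n
      have "conjpow a n z = inv (conjpow a (n - int (n1 * j)) (\<beta> j)) \<otimes> conjpow a (n - int (n2 * j)) (\<beta> j)"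
        using a c by (simp add: z_def f_def conjpow_mult conjpow_inv)
      then show "conjpow a n z \<in> (\<lambda>x. inv x) ` Cj <#> Cj" unfolding Cj_def by (auto intro!: set_multI)
    qed
    then have "z \<in> X0"
      using tidy_bounded_orbit[OF a t zW] bdd_in_subset[OF bdd_in_set_mult[OF bdd_in_inv_image[OF bCj] bCj]] by blast
    then have "conjpow a (int (n1 * j)) z \<in> W" using t'(13) t'(5,7) by blast
    moreover have "conjpow a (int (n1 * j)) z = inv (\<beta> j) \<otimes> conjpow a (- int ((n2 - n1) * j)) (\<beta> j)"
    proof -
      have "int (n1 * j) + - int (n2 * j) = - int ((n2 - n1) * j)" using n2 by (simp add: diff_mult_distrib of_nat_diff)
      then show ?thesis using a c by (simp add: z_def f_def conjpow_mult conjpow_inv)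
    qed
    ultimately have in_W: "inv (\<beta> j) \<otimes> conjpow a (- int ((n2 - n1) * j)) (\<beta> j) \<in> W" by simp
    define s where "s = conjpow a (- int ((n2 - n1) * j)) (\<beta> j)"
    have sc: "s \<in> carrier G" using a c by (simp add: s_def)
    have "1 \<le> n2 - n1" using n2 by simp
    then have "j \<le> (n2 - n1) * j" using mult_le_mono1[of 1 "n2 - n1" j] by simp
    from far[OF this] have "s \<in> W <#> Ci <#> W" by (simp only: s_def)
    moreover have "inv (inv (\<beta> j) \<otimes> s) \<in> W" using in_W Wi by (simp add: s_def)
    ultimately have "s \<otimes> inv (inv (\<beta> j) \<otimes> s) \<in> C'" unfolding C'_def by (rule set_multI)
    moreover have "s \<otimes> inv (inv (\<beta> j) \<otimes> s) = \<beta> j" using sc c by (simp add: group_nf)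
    ultimately show ?thesis by simp
  qed
  have "{j \<in> J. i < j} \<subseteq> {n::nat. conjpow a (int n) x \<in> {k} <#> W <#> C'}"
  proof safe
    fix j assume j: "j \<in> J" "i < j"
    have "conjpow a (int j) x = (k \<otimes> \<omega> j) \<otimes> \<beta> j"
      using JD[OF j(1)] kc Wc Bc by (auto simp: m_assoc subset_iff)
    then show "conjpow a (int j) x \<in> {k} <#> W <#> C'"
      using main[OF j] JD(1)[OF j(1)] by (auto intro!: set_multI)
  qed
  moreover have "infinite {j \<in> J. i < j}"
  proof -
    have "J \<subseteq> {j \<in> J. i < j} \<union> {..i}" by auto
    then show ?thesis using J finite_subset by blast
  qed
  ultimately have "infinite {n::nat. conjpow a (int n) x \<in> {k} <#> W <#> C'}" using infinite_super by blast
  then show ?thesis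
    by (rule tidy_plus[OF t x, rotated]) (intro bdd_in_set_mult bdd_in_singleton kc bW bC')
qed

text \<open>Recurrence yields \<open>u\<close> such that both \<open>u\<close> and \<open>w u\<close> return infinitely often; both then lie in \<open>Xm\<close>, hence
  so does \<open>w\<close>.\<close>

lemma tidy_recurrent_half:
  assumes a: "a \<in> H" and t: "tidy a W Xp Xm X0" and H: "subgroup H G" and rec: "recurrent H"
    and F: "finite F" "F \<subseteq> carrier G" and B: "B \<subseteq> carrier G" "H \<subseteq> F <#> B"
    and bB: "\<And>b. b \<in> B \<Longrightarrow> bdd_in T (range (\<lambda>n. conjpow a n b))"
  shows "W \<subseteq> Xm"
proof
  note t' = tidyD[OF t]
  have Hc: "H \<subseteq> carrier G" by (rule subgroup.subset[OF H])
  have ac: "a \<in> carrier G" using a Hc by auto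
  have Wc: "W \<subseteq> carrier G" by (rule compact_open_subset[OF t'(1)])
  have Ws: "subgroup W G" by (rule compact_openD(1)[OF t'(1)])
  have Wk: "compactin T W" by (rule compact_openD(2)[OF t'(1)])
  \<comment> \<open>Multiplying \<open>a [^] (int n) \<otimes> u\<close> on the right by the inverse
    power of \<open>a\<close>, an element of \<open>H\<close>, stays in \<open>K <#> H\<close>. So
    visits of the translates are visits of the conjugates of \<open>u\<close>. The forward orbit of
    \<open>m\<close> lies in \<open>W\<close>, hence the expanding factor \<open>p\<close> returns
    to a compact set times \<open>B\<close>.\<close>
  have claim: "u \<in> Xm" if u: "u \<in> W" "visits H (\<lambda>n. a [^] (int n)) u" for u
  proof -
    obtain K where K: "compactin T K" "infinite {n. a [^] (int n) \<otimes> u \<in> K <#> H}"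
      using u(2) by (auto simp: visits_def)
    have Kc: "K \<subseteq> carrier G" by (rule compactin_subset_carrier[OF K(1)])
    obtain m p where mp: "m \<in> Xm" "p \<in> Xp" "u = m \<otimes> p" using t'(10)[OF u(1)] by blast
    have c: "m \<in> carrier G" "p \<in> carrier G" "u \<in> carrier G" using mp(1,2) t'(5,6) Wc u(1) by auto
    have FK: "compactin T F" by (rule finite_imp_compactin) (use F in auto)
    have "{n. a [^] (int n) \<otimes> u \<in> K <#> H} \<subseteq> {n. conjpow a (int n) p \<in> W <#> (K <#> F) <#> B}"
    proof safe
      fix n assume "a [^] (int n) \<otimes> u \<in> K <#> H"
      then obtain k h where kh: "k \<in> K" "h \<in> H" "a [^] (int n) \<otimes> u = k \<otimes> h" by (auto simp: set_mult_iff)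
      have kc: "k \<in> carrier G" using kh Kc by blast
      have "a [^] (int n) \<in> H" using a H by (meson int_pow_closed subgroup_int_pow_closed)
      then have h': "h \<otimes> inv (a [^] (int n)) \<in> H"
        using kh(2) subgroup.m_closed[OF H] subgroup.m_inv_closed[OF H] by blast
      then obtain f b where fb: "f \<in> F" "b \<in> B" "h \<otimes> inv (a [^] (int n)) = f \<otimes> b"
        using B(2) unfolding subset_iff set_mult_iff by blast
      have "conjpow a (int n) u = (a [^] (int n) \<otimes> u) \<otimes> inv (a [^] (int n))" by (simp add: conjpow_def conjby_def)
      also have "\<dots> = k \<otimes> (h \<otimes> inv (a [^] (int n)))" unfolding kh(3) using kc kh(2) Hc ac by (auto simp: m_assoc subset_iff)
      also have "\<dots> = k \<otimes> (f \<otimes> b)" unfolding fb(3) ..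
      finally have e: "conjpow a (int n) u = k \<otimes> (f \<otimes> b)" .
      have fbc: "f \<in> carrier G" "b \<in> carrier G" using fb F B by auto
      have mi: "inv (conjpow a (int n) m) \<in> W"
        using t'(12)[OF mp(1)] t'(6) subgroup.m_inv_closed[OF Ws] by blast
      have mic: "inv (conjpow a (int n) m) \<in> carrier G" using c ac by simp
      have "conjpow a (int n) p = inv (conjpow a (int n) m) \<otimes> conjpow a (int n) u" unfolding mp(3) using c ac by (simp add: conjpow_mult)
      also have "\<dots> = (inv (conjpow a (int n) m) \<otimes> (k \<otimes> f)) \<otimes> b"
        unfolding e using mic kc fbc by (simp add: m_assoc)
      finally show "conjpow a (int n) p \<in> W <#> (K <#> F) <#> B"
        using mi kh(1) fb(1,2) by (auto intro!: set_multI)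
    qed
    then have "infinite {n. conjpow a (int n) p \<in> W <#> (K <#> F) <#> B}" using K(2) infinite_super by blast
    from tidy_returns[OF ac t B(1) bB mp(2) compactin_set_mult[OF Wk compactin_set_mult[OF K(1) FK]] this]
    have "p \<in> Xm" using t'(8) by blast
    then show ?thesis using mp subgroup.m_closed[OF t'(3)] by simp
  qed
  fix w assume w: "w \<in> W"
  have wc: "w \<in> carrier G" using w Wc by blast
  have "W \<noteq> {}" using w by blast
  moreover have "\<And>n::nat. a [^] (int n) \<in> carrier G" using ac by simp
  ultimately obtain u where u: "u \<in> W" "visits H (\<lambda>n. a [^] (int n)) u" "visits H (\<lambda>n. a [^] (int n)) (w \<otimes> u)"
    using rec[unfolded recurrent_def, rule_format, of "\<lambda>n. a [^] (int n)" W w] compact_openD(3)[OF t'(1)] wc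
    by blast
  have uc: "u \<in> carrier G" using u Wc by blast
  have "u \<in> Xm" "w \<otimes> u \<in> Xm" using claim u subgroup.m_closed[OF Ws w] by auto
  then have "(w \<otimes> u) \<otimes> inv u \<in> Xm" using subgroup.m_closed[OF t'(3)] subgroup.m_inv_closed[OF t'(3)] by blast
  then show "w \<in> Xm" using wc uc by (simp add: m_assoc)
qed

text \<open>Replacing \<open>a\<close> by \<open>inv a\<close> exchanges \<open>Xp\<close> and
  \<open>Xm\<close>, so \<open>tidy_recurrent_half\<close> applies twice and puts \<open>W\<close>
  inside both parts. The orbit of \<open>W\<close> then stays in \<open>W\<close> in both
  directions.\<close>

lemma normalizes_compact_open:
  assumes U: "compact_open U"
    and a: "a \<in> H" and H: "subgroup H G" and rec: "recurrent H"
    and F: "finite F" "F \<subseteq> carrier G" and B: "B \<subseteq> carrier G" "H \<subseteq> F <#> B"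
    and bB: "\<And>b. b \<in> B \<Longrightarrow> bdd_in T (range (\<lambda>n. conjpow a n b))"
  obtains W where "compact_open W" "\<And>n. conjpow a n ` W = W"
proof -
  have ac: "a \<in> carrier G" using a subgroup.subset[OF H] by auto
  obtain W Xp Xm X0 where t: "tidy a W Xp Xm X0" by (rule tidy_exists[OF ac U])
  note t' = tidyD[OF t]
  have Wc: "W \<subseteq> carrier G" by (rule compact_open_subset[OF t'(1)])
  have 1: "W \<subseteq> Xm" by (rule tidy_recurrent_half[OF a t H rec F B bB])
  have "range (\<lambda>n. conjpow (inv a) n b) = range (\<lambda>n. conjpow a n b)" if "b \<in> B" for b
  proof -
    have "range (\<lambda>n. conjpow (inv a) n b) = range ((\<lambda>n. conjpow a n b) \<circ> uminus)" using ac by (simp add: o_def)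
    then show ?thesis by (simp only: image_comp[symmetric] surj_uminus)
  qed
  then have bB': "bdd_in T (range (\<lambda>n. conjpow (inv a) n b))" if "b \<in> B" for b using bB that by simp
  have 2: "W \<subseteq> Xp"
    by (rule tidy_recurrent_half[OF subgroup.m_inv_closed[OF H a] tidy_inverse[OF ac t] H rec F B bB'])
  have inW: "conjpow a n w \<in> W" if "w \<in> W" for n w
  proof (cases "n \<ge> 0")
    case True
    then show ?thesis using t'(12)[of w "nat n"] 1 t'(6) that by auto
  next
    case False
    then show ?thesis using t'(11)[of w "nat (-n)"] 2 t'(5) that by auto
  qed
  have "conjpow a n ` W = W" for n
  proof
    show "conjpow a n ` W \<subseteq> W" using inW by auto
    show "W \<subseteq> conjpow a n ` W"
    proof
      fix w assume w: "w \<in> W"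
      then have "w = conjpow a n (conjpow a (-n) w)" using ac Wc by auto
      then show "w \<in> conjpow a n ` W" using inW[OF w, of "-n"] by blast
    qed
  qed
  then show thesis using that t'(1) by blast
qed

end

section \<open>Schlichting's theorem\<close>
definition (in group) Normalizer :: "'a set \<Rightarrow> 'a set" where
  "Normalizer S = {g \<in> carrier G. conjby g ` S = S}"

context group
begin

lemma subgroup_Normalizer:
  assumes S: "S \<subseteq> carrier G" shows "subgroup (Normalizer S) G"
proof
  show "Normalizer S \<subseteq> carrier G" by (auto simp: Normalizer_def)
  show "\<one> \<in> Normalizer S" using S by (simp add: Normalizer_def)
  show "x \<otimes> y \<in> Normalizer S" if xy: "x \<in> Normalizer S" "y \<in> Normalizer S" for x y
  proof -
    have c: "x \<in> carrier G" "y \<in> carrier G" "conjby x ` S = S" "conjby y ` S = S" using xy by (auto simp: Normalizer_def)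
    have "conjby (x \<otimes> y) ` S = conjby x ` conjby y ` S" by (rule conjby_image_comp[OF c(1,2) S, symmetric])
    then show ?thesis using c by (simp add: Normalizer_def)
  qed
  show "inv x \<in> Normalizer S" if x: "x \<in> Normalizer S" for x
  proof -
    have xc: "x \<in> carrier G" and eq: "conjby x ` S = S" using x by (auto simp: Normalizer_def)
    have "conjby (inv x) ` S = conjby (inv x) ` conjby x ` S" by (simp only: eq)
    also have "\<dots> = S" using S xc by (simp add: conjby_image_comp)
    finally show ?thesis using xc by (simp add: Normalizer_def)
  qed
qed

lemma NormalizerD: "g \<in> Normalizer S \<Longrightarrow> conjby g ` S = S" "g \<in> Normalizer S \<Longrightarrow> g \<in> carrier G"
  by (auto simp: Normalizer_def)

lemma Normalizer_conjby: "g \<in> Normalizer S \<Longrightarrow> x \<in> S \<Longrightarrow> conjby g x \<in> S"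
  by (auto simp: Normalizer_def)

lemma subgroup_subset_Normalizer:
  assumes S: "subgroup S G" shows "S \<subseteq> Normalizer S"
proof -
  have Sc: "S \<subseteq> carrier G" by (rule subgroup.subset[OF S])
  have 1: "conjby s ` S \<subseteq> S" if "s \<in> S" for s
    using that subgroup.m_closed[OF S] subgroup.m_inv_closed[OF S] by (auto simp: conjby_def)
  have "S \<subseteq> conjby s ` S" if s: "s \<in> S" for s
  proof
    fix x assume x: "x \<in> S"
    have "conjby (inv s) x \<in> S" using 1[OF subgroup.m_inv_closed[OF S s]] x by blast
    then show "x \<in> conjby s ` S" using s x Sc by (subst mem_conjby_image_iff) auto
  qed
  then have "conjby s ` S = S" if "s \<in> S" for s using 1[OF that] that by (intro equalityI)
  then show ?thesis using Sc unfolding Normalizer_def by blast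
qed

text \<open>As \<open>S\<close> normalizes \<open>U\<close>, the product on the right is already a
  group containing all generators.\<close>

lemma generate_normalized:
  assumes U: "subgroup U G" and S: "S \<subseteq> Normalizer U"
  shows "generate G (S \<union> U) \<subseteq> U <#> generate G S"
proof (rule generate_subgroup_incl)
  have Uc: "U \<subseteq> carrier G" by (rule subgroup.subset[OF U])
  have Sc: "S \<subseteq> carrier G" using S NormalizerD(2) by blast
  have D: "subgroup (generate G S) G" by (rule generate_is_subgroup[OF Sc])
  have "generate G S \<subseteq> Normalizer U" by (rule generate_subgroup_incl[OF S subgroup_Normalizer[OF Uc]])
  then show "subgroup (U <#> generate G S) G"
    by (intro subgroup_set_mult(1)[OF is_group U D]) (use Normalizer_conjby in blast)
  show "S \<union> U \<subseteq> U <#> generate G S"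
  proof
    fix y assume "y \<in> S \<union> U"
    then consider "y \<in> S" | "y \<in> U" by blast
    then show "y \<in> U <#> generate G S"
    proof cases
      case 1
      then have "\<one> \<otimes> y \<in> U <#> generate G S" by (intro set_multI subgroup.one_closed[OF U] generate.incl)
      then show ?thesis using 1 Sc by auto
    next
      case 2
      then have "y \<otimes> \<one> \<in> U <#> generate G S" by (intro set_multI generate.one)
      then show ?thesis using 2 Uc by auto
    qed
  qed
qed

lemma conjby_image_inj:
  assumes "g \<in> carrier G" "S \<subseteq> carrier G" "R \<subseteq> carrier G"
  shows "conjby g ` (S \<inter> R) = conjby g ` S \<inter> conjby g ` R"
proof (rule inj_on_image_Int[of _ "carrier G"])
  show "inj_on (conjby g) (carrier G)"
    by (rule inj_on_inverseI[of _ "conjby (inv g)"]) (use assms in auto)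
qed (use assms in auto)

lemma generate_finite:
  assumes "x \<in> generate G (\<Union>i\<in>I. S i)" "I \<noteq> {}"
  shows "\<exists>J. finite J \<and> J \<noteq> {} \<and> J \<subseteq> I \<and> x \<in> generate G (\<Union>i\<in>J. S i)"
  using assms(1)
proof induction
  case one
  obtain i where "i \<in> I" using assms(2) by blast
  then show ?case by (intro exI[of _ "{i}"]) (auto intro: generate.one)
next
  case (incl h)
  then obtain i where "i \<in> I" "h \<in> S i" by blast
  then show ?case by (intro exI[of _ "{i}"]) (auto intro: generate.incl)
next
  case (inv h)
  then obtain i where "i \<in> I" "h \<in> S i" by blast
  then show ?case by (intro exI[of _ "{i}"]) (auto intro: generate.inv)
next
  case (eng h1 h2)
  then obtain J K where J: "finite J" "J \<noteq> {}" "J \<subseteq> I" "h1 \<in> generate G (\<Union>i\<in>J. S i)"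
    and K: "finite K" "K \<noteq> {}" "K \<subseteq> I" "h2 \<in> generate G (\<Union>i\<in>K. S i)" by blast
  have "h1 \<in> generate G (\<Union>i\<in>J \<union> K. S i)" "h2 \<in> generate G (\<Union>i\<in>J \<union> K. S i)"
    using J(4) K(4) mono_generate[of "\<Union>i\<in>J. S i" "\<Union>i\<in>J \<union> K. S i"]
      mono_generate[of "\<Union>i\<in>K. S i" "\<Union>i\<in>J \<union> K. S i"] by blast+
  then have "h1 \<otimes> h2 \<in> generate G (\<Union>i\<in>J \<union> K. S i)" by (rule generate.eng)
  moreover have "finite (J \<union> K)" "J \<union> K \<noteq> {}" "J \<union> K \<subseteq> I" using J K by auto
  ultimately show ?case by blast
qed

lemma generate_conjby:
  assumes S: "S \<subseteq> carrier G" and g: "g \<in> carrier G" and gS: "\<And>x. x \<in> S \<Longrightarrow> conjby g x \<in> S"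
    and x: "x \<in> generate G S"
  shows "conjby g x \<in> generate G S"
  using x
proof induction
  case one
  show ?case using g generate.one[of G S] by simp
next
  case (incl h)
  show ?case by (rule generate.incl[OF gS[OF incl]])
next
  case (inv h)
  have "h \<in> carrier G" using inv S by blast
  then have "conjby g (inv h) = inv (conjby g h)" using g by (simp add: conjby_inv)
  then show ?case using generate.inv[OF gS[OF inv]] by simp
next
  case (eng h1 h2)
  have "h1 \<in> carrier G" "h2 \<in> carrier G" using eng(1,2) generate_in_carrier[OF S] by auto
  then show ?case using generate.eng[OF eng(3,4)] g by (simp add: conjby_mult)
qed

lemma l_coset_l_coset:
  assumes "x \<in> carrier G" "y \<in> carrier G" "U \<subseteq> carrier G" shows "x <# (y <# U) = x \<otimes> y <# U"
  using assms by (force simp: l_coset_def m_assoc subset_iff)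

lemma l_coset_eqI:
  assumes U: "subgroup U G" and x: "x \<in> carrier G" and y: "y \<in> x <# U"
  shows "y <# U = x <# U"
proof -
  have Uc: "U \<subseteq> carrier G" by (rule subgroup.subset[OF U])
  obtain u where u: "u \<in> U" "y = x \<otimes> u" using y by (auto simp: l_coset_iff)
  have uU: "u <# U = U"
  proof
    show "u <# U \<subseteq> U" using subgroup.m_closed[OF U u(1)] by (auto simp: l_coset_iff)
    show "U \<subseteq> u <# U"
    proof
      fix v assume v: "v \<in> U"
      have "v = u \<otimes> (inv u \<otimes> v)" using u v Uc by (simp add: subset_iff)
      then show "v \<in> u <# U"
        using subgroup.m_closed[OF U subgroup.m_inv_closed[OF U u(1)] v] unfolding l_coset_iff by blast
    qed
  qed
  have "y <# U = x <# (u <# U)" unfolding u(2) using x u(1) Uc by (intro l_coset_l_coset[symmetric]) auto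
  then show ?thesis by (simp only: uU)
qed

end

context hausdorff_group
begin

lemma finite_l_cosets:
  fixes C U :: "'a set"
  assumes C: "compactin T C" and U: "compact_open U" shows "finite ((\<lambda>x. x <# U) ` C)"
proof -
  have Us: "subgroup U G" by (rule compact_openD(1)[OF U])
  obtain F where F: "finite F" "F \<subseteq> C" "C \<subseteq> F <#> U"
    by (rule compact_finite_cover[OF C compact_openD(1,3)[OF U]])
  have "(\<lambda>x. x <# U) ` C \<subseteq> (\<lambda>x. x <# U) ` F"
  proof
    fix D assume "D \<in> (\<lambda>x. x <# U) ` C"
    then obtain x where x: "x \<in> C" "D = x <# U" by blast
    then have "x \<in> F <#> U" using F(3) by blast
    then obtain f where f: "f \<in> F" "x \<in> f <# U" by (auto simp: set_mult_iff l_coset_iff)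
    have "f \<in> carrier G" using f(1) F(2) compactin_subset_carrier[OF C] by blast
    then show "D \<in> (\<lambda>x. x <# U) ` F" using l_coset_eqI[OF Us _ f(2)] x f by blast
  qed
  then show ?thesis using F(1) finite_surj by blast
qed

text \<open>Schlichting's theorem; the minimality argument is the one of Bergman and Lenstra.\<close>

lemma Schlichting:
  fixes A U C :: "'a set"
  assumes A: "subgroup A G" and U: "compact_open U" and C: "compactin T C"
    and AC: "\<And>a. a \<in> A \<Longrightarrow> conjby a ` U \<subseteq> C"
  obtains D where "compact_open D" "A \<subseteq> Normalizer D" "(\<Inter>a\<in>A. conjby a ` U) \<subseteq> D"
proof -
  have Ac: "A \<subseteq> carrier G" by (rule subgroup.subset[OF A])
  have Us: "subgroup U G" by (rule compact_openD(1)[OF U])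
  have Uc: "U \<subseteq> carrier G" by (rule subgroup.subset[OF Us])
  have Cc: "C \<subseteq> carrier G" by (rule compactin_subset_carrier[OF C])
  note Am = subgroup.m_closed[OF A] and Ai = subgroup.m_inv_closed[OF A] and A1 = subgroup.one_closed[OF A]
  define N where "N S = (\<Inter>s\<in>S. conjby s ` U)" for S
  \<comment> \<open>The orbit of the coset \<open>a <# U\<close> under \<open>N S\<close>. For
    nonempty \<open>S\<close> inside \<open>A\<close> its size is the index in \<open>N S\<close> of
    the intersection of \<open>N S\<close> with the conjugate of \<open>U\<close> by
    \<open>a\<close>.\<close>
  define Q where "Q S a = (\<lambda>x. x \<otimes> a <# U) ` N S" for S a
  define c0 where "c0 = card ((\<lambda>x. x <# U) ` C)"
  have NC: "N S \<subseteq> C" "N S \<subseteq> carrier G" if "S \<noteq> {}" "S \<subseteq> A" for S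
  proof -
    show "N S \<subseteq> C" using that AC unfolding N_def by blast
    then show "N S \<subseteq> carrier G" using Cc by blast
  qed
  \<comment> \<open>Translating the orbit by the inverse of \<open>a\<close> replaces elements of
    \<open>N S\<close> by elements of another conjugate of \<open>U\<close>, again inside
    \<open>C\<close>. So the size is bounded by the number of cosets of \<open>U\<close> meeting
    \<open>C\<close>, for all \<open>S\<close> and \<open>a\<close>.\<close>
  have Qb: "finite (Q S a)" "card (Q S a) \<le> c0" if S: "S \<noteq> {}" "S \<subseteq> A" and a: "a \<in> A" for S a
  proof -
    obtain s where s: "s \<in> S" using S by blast
    have sA: "s \<in> A" using s S by blast
    have c: "s \<in> carrier G" "a \<in> carrier G" using sA a Ac by auto
    have "Q S a \<subseteq> (\<lambda>D. a <# D) ` (\<lambda>x. x <# U) ` C"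
    proof
      fix D assume "D \<in> Q S a"
      then obtain x where x: "x \<in> N S" "D = x \<otimes> a <# U" by (auto simp: Q_def)
      then obtain u where u: "u \<in> U" "x = conjby s u" using s by (auto simp: N_def)
      have uc: "u \<in> carrier G" using u Uc by blast
      have "conjby (inv a \<otimes> s) u \<in> C" using AC[OF Am[OF Ai[OF a] sA]] u(1) by blast
      moreover have "x \<otimes> a = a \<otimes> conjby (inv a \<otimes> s) u" unfolding u(2) using c uc by (simp add: conjby_def group_nf)
      then have "D = a <# (conjby (inv a \<otimes> s) u <# U)" unfolding x(2) using c uc Uc by (simp add: l_coset_l_coset)
      ultimately show "D \<in> (\<lambda>D. a <# D) ` (\<lambda>x. x <# U) ` C" by blast
    qed
    moreover have f: "finite ((\<lambda>x. x <# U) ` C)" by (rule finite_l_cosets[OF C U])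
    ultimately show "finite (Q S a)" by (meson finite_imageI finite_subset)
    have "card (Q S a) \<le> card ((\<lambda>D. a <# D) ` (\<lambda>x. x <# U) ` C)"
      using \<open>Q S a \<subseteq> _\<close> f by (intro card_mono) auto
    also have "\<dots> \<le> c0" unfolding c0_def by (rule card_image_le[OF f])
    finally show "card (Q S a) \<le> c0" .
  qed
  define P where "P m \<longleftrightarrow> (\<exists>S. finite S \<and> S \<noteq> {} \<and> S \<subseteq> A \<and> (\<forall>a\<in>A. card (Q S a) \<le> m))" for m
  have "P c0" unfolding P_def by (rule exI[of _ "{\<one>}"]) (use Qb A1 in auto)
  \<comment> \<open>The smallest uniform bound for these indices that some finite intersection
    achieves; an intersection of more conjugates cannot do better.\<close>
  define M where "M = (LEAST m. P m)"
  have "P M" unfolding M_def by (rule LeastI[of P, OF \<open>P c0\<close>])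
  then obtain S where S: "finite S" "S \<noteq> {}" "S \<subseteq> A" and SM: "\<And>a. a \<in> A \<Longrightarrow> card (Q S a) \<le> M"
    by (auto simp: P_def)
  have Sc: "S \<subseteq> carrier G" using S Ac by blast
  define NN where "NN \<beta> = N ((\<lambda>s. \<beta> \<otimes> s) ` S)" for \<beta>
  have SA: "(\<lambda>s. \<beta> \<otimes> s) ` S \<subseteq> A" "(\<lambda>s. \<beta> \<otimes> s) ` S \<noteq> {}" if "\<beta> \<in> A" for \<beta> using that S Am by auto
  have NN_sub: "compact_open (NN \<beta>)" if "\<beta> \<in> A" for \<beta>
    unfolding NN_def N_def using S SA[OF that] Ac by (intro compact_open_INT) (auto intro!: compact_open_conjby U)
  have NN_conjby: "NN (\<alpha> \<otimes> \<beta>) = conjby \<alpha> ` NN \<beta>" if "\<alpha> \<in> A" "\<beta> \<in> A" for \<alpha> \<beta>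
  proof -
    have c: "\<alpha> \<in> carrier G" "\<beta> \<in> carrier G" using that Ac by auto
    have sub: "conjby g ` U \<subseteq> carrier G" if "g \<in> carrier G" for g using that Uc by auto
    have "x \<in> NN (\<alpha> \<otimes> \<beta>) \<longleftrightarrow> x \<in> conjby \<alpha> ` NN \<beta>" if x: "x \<in> carrier G" for x
    proof -
      have "x \<in> NN (\<alpha> \<otimes> \<beta>) \<longleftrightarrow> (\<forall>s\<in>S. conjby (inv (\<alpha> \<otimes> \<beta> \<otimes> s)) x \<in> U)"
        unfolding NN_def N_def using x c Sc Uc by (auto simp: mem_conjby_image_iff subset_iff)
      also have "\<dots> \<longleftrightarrow> (\<forall>s\<in>S. conjby (inv (\<beta> \<otimes> s)) (conjby (inv \<alpha>) x) \<in> U)"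
        using x c Sc by (intro ball_cong refl) (auto simp: conjby_conjby group_nf subset_iff)
      also have "\<dots> \<longleftrightarrow> conjby (inv \<alpha>) x \<in> NN \<beta>"
        unfolding NN_def N_def using x c Sc Uc by (auto simp: mem_conjby_image_iff subset_iff)
      also have "\<dots> \<longleftrightarrow> x \<in> conjby \<alpha> ` NN \<beta>"
        using x c compact_open_subset[OF NN_sub[OF \<open>\<beta> \<in> A\<close>]] by (subst mem_conjby_image_iff) auto
      finally show ?thesis .
    qed
    moreover have "NN (\<alpha> \<otimes> \<beta>) \<subseteq> carrier G" "conjby \<alpha> ` NN \<beta> \<subseteq> carrier G"
      using compact_open_subset[OF NN_sub[OF Am[OF that]]] compact_open_subset[OF NN_sub[OF that(2)]] c
      by (auto simp: subset_iff)
    ultimately show ?thesis by blast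
  qed
  \<comment> \<open>Conjugating \<open>S\<close> by \<open>\<beta>\<close> only moves the index
    \<open>a\<close>, so every translate of \<open>S\<close> satisfies the same bound
    \<open>M\<close>.\<close>
  have card_NN: "card (Q ((\<lambda>s. \<beta> \<otimes> s) ` S) a) \<le> M" if "\<beta> \<in> A" "a \<in> A" for \<beta> a
  proof -
    have ba: "inv \<beta> \<otimes> a \<in> A" using that Am Ai by blast
    have c: "\<beta> \<in> carrier G" "a \<in> carrier G" using that Ac by auto
    have N1: "NN \<one> = N S" unfolding NN_def using Sc by (intro arg_cong[of _ _ N]) (auto simp: subset_iff image_iff)
    have NNb: "NN \<beta> = conjby \<beta> ` N S" using NN_conjby[OF that(1) A1] c N1 by simp
    have "Q ((\<lambda>s. \<beta> \<otimes> s) ` S) a \<subseteq> (\<lambda>D. \<beta> <# D) ` Q S (inv \<beta> \<otimes> a)"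
    proof
      fix D assume "D \<in> Q ((\<lambda>s. \<beta> \<otimes> s) ` S) a"
      then obtain x where x: "x \<in> NN \<beta>" "D = x \<otimes> a <# U" by (auto simp: Q_def NN_def)
      then obtain n where n: "n \<in> N S" "x = conjby \<beta> n" using NNb by auto
      have nc: "n \<in> carrier G" using n NC(2)[OF S(2,3)] by blast
      have "x \<otimes> a = \<beta> \<otimes> (n \<otimes> (inv \<beta> \<otimes> a))" unfolding n(2) using c nc by (simp add: conjby_def group_nf)
      then have "D = \<beta> <# (n \<otimes> (inv \<beta> \<otimes> a) <# U)" unfolding x(2) using c nc Uc by (simp add: l_coset_l_coset)
      then show "D \<in> (\<lambda>D. \<beta> <# D) ` Q S (inv \<beta> \<otimes> a)" using n(1) by (auto simp: Q_def)
    qed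
    then have "card (Q ((\<lambda>s. \<beta> \<otimes> s) ` S) a) \<le> card ((\<lambda>D. \<beta> <# D) ` Q S (inv \<beta> \<otimes> a))"
      using Qb(1)[OF S(2,3) ba] by (intro card_mono) auto
    also have "\<dots> \<le> card (Q S (inv \<beta> \<otimes> a))" by (rule card_image_le[OF Qb(1)[OF S(2,3) ba]])
    also have "\<dots> \<le> M" by (rule SM[OF ba])
    finally show ?thesis .
  qed
  have gen_fin: "generate G (\<Union>\<beta>\<in>\<Phi>. NN \<beta>) \<subseteq> C <#> C" if \<Phi>: "finite \<Phi>" "\<Phi> \<noteq> {}" "\<Phi> \<subseteq> A" for \<Phi>
  proof -
    define R where "R = (\<Union>\<beta>\<in>\<Phi>. (\<lambda>s. \<beta> \<otimes> s) ` S)"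
    have R: "finite R" "R \<noteq> {}" "R \<subseteq> A" using \<Phi> S Am by (auto simp: R_def)
    \<comment> \<open>By minimality of \<open>M\<close> the finer intersection \<open>N R\<close>
      still has an orbit of size at least \<open>M\<close>. For this \<open>a\<close> the orbits of
      all the groups \<open>NN \<beta>\<close> contain it and are no larger, so they coincide. One
      finite set \<open>Y\<close> of cosets is therefore preserved by all these groups and by what
      they generate.\<close>
    have ex: "\<exists>a\<in>A. card (Q R a) \<ge> M"
    proof (rule ccontr)
      assume "\<not> ?thesis"
      then have lt: "\<And>a. a \<in> A \<Longrightarrow> card (Q R a) < M" by (meson not_le)
      have "M > 0" using lt[OF A1] by simp
      have "P (M - 1)" unfolding P_def
      proof (intro exI[of _ R] conjI R ballI)
        fix a assume "a \<in> A" then show "card (Q R a) \<le> M - 1" using lt by fastforce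
      qed
      then have "M \<le> M - 1" unfolding M_def by (rule Least_le)
      then show False using \<open>M > 0\<close> by simp
    qed
    then obtain a where a: "a \<in> A" "card (Q R a) \<ge> M" by blast
    have ac: "a \<in> carrier G" using a Ac by blast
    define Y where "Y = Q R a"
    have Yeq: "Q ((\<lambda>s. \<beta> \<otimes> s) ` S) a = Y" if "\<beta> \<in> \<Phi>" for \<beta>
    proof -
      have bA: "\<beta> \<in> A" using that \<Phi> by blast
      have "N R \<subseteq> N ((\<lambda>s. \<beta> \<otimes> s) ` S)" using that unfolding N_def R_def by blast
      then have "Y \<subseteq> Q ((\<lambda>s. \<beta> \<otimes> s) ` S) a" unfolding Y_def Q_def by blast
      moreover have fin: "finite (Q ((\<lambda>s. \<beta> \<otimes> s) ` S) a)" by (rule Qb(1)[OF SA(2,1)[OF bA] a(1)])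
      moreover have "card (Q ((\<lambda>s. \<beta> \<otimes> s) ` S) a) \<le> card Y" using card_NN[OF bA a(1)] a(2) by (simp add: Y_def)
      ultimately show ?thesis using card_subset_eq[OF fin] card_mono[OF fin] by (metis le_antisym)
    qed
    define Z where "Z = {g \<in> carrier G. \<forall>D\<in>Y. g <# D \<in> Y}"
    have NZ: "NN \<beta> \<subseteq> Z" if b: "\<beta> \<in> \<Phi>" for \<beta>
    proof
      fix x assume x: "x \<in> NN \<beta>"
      have bA: "\<beta> \<in> A" using b \<Phi> by blast
      have NNc: "NN \<beta> \<subseteq> carrier G" by (rule compact_open_subset[OF NN_sub[OF bA]])
      have "x <# D \<in> Y" if "D \<in> Y" for D
      proof -
        have "D \<in> Q ((\<lambda>s. \<beta> \<otimes> s) ` S) a" using that Yeq[OF b] by simp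
        then obtain y where y: "y \<in> NN \<beta>" "D = y \<otimes> a <# U" by (auto simp: Q_def NN_def)
        have "x \<otimes> y \<in> NN \<beta>" by (rule subgroup.m_closed[OF compact_openD(1)[OF NN_sub[OF bA]] x y(1)])
        moreover have "x <# D = (x \<otimes> y) \<otimes> a <# U"
          unfolding y(2) using x y(1) NNc ac Uc by (simp add: l_coset_l_coset m_assoc subset_iff)
        ultimately have "x <# D \<in> Q ((\<lambda>s. \<beta> \<otimes> s) ` S) a" by (auto simp: Q_def NN_def)
        then show ?thesis using Yeq[OF b] by simp
      qed
      then show "x \<in> Z" using x NNc by (auto simp: Z_def)
    qed
    have Dc: "D \<subseteq> carrier G" if "D \<in> Y" for D
      using that NC(2)[OF R(2,3)] ac Uc by (force simp: Y_def Q_def l_coset_iff subset_iff)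
    have genZ: "x \<in> Z" if "x \<in> generate G (\<Union>\<beta>\<in>\<Phi>. NN \<beta>)" for x
      using that
    proof induction
      case one
      show ?case using Dc by (force simp: Z_def l_coset_def subset_iff)
    next
      case (incl h)
      then show ?case using NZ by blast
    next
      case (inv h)
      then obtain \<beta> where b: "\<beta> \<in> \<Phi>" "h \<in> NN \<beta>" by blast
      then have "inv h \<in> NN \<beta>" using \<Phi> subgroup.m_inv_closed[OF compact_openD(1)[OF NN_sub]] by blast
      then show ?case using NZ[OF b(1)] by blast
    next
      case (eng h1 h2)
      have "h1 \<otimes> h2 <# D \<in> Y" if D: "D \<in> Y" for D
      proof -
        have "h1 <# (h2 <# D) \<in> Y" using eng(3,4) D by (auto simp: Z_def)
        moreover have "h1 <# (h2 <# D) = h1 \<otimes> h2 <# D" using eng(3,4) Dc[OF D] by (intro l_coset_l_coset) (auto simp: Z_def)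
        ultimately show ?thesis by simp
      qed
      then show ?case using eng(3,4) by (auto simp: Z_def)
    qed
    show ?thesis
    proof
      fix x assume "x \<in> generate G (\<Union>\<beta>\<in>\<Phi>. NN \<beta>)"
      then have xZ: "x \<in> Z" by (rule genZ)
      have xc: "x \<in> carrier G" using xZ by (simp add: Z_def)
      \<comment> \<open>The coset \<open>a <# U\<close> belongs to \<open>Y\<close>, so an element
        preserving \<open>Y\<close> lies in the product of \<open>N R\<close> with the conjugate of
        \<open>U\<close> by \<open>a\<close>. Both factors are in \<open>C\<close>, which gives a
        bound independent of \<open>\<Phi>\<close>.\<close>
      have "\<one> \<in> N R"
        unfolding N_def
      proof
        fix s assume "s \<in> R"
        then have "s \<in> carrier G" using R Ac by blast
        then show "\<one> \<in> conjby s ` U" using subgroup.one_closed[OF Us] by (intro image_eqI[of _ _ \<one>]) auto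
      qed
      then have "\<one> \<otimes> a <# U \<in> Y" unfolding Y_def Q_def by blast
      then have "a <# U \<in> Y" using ac by simp
      then have "x <# (a <# U) \<in> Y" using xZ by (auto simp: Z_def)
      then have "x \<otimes> a <# U \<in> Y" using xc ac Uc by (simp add: l_coset_l_coset)
      then obtain y where y: "y \<in> N R" "x \<otimes> a <# U = y \<otimes> a <# U" by (auto simp: Y_def Q_def)
      have yc: "y \<in> C" "y \<in> carrier G" using y NC[OF R(2,3)] by auto
      have "x \<otimes> a \<in> x \<otimes> a <# U"
        unfolding l_coset_iff using xc ac subgroup.one_closed[OF Us] by (intro bexI[of _ \<one>]) auto
      then have "x \<otimes> a \<in> y \<otimes> a <# U" using y(2) by simp
      then obtain u where u: "u \<in> U" "x \<otimes> a = y \<otimes> a \<otimes> u" unfolding l_coset_iff by blast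
      have uc: "u \<in> carrier G" using u Uc by blast
      have "x = (x \<otimes> a) \<otimes> inv a" using xc ac by (simp add: m_assoc)
      also have "\<dots> = y \<otimes> conjby a u" unfolding u(2) using xc ac uc yc by (simp add: m_assoc conjby_def)
      finally have "x = y \<otimes> conjby a u" .
      moreover have "conjby a u \<in> C" using AC[OF a(1)] u(1) by blast
      ultimately show "x \<in> C <#> C" using yc(1) by (simp add: set_multI)
    qed
  qed
  \<comment> \<open>Each element is a word involving finitely many of the groups
    \<open>NN \<beta>\<close>, so the bound for finite \<open>\<Phi>\<close> holds for all of
    \<open>D\<close>. Taking all of \<open>A\<close> makes \<open>D\<close> invariant.\<close>
  define D where "D = generate G (\<Union>\<beta>\<in>A. NN \<beta>)"
  have NNc: "(\<Union>\<beta>\<in>A. NN \<beta>) \<subseteq> carrier G" using compact_open_subset[OF NN_sub] by blast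
  have Ds: "subgroup D G" unfolding D_def by (rule generate_is_subgroup[OF NNc])
  have A_ne: "A \<noteq> {}" using A1 by blast
  have DC: "D \<subseteq> C <#> C"
  proof
    fix x assume "x \<in> D"
    then obtain J where "finite J" "J \<noteq> {}" "J \<subseteq> A" "x \<in> generate G (\<Union>\<beta>\<in>J. NN \<beta>)"
      using generate_finite[OF _ A_ne] unfolding D_def by blast
    then show "x \<in> C <#> C" using gen_fin by blast
  qed
  have ND: "NN \<one> \<subseteq> D" unfolding D_def using A1 by (auto intro: generate.incl)
  have "openin T D"
    by (rule openin_subgroup_of_open[OF Ds compact_openD(3)[OF NN_sub[OF A1]] _ ND])
      (use compact_open_one[OF NN_sub[OF A1]] in blast)
  then have "compactin T D"
    using closed_compactin[OF compactin_set_mult[OF C C] DC] closedin_open_subgroup[OF Ds] by blast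
  then have D: "compact_open D" using Ds \<open>openin T D\<close> by (simp add: compact_open_def)
  have sub: "conjby a ` D \<subseteq> D" if a: "a \<in> A" for a
  proof -
    have "conjby a x \<in> (\<Union>\<beta>\<in>A. NN \<beta>)" if x: "x \<in> (\<Union>\<beta>\<in>A. NN \<beta>)" for x
    proof -
      obtain \<beta> where b: "\<beta> \<in> A" "x \<in> NN \<beta>" using x by blast
      then have "conjby a x \<in> NN (a \<otimes> \<beta>)" using NN_conjby[OF a b(1)] by simp
      then show ?thesis using Am[OF a b(1)] by blast
    qed
    then have "conjby a x \<in> D" if "x \<in> D" for x
      using that a Ac unfolding D_def by (intro generate_conjby[OF NNc]) auto
    then show ?thesis by blast
  qed
  have "A \<subseteq> Normalizer D"
  proof
    fix a assume a: "a \<in> A"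
    have ac: "a \<in> carrier G" using a Ac by blast
    have "D \<subseteq> conjby a ` D"
    proof
      fix x assume x: "x \<in> D"
      have "conjby (inv a) x \<in> D" using sub[OF Ai[OF a]] x by blast
      then show "x \<in> conjby a ` D" using x ac subgroup.subset[OF Ds] by (subst mem_conjby_image_iff) auto
    qed
    then show "a \<in> Normalizer D" using sub[OF a] ac by (auto simp: Normalizer_def)
  qed
  moreover have "(\<Inter>a\<in>A. conjby a ` U) \<subseteq> D"
  proof -
    have "(\<Inter>a\<in>A. conjby a ` U) \<subseteq> NN \<one>" using S Sc unfolding NN_def N_def by (auto simp: subset_iff)
    then show ?thesis using ND by blast
  qed
  ultimately show thesis using that D by blast
qed

end

section \<open>A compact open subgroup normalized by several elements\<close>
context group
begin

text \<open>The condition says that \<open>g\<close> fixes the coset \<open>x <# V\<close> under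
  conjugation, so this is a stabilizer. It is the means of passing from generators to the group they
  generate.\<close>

lemma subgroup_commute_mod:
  assumes V: "subgroup V G" and x: "x \<in> carrier G"
  shows "subgroup {g \<in> Normalizer V. conjby g x \<in> x <# V} G"
proof -
  have Vc: "V \<subseteq> carrier G" by (rule subgroup.subset[OF V])
  note NV = subgroup_Normalizer[OF Vc]
  show ?thesis
  proof
    show "{g \<in> Normalizer V. conjby g x \<in> x <# V} \<subseteq> carrier G" using NormalizerD(2) by blast
    have "conjby \<one> x = x \<otimes> \<one>" using x by simp
    then show "\<one> \<in> {g \<in> Normalizer V. conjby g x \<in> x <# V}"
      using subgroup.one_closed[OF NV] subgroup.one_closed[OF V] unfolding l_coset_iff by blast
    show "g \<otimes> h \<in> {g \<in> Normalizer V. conjby g x \<in> x <# V}"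
      if gh: "g \<in> {g \<in> Normalizer V. conjby g x \<in> x <# V}" "h \<in> {g \<in> Normalizer V. conjby g x \<in> x <# V}" for g h
    proof -
      obtain v w where vw: "v \<in> V" "conjby g x = x \<otimes> v" "w \<in> V" "conjby h x = x \<otimes> w"
        using gh by (auto simp: l_coset_iff)
      have c: "g \<in> carrier G" "h \<in> carrier G" "v \<in> carrier G" "w \<in> carrier G" using gh NormalizerD(2) vw Vc by auto
      have gw: "conjby g w \<in> V" using Normalizer_conjby[of g V w] gh vw by auto
      have "conjby (g \<otimes> h) x = conjby g (x \<otimes> w)" using c x vw(4) by (simp add: conjby_conjby[symmetric])
      also have "\<dots> = x \<otimes> (v \<otimes> conjby g w)" using c x vw(2) gw Vc by (simp add: conjby_mult m_assoc subset_iff)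
      finally show ?thesis using subgroup.m_closed[OF V vw(1) gw] subgroup.m_closed[OF NV] gh
        unfolding l_coset_iff by blast
    qed
    show "inv g \<in> {g \<in> Normalizer V. conjby g x \<in> x <# V}" if g: "g \<in> {g \<in> Normalizer V. conjby g x \<in> x <# V}" for g
    proof -
      obtain v where v: "v \<in> V" "conjby g x = x \<otimes> v" using g by (auto simp: l_coset_iff)
      have c: "g \<in> carrier G" "v \<in> carrier G" using g NormalizerD(2) v Vc by auto
      have ig: "inv g \<in> Normalizer V" using subgroup.m_inv_closed[OF NV] g by blast
      have gv: "conjby (inv g) v \<in> V" by (rule Normalizer_conjby[OF ig v(1)])
      have gvc: "conjby (inv g) v \<in> carrier G" using gv Vc by blast
      have "x = conjby (inv g) (x \<otimes> v)" using c x by (simp add: v(2)[symmetric])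
      then have eq: "x = conjby (inv g) x \<otimes> conjby (inv g) v" using c x by (simp add: conjby_mult)
      have "x \<otimes> inv (conjby (inv g) v) = (conjby (inv g) x \<otimes> conjby (inv g) v) \<otimes> inv (conjby (inv g) v)"
        by (rule arg_cong[OF eq])
      then have "conjby (inv g) x = x \<otimes> inv (conjby (inv g) v)" using c x gvc by (simp add: m_assoc)
      then show ?thesis using ig subgroup.m_inv_closed[OF V gv] unfolding l_coset_iff by blast
    qed
  qed
qed

lemma conjpow_commute_mod:
  assumes V: "subgroup V G" and x: "x \<in> carrier G" and g: "g \<in> Normalizer V" "conjby g x \<in> x <# V"
  shows "conjpow g m x \<in> x <# V"
proof -
  have "g [^] m \<in> {g \<in> Normalizer V. conjby g x \<in> x <# V}"
    by (rule subgroup_int_pow_closed[OF subgroup_commute_mod[OF V x]]) (use g in simp)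
  then show ?thesis by (simp add: conjpow_def)
qed

lemma conjpow_Normalizer:
  assumes V: "V \<subseteq> carrier G" and g: "g \<in> Normalizer V" shows "conjpow g m ` V = V"
proof -
  have "g [^] m \<in> Normalizer V" by (rule subgroup_int_pow_closed[OF subgroup_Normalizer[OF V] g])
  then show ?thesis by (simp add: conjpow_def NormalizerD)
qed

end

context hausdorff_group
begin

lemma subgroup_bounded_orbits:
  assumes a: "a \<in> carrier G"
  shows "subgroup {x \<in> carrier G. bdd_in T (range (\<lambda>n. conjpow a n x))} G"
proof
  let ?P = "{x \<in> carrier G. bdd_in T (range (\<lambda>n. conjpow a n x))}"
  show "?P \<subseteq> carrier G" by auto
  show "\<one> \<in> ?P" using a by (simp add: bdd_in_singleton)
  show "x \<otimes> y \<in> ?P" if xy: "x \<in> ?P" "y \<in> ?P" for x y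
  proof -
    have "range (\<lambda>n. conjpow a n (x \<otimes> y)) \<subseteq> range (\<lambda>n. conjpow a n x) <#> range (\<lambda>n. conjpow a n y)"
      using xy a by (auto simp: conjpow_mult intro!: set_multI)
    then show ?thesis using xy bdd_in_subset[OF bdd_in_set_mult] by blast
  qed
  show "inv x \<in> ?P" if x: "x \<in> ?P" for x
  proof -
    have "range (\<lambda>n. conjpow a n (inv x)) \<subseteq> (\<lambda>x. inv x) ` range (\<lambda>n. conjpow a n x)"
      using x a by (auto simp: conjpow_inv)
    then show ?thesis using x bdd_in_subset[OF bdd_in_inv_image] by blast
  qed
qed

text \<open>Put \<open>b = a k\<close> and let \<open>Z\<close> be the part of \<open>W\<close> with bounded \<open>b\<close>-orbits. All conjugates of \<open>Z\<close> under the group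
  generated by \<open>V\<close> and \<open>a 0, ..., a k\<close> are conjugates by powers of \<open>b\<close>, hence uniformly bounded, and
  Schlichting's theorem applies.\<close>

lemma common_compact_open_step:
  fixes V W W' :: "'a set" and a :: "nat \<Rightarrow> 'a"
  assumes V: "compactin T V" "subgroup V G" and VW: "V \<subseteq> W" and W: "compact_open W"
    and a: "\<And>i. i \<le> k \<Longrightarrow> a i \<in> Normalizer V"
    and comm: "\<And>j. j \<le> k \<Longrightarrow> conjby (a k) (a j) \<in> a j <# V"
    and W': "compact_open W'" "\<And>m. conjpow (a k) m ` W' = W'" and aW: "\<And>j. j < k \<Longrightarrow> a j \<in> Normalizer W"
  shows "\<exists>D. compact_open D \<and> V \<subseteq> D \<and> (\<forall>j<Suc k. a j \<in> Normalizer D)"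
proof -
  define b where "b = a k"
  have Vc: "V \<subseteq> carrier G" by (rule subgroup.subset[OF V(2)])
  have bN: "b \<in> Normalizer V" using a by (simp add: b_def)
  have bc: "b \<in> carrier G" by (rule NormalizerD(2)[OF bN])
  have ac: "a j \<in> carrier G" if "j \<le> k" for j by (rule NormalizerD(2)[OF a[OF that]])
  have orb: "conjpow b m (a j) \<in> a j <# V" if "j \<le> k" for j m
    using conjpow_commute_mod[OF V(2) ac[OF that] bN] comm[OF that] by (simp add: b_def)
  define P where "P = {x \<in> carrier G. bdd_in T (range (\<lambda>n. conjpow b n x))}"
  have P: "subgroup P G" unfolding P_def by (rule subgroup_bounded_orbits[OF bc])
  have inP: "x \<in> P" if "x \<in> carrier G" "\<And>m. conjpow b m x \<in> S" "bdd_in T S" for x S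
  proof -
    have "range (\<lambda>n. conjpow b n x) \<subseteq> S" using that(2) by blast
    then show ?thesis using that(1) bdd_in_subset[OF that(3)] by (simp add: P_def)
  qed
  have W'c: "W' \<subseteq> carrier G" by (rule compact_open_subset[OF W'(1)])
  have bV: "bdd_in T V" by (rule compactin_imp_bdd_in[OF V(1)])
  have bW': "bdd_in T W'" by (rule compactin_imp_bdd_in[OF compact_openD(2)[OF W'(1)]])
  have alW': "conjpow b m x \<in> W'" if "x \<in> W'" for x m using W'(2)[of m] that unfolding b_def by blast
  have alV: "conjpow b m x \<in> V" if "x \<in> V" for x m using conjpow_Normalizer[OF Vc bN, of m] that by blast
  have W'P: "W' \<subseteq> P" using inP[OF _ alW' bW'] W'c by blast
  have VP: "V \<subseteq> P" using inP[OF _ alV bV] Vc by blast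
  \<comment> \<open>Commuting modulo \<open>V\<close> keeps the \<open>b\<close>-orbit of
    \<open>a j\<close> in the compact coset \<open>a j <# V\<close>. As an element of
    \<open>P\<close>, each \<open>a j\<close> normalizes \<open>P\<close>; for \<open>j < k\<close>
    it normalizes \<open>W\<close> as well, hence \<open>Z\<close>.\<close>
  have aP: "a j \<in> P" if "j \<le> k" for j
  proof (rule inP[OF ac[OF that] orb[OF that]])
    show "bdd_in T (a j <# V)"
      unfolding l_coset_eq_set_mult by (intro bdd_in_set_mult bdd_in_singleton ac that bV)
  qed
  have oP: "openin T P"
    by (rule openin_subgroup_of_open[OF P compact_openD(3)[OF W'(1)] _ W'P])
      (use compact_open_one[OF W'(1)] in blast)
  define Z where "Z = W \<inter> P"
  have Z: "compact_open Z"
    unfolding compact_open_def Z_def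
    using compact_Int_closedin[OF compact_openD(2)[OF W] closedin_open_subgroup[OF P oP]]
      subgroups_Inter_pair[OF compact_openD(1)[OF W] P] openin_Int[OF compact_openD(3)[OF W] oP] by blast
  have Zs: "subgroup Z G" by (rule compact_openD(1)[OF Z])
  have Zc: "Z \<subseteq> carrier G" by (rule compact_open_subset[OF Z])
  have VZ: "V \<subseteq> Z" using VW VP by (auto simp: Z_def)
  have aZ: "a j \<in> Normalizer Z" if "j < k" for j
  proof -
    have "a j \<in> Normalizer P" using subgroup_subset_Normalizer[OF P] aP that by auto
    then have "conjby (a j) ` Z = Z" unfolding Z_def
      using aW[OF that] compact_open_subset[OF W] subgroup.subset[OF P]
      by (subst conjby_image_inj) (auto simp: NormalizerD)
    then show ?thesis using ac that by (simp add: Normalizer_def)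
  qed
  \<comment> \<open>Finitely many cosets of the \<open>b\<close>-invariant group \<open>W'\<close>
    cover \<open>Z\<close>, so bounded orbits of the representatives give one compact set for all
    orbits in \<open>Z\<close>.\<close>
  obtain F where F: "finite F" "F \<subseteq> Z" "Z \<subseteq> F <#> W'"
    by (rule compact_finite_cover[OF compact_openD(2)[OF Z] compact_openD(1,3)[OF W'(1)]])
  have "bdd_in T (\<Union>f\<in>F. range (\<lambda>m. conjpow b m f) <#> W')"
  proof (rule bdd_in_UN[OF F(1)])
    fix f assume "f \<in> F"
    then have "f \<in> P" using F(2) by (auto simp: Z_def)
    then show "bdd_in T (range (\<lambda>m. conjpow b m f) <#> W')" by (intro bdd_in_set_mult bW') (simp add: P_def)
  qed
  then obtain C where C: "compactin T C" "(\<Union>f\<in>F. range (\<lambda>m. conjpow b m f) <#> W') \<subseteq> C" by (auto simp: bdd_in_def)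
  have ZC: "conjpow b m ` Z \<subseteq> C" for m
  proof
    fix y assume "y \<in> conjpow b m ` Z"
    then obtain x where x: "x \<in> Z" "y = conjpow b m x" by blast
    then have "x \<in> F <#> W'" using F(3) by blast
    then obtain f w where fw: "f \<in> F" "w \<in> W'" "x = f \<otimes> w" by (auto simp: set_mult_iff)
    have "f \<in> carrier G" "w \<in> carrier G" using fw F(2) Zc W'c by auto
    then have "y = conjpow b m f \<otimes> conjpow b m w" unfolding x(2) fw(3) using bc by (simp add: conjpow_mult)
    then have "y \<in> range (\<lambda>m. conjpow b m f) <#> W'" using alW'[OF fw(2)] by (auto intro!: set_multI)
    then show "y \<in> C" using C(2) fw(1) by blast
  qed
  define X where "X = a ` {..k} \<union> V"
  have Xc: "X \<subseteq> carrier G" using ac Vc by (auto simp: X_def)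
  define A where "A = generate G X"
  have A: "subgroup A G" unfolding A_def by (rule generate_is_subgroup[OF Xc])
  \<comment> \<open>The elements that send each conjugate of \<open>Z\<close> by a power of
    \<open>b\<close> to another one. The element \<open>b\<close> shifts these conjugates; the other
    generators fix each of them, because all their conjugates by powers of \<open>b\<close>
    normalize \<open>Z\<close>.\<close>
  define S where "S = {g \<in> carrier G. \<forall>m. \<exists>m'. conjby g ` conjpow b m ` Z = conjpow b m' ` Z}"
  have conjpow_comp: "conjpow b m ` conjpow b m' ` Z = conjpow b (m + m') ` Z" for m m'
    using Zc bc by (auto simp: image_comp o_def subset_iff intro!: image_cong)
  have S1: "b \<in> S" "inv b \<in> S"
  proof -
    have "conjby b ` conjpow b m ` Z = conjpow b (1 + m) ` Z" for m
      using conjpow_comp[of 1 m] bc by (simp add: conjpow_def)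
    then show "b \<in> S" using bc unfolding S_def by blast
    have "conjby (inv b) ` conjpow b m ` Z = conjpow b (-1 + m) ` Z" for m
      using conjpow_comp[of "-1" m] bc by (simp add: conjpow_def int_pow_neg)
    then show "inv b \<in> S" using bc unfolding S_def by blast
  qed
  have S2: "g \<in> S" if g: "g \<in> carrier G" "\<And>m. conjpow b m g \<in> Normalizer Z" for g
  proof -
    have "conjby g ` conjpow b m ` Z = conjpow b m ` Z" for m
    proof -
      have "conjby g ` conjpow b m ` Z = conjpow b m ` conjby (conjpow b (- m) g) ` Z"
        using Zc bc g by (auto simp: image_comp o_def subset_iff conjpow_conjby intro!: image_cong)
      also have "conjby (conjpow b (- m) g) ` Z = Z" by (rule NormalizerD(1)[OF g(2)])
      finally show ?thesis .
    qed
    then show ?thesis using g unfolding S_def by blast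
  qed
  note NZ = subgroup_Normalizer[OF Zc]
  have ZN: "Z \<subseteq> Normalizer Z" by (rule subgroup_subset_Normalizer[OF Zs])
  have hN: "conjpow b m h \<in> Normalizer Z" if h: "h \<in> X" "h \<noteq> b" for h m
  proof (cases "h \<in> V")
    case True
    then show ?thesis using alV VZ ZN by blast
  next
    case False
    then obtain j where j: "j \<le> k" "h = a j" using h by (auto simp: X_def)
    then have "j < k" using h by (cases "j = k") (auto simp: b_def)
    obtain v where v: "v \<in> V" "conjpow b m h = a j \<otimes> v" using orb[OF j(1), of m] j by (auto simp: l_coset_iff)
    then show ?thesis using subgroup.m_closed[OF NZ aZ[OF \<open>j < k\<close>]] VZ ZN by auto
  qed
  have SX: "h \<in> S" "inv h \<in> S" if h: "h \<in> X" for h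
  proof -
    have hc: "h \<in> carrier G" using h Xc by blast
    show "h \<in> S" using S1 S2[OF hc] hN[OF h] by blast
    have "inv h \<in> S" if "h \<noteq> b"
    proof (rule S2)
      show "inv h \<in> carrier G" using hc by simp
      show "conjpow b m (inv h) \<in> Normalizer Z" for m
        using subgroup.m_inv_closed[OF NZ hN[OF h that]] hc bc by (simp add: conjpow_inv)
    qed
    then show "inv h \<in> S" using S1 by blast
  qed
  have AS: "g \<in> S" if "g \<in> A" for g
    using that unfolding A_def
  proof induction
    case one
    have "conjby \<one> ` conjpow b m ` Z = conjpow b m ` Z" for m using Zc bc by (intro conjby_image_one) auto
    then show ?case unfolding S_def by blast
  next
    case (incl h) then show ?case by (rule SX(1))
  next
    case (inv h) then show ?case by (rule SX(2))
  next
    case (eng h1 h2)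
    then have c: "h1 \<in> carrier G" "h2 \<in> carrier G" by (auto simp: S_def)
    have "\<exists>m'. conjby (h1 \<otimes> h2) ` conjpow b m ` Z = conjpow b m' ` Z" for m
    proof -
      obtain m1 where m1: "conjby h2 ` conjpow b m ` Z = conjpow b m1 ` Z" using eng(4) unfolding S_def by blast
      obtain m2 where m2: "conjby h1 ` conjpow b m1 ` Z = conjpow b m2 ` Z" using eng(3) unfolding S_def by blast
      have "conjpow b m ` Z \<subseteq> carrier G" using Zc bc by auto
      from conjby_image_comp[OF c this] have "conjby (h1 \<otimes> h2) ` conjpow b m ` Z = conjpow b m2 ` Z" using m1 m2 by simp
      then show ?thesis by blast
    qed
    then show ?case using c by (simp add: S_def)
  qed
  have orbit: "\<exists>m. conjby g ` Z = conjpow b m ` Z" if "g \<in> A" for g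
  proof -
    have "\<exists>m. conjby g ` conjpow b 0 ` Z = conjpow b m ` Z" using AS[OF that] unfolding S_def by blast
    moreover have "conjpow b 0 ` Z = Z" using Zc by (auto simp: subset_iff image_iff)
    ultimately show ?thesis by simp
  qed
  have AC: "conjby g ` Z \<subseteq> C" if "g \<in> A" for g using orbit[OF that] ZC by (elim exE) (simp only:)
  obtain D where D: "compact_open D" "A \<subseteq> Normalizer D" "(\<Inter>a\<in>A. conjby a ` Z) \<subseteq> D"
    by (rule Schlichting[OF A Z C(1) AC])
  \<comment> \<open>\<open>V\<close> is invariant under \<open>b\<close>, so it survives in every
    conjugate of \<open>Z\<close>, and the last clause of \<open>Schlichting\<close> places it in
    \<open>D\<close>.\<close>
  have VI: "V \<subseteq> (\<Inter>a\<in>A. conjby a ` Z)"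
  proof (intro subsetI INT_I)
    fix v g assume v: "v \<in> V" and g: "g \<in> A"
    obtain m where m: "conjby g ` Z = conjpow b m ` Z" using orbit[OF g] by blast
    have "v = conjpow b m (conjpow b (-m) v)" using v Vc bc by auto
    moreover have "conjpow b (-m) v \<in> Z" using alV[OF v] VZ by blast
    ultimately show "v \<in> conjby g ` Z" unfolding m by blast
  qed
  have aA: "a j \<in> A" if "j < Suc k" for j using that unfolding A_def X_def by (auto intro: generate.incl)
  have "\<forall>j<Suc k. a j \<in> Normalizer D" using subsetD[OF D(2) aA] by simp
  with D(1) subset_trans[OF VI D(3)] show ?thesis by (intro exI[of _ D] conjI)
qed

text \<open>Induction on the number of elements already treated. The inclusion of \<open>V\<close>
  is carried along because the members commute only modulo \<open>V\<close>, and commutation must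
  survive in the new group.\<close>

lemma common_compact_open:
  fixes V U :: "'a set" and a :: "nat \<Rightarrow> 'a"
  assumes V: "compactin T V" "subgroup V G" and U: "compact_open U"
    and a: "\<And>i. i < n \<Longrightarrow> a i \<in> Normalizer V"
    and comm: "\<And>i j. i < n \<Longrightarrow> j < n \<Longrightarrow> conjby (a i) (a j) \<in> a j <# V"
    and W: "\<And>i. i < n \<Longrightarrow> \<exists>W. compact_open W \<and> (\<forall>m. conjpow (a i) m ` W = W)"
  shows "\<exists>W. compact_open W \<and> V \<subseteq> W \<and> (\<forall>j<n. a j \<in> Normalizer W)"
proof -
  have "\<exists>W. compact_open W \<and> V \<subseteq> W \<and> (\<forall>j<k. a j \<in> Normalizer W)" if "k \<le> n" for k
    using that
  proof (induction k)
    case 0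
    obtain W where "compact_open W" "V \<subseteq> W" by (rule compact_open_containing[OF V U])
    then show ?case by blast
  next
    case (Suc k)
    then obtain W where W0: "compact_open W" "V \<subseteq> W" "\<And>j. j < k \<Longrightarrow> a j \<in> Normalizer W" by auto
    have k: "k < n" using Suc.prems by simp
    obtain W' where W': "compact_open W'" "\<And>m. conjpow (a k) m ` W' = W'" using W[OF k] by blast
    have "a i \<in> Normalizer V" "conjby (a k) (a i) \<in> a i <# V" if "i \<le> k" for i using that k a comm by auto
    from common_compact_open_step[of V W k a, OF V W0(2,1) this W' W0(3)] show ?case .
  qed
  then show ?thesis by blast
qed

end

section \<open>Recurrence from compactness and finite volume of the coset space\<close>
context topological_group
begin

lemma coset_eq_iff:
  assumes H: "subgroup H G" and x: "x \<in> carrier G" "y \<in> carrier G"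
  shows "x <# H = y <# H \<longleftrightarrow> x \<in> y <# H"
proof
  assume "x <# H = y <# H"
  moreover have "x \<in> x <# H"
    unfolding l_coset_iff using x subgroup.one_closed[OF H] by (intro bexI[of _ \<one>]) auto
  ultimately show "x \<in> y <# H" by simp
next
  assume "x \<in> y <# H" then show "x <# H = y <# H" by (rule l_coset_eqI[OF H x(2)])
qed

lemma topspace_coset_space: "topspace (coset_space G T H) = (\<lambda>g. g <# H) ` carrier G"
  by (simp add: coset_space_def)

lemma openin_coset_image:
  assumes H: "subgroup H G" and U: "openin T U"
  shows "openin (coset_space G T H) ((\<lambda>g. g <# H) ` U)"
proof -
  have Hc: "H \<subseteq> carrier G" by (rule subgroup.subset[OF H])
  have Uc: "U \<subseteq> carrier G" by (rule openin_subset_carrier[OF U])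
  have "{x \<in> carrier G. x <# H \<in> (\<lambda>g. g <# H) ` U} = U <#> H"
  proof (intro equalityI subsetI)
    fix x assume "x \<in> {x \<in> carrier G. x <# H \<in> (\<lambda>g. g <# H) ` U}"
    then obtain u where u: "x \<in> carrier G" "u \<in> U" "x <# H = u <# H" by auto
    then have "x \<in> u <# H" using coset_eq_iff[OF H u(1)] Uc by blast
    then show "x \<in> U <#> H" using u(2) by (auto simp: l_coset_iff intro!: set_multI)
  next
    fix x assume "x \<in> U <#> H"
    then obtain u h where u: "u \<in> U" "h \<in> H" "x = u \<otimes> h" by (auto simp: set_mult_iff)
    then have "x \<in> u <# H" by (auto simp: l_coset_iff)
    moreover have "x \<in> carrier G" "u \<in> carrier G" using u Uc Hc by auto
    ultimately show "x \<in> {x \<in> carrier G. x <# H \<in> (\<lambda>g. g <# H) ` U}"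
      using coset_eq_iff[OF H] u(1) by blast
  qed
  then show ?thesis
    using openin_set_mult_left[OF Hc U] Uc unfolding coset_space_def openin_quotient_topology by auto
qed

lemma compact_cover_translates:
  assumes K: "compactin T K" and U: "openin T U" "U \<noteq> {}"
  obtains F where "finite F" "F \<subseteq> carrier G" "K \<subseteq> F <#> U"
proof -
  have Kc: "K \<subseteq> carrier G" by (rule compactin_subset_carrier[OF K])
  have Uc: "U \<subseteq> carrier G" by (rule openin_subset_carrier[OF U(1)])
  obtain u where u: "u \<in> U" using U by blast
  have uc: "u \<in> carrier G" using u Uc by blast
  have op: "openin T V" if "V \<in> (\<lambda>x. (x \<otimes> inv u) <# U) ` K" for V
    using that openin_l_coset U Kc uc by auto
  have cov: "K \<subseteq> \<Union>((\<lambda>x. (x \<otimes> inv u) <# U) ` K)"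
  proof
    fix x assume x: "x \<in> K"
    have "x = (x \<otimes> inv u) \<otimes> u" using x Kc uc by (auto simp: m_assoc)
    then have "x \<in> (x \<otimes> inv u) <# U" using u unfolding l_coset_iff by blast
    then show "x \<in> \<Union>((\<lambda>x. (x \<otimes> inv u) <# U) ` K)" using x by blast
  qed
  from compactinD[OF K op cov]
  obtain \<F> where \<F>: "finite \<F>" "\<F> \<subseteq> (\<lambda>x. (x \<otimes> inv u) <# U) ` K" "K \<subseteq> \<Union>\<F>"
    by auto
  from finite_subset_image[OF this(1,2)]
  obtain F where F: "finite F" "F \<subseteq> K" "\<F> = (\<lambda>x. (x \<otimes> inv u) <# U) ` F"
    by auto
  have "K \<subseteq> (\<lambda>x. x \<otimes> inv u) ` F <#> U"
  proof
    fix x assume "x \<in> K"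
    then obtain f where "f \<in> F" "x \<in> (f \<otimes> inv u) <# U" using \<F>(3) F(3) by auto
    then show "x \<in> (\<lambda>x. x \<otimes> inv u) ` F <#> U" by (auto simp: l_coset_iff intro!: set_multI)
  qed
  moreover have "(\<lambda>x. x \<otimes> inv u) ` F \<subseteq> carrier G" using F(2) Kc uc by auto
  ultimately show thesis using that F(1) by blast
qed

text \<open>Compactness of \<open>G/H\<close> gives a finite \<open>F\<close> such that
  \<open>F <#> U <#> H\<close> is the whole group. Every point then visits the same compact set at
  all times.\<close>

lemma cocompact_recurrent:
  assumes H: "subgroup H G" and U: "compact_open U" and coc: "cocompact H G T"
  shows "recurrent H"
proof -
  let ?X = "coset_space G T H"
  have Us: "subgroup U G" by (rule compact_openD(1)[OF U])
  have K: "compactin ?X (topspace ?X)" using coc by (simp add: cocompact_def compact_space_def)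
  define V where "V x = (\<lambda>g. g <# H) ` (x <# U)" for x
  have op: "openin ?X W" if "W \<in> V ` carrier G" for W
    using that openin_coset_image[OF H openin_l_coset[OF _ compact_openD(3)[OF U]]] by (auto simp: V_def)
  have cov: "topspace ?X \<subseteq> \<Union> (V ` carrier G)"
  proof
    fix D assume "D \<in> topspace ?X"
    then obtain x where x: "x \<in> carrier G" "D = x <# H" unfolding topspace_coset_space by blast
    have "x \<in> x <# U" unfolding l_coset_iff using x subgroup.one_closed[OF Us] by (intro bexI[of _ \<one>]) auto
    then show "D \<in> \<Union> (V ` carrier G)" using x by (auto simp: V_def)
  qed
  from compactinD[OF K op cov] obtain \<F> where \<F>: "finite \<F>" "\<F> \<subseteq> V ` carrier G" "topspace ?X \<subseteq> \<Union>\<F>" by auto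
  from finite_subset_image[OF this(1,2)] obtain F where F: "finite F" "F \<subseteq> carrier G" "\<F> = V ` F" by auto
  have all: "x \<in> (F <#> U) <#> H" if x: "x \<in> carrier G" for x
  proof -
    have "x <# H \<in> topspace ?X" using x by (auto simp: topspace_coset_space)
    then obtain f where f: "f \<in> F" "x <# H \<in> V f" using \<F>(3) F(3) by auto
    then obtain u where u: "u \<in> U" "x <# H = (f \<otimes> u) <# H" by (auto simp: V_def l_coset_iff)
    have "f \<otimes> u \<in> carrier G" using f u F compact_open_subset[OF U] by auto
    then have "x \<in> (f \<otimes> u) <# H" using coset_eq_iff[OF H x] u(2) by blast
    then show ?thesis using f(1) u(1) by (auto simp: l_coset_iff intro!: set_multI)
  qed
  have comp: "compactin T (F <#> U)"
    by (intro compactin_set_mult compact_openD(2)[OF U] finite_imp_compactin) (use F in auto)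
  have vis: "visits H g x" if "\<And>n. g n \<in> carrier G" "x \<in> carrier G" for g :: "nat \<Rightarrow> 'a" and x
    unfolding visits_def
  proof (intro exI conjI)
    have "{n. g n \<otimes> x \<in> F <#> U <#> H} = UNIV" using all that by auto
    then show "infinite {n. g n \<otimes> x \<in> F <#> U <#> H}" by simp
  qed (rule comp)
  show ?thesis unfolding recurrent_def
  proof (intro allI impI)
    fix g :: "nat \<Rightarrow> 'a" and U w assume a: "\<forall>n. g n \<in> carrier G" "openin T U" "U \<noteq> {}" "w \<in> carrier G"
    then obtain u where u: "u \<in> U" by blast
    then have "u \<in> carrier G" using openin_subset_carrier[OF a(2)] by blast
    then show "\<exists>u\<in>U. visits H g u \<and> visits H g (w \<otimes> u)" using vis a u by (intro bexI[of _ u]) auto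
  qed
qed

text \<open>For an exhaustion by compact sets of measure tending to 1, the limes superior of the translated
  sets has at least the same measure.\<close>

lemma finite_covolume_recurrent:
  assumes sc: "sigma_compact_space T" and H: "subgroup H G" and U0: "compact_open U0"
    and fc: "finite_covolume H G T"
  shows "recurrent H"
proof -
  let ?X = "coset_space G T H"
  define q where "q = (\<lambda>g. g <# H)"
  obtain M where M: "borel_measure_on ?X M" "prob_space M"
    and inv: "\<And>g B. g \<in> carrier G \<Longrightarrow> B \<in> sets M \<Longrightarrow> emeasure M ((\<lambda>C. g <# C) ` B) = emeasure M B"
    using fc unfolding finite_covolume_def by blast
  interpret M: prob_space M by (rule M(2))
  have Hc: "H \<subseteq> carrier G" by (rule subgroup.subset[OF H])
  have spM: "space M = q ` carrier G" using M(1) by (simp add: borel_measure_on_def topspace_coset_space q_def)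
  have qo: "q ` V \<in> sets M" if "openin T V" for V
    using M(1) openin_coset_image[OF H that] by (auto simp: borel_measure_on_def q_def intro: sigma_sets.Basic)
  have tr: "(\<lambda>C. g <# C) ` q ` V = q ` (g <# V)" if "g \<in> carrier G" "V \<subseteq> carrier G" for g V
  proof -
    have "g <# q v = q (g \<otimes> v)" if "v \<in> V" for v
      unfolding q_def using that \<open>g \<in> carrier G\<close> \<open>V \<subseteq> carrier G\<close> Hc by (intro l_coset_l_coset) auto
    then show ?thesis by (force simp: l_coset_def image_iff)
  qed
  have inv': "emeasure M (q ` (g <# V)) = emeasure M (q ` V)" if "g \<in> carrier G" "openin T V" for g V
    using inv[OF that(1) qo[OF that(2)]] tr[OF that(1) openin_subset_carrier[OF that(2)]] by simp
  obtain \<K> where \<K>: "countable \<K>" "\<And>K. K \<in> \<K> \<Longrightarrow> compactin T K" "\<Union>\<K> = carrier G"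
    using sc unfolding sigma_compact_space_def by auto
  have ne: "\<K> \<noteq> {}" using \<K>(3) by blast
  define KK where "KK = from_nat_into \<K>"
  have KK: "compactin T (KK n)" for n unfolding KK_def by (rule \<K>(2)[OF from_nat_into[OF ne]])
  have KKU: "(\<Union>n. KK n) = carrier G" unfolding KK_def using range_from_nat_into[OF ne \<K>(1)] \<K>(3) by simp
  \<comment> \<open>The factor \<open>U0\<close> makes the compact exhaustion open as well, so that
    its image in the coset space is open and hence measurable.\<close>
  define Om where "Om m = (\<Union>n\<le>m. KK n) <#> U0" for m :: nat
  have comp: "compactin T (\<Union>n\<le>m. KK n)" for m
    by (intro compactin_Union) (auto intro: KK)
  have OOk: "compactin T (Om m)" for m
    unfolding Om_def by (intro compactin_set_mult comp compact_openD(2)[OF U0])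
  have OOo: "openin T (Om m)" for m
    unfolding Om_def by (rule openin_set_mult_right[OF compactin_subset_carrier[OF comp] compact_openD(3)[OF U0]])
  have OOc: "Om m \<subseteq> carrier G" for m by (rule openin_subset_carrier[OF OOo])
  have OOU: "(\<Union>m. Om m) = carrier G"
  proof
    show "(\<Union>m. Om m) \<subseteq> carrier G" using OOc by blast
    show "carrier G \<subseteq> (\<Union>m. Om m)"
    proof
      fix x assume x: "x \<in> carrier G"
      then obtain n where "x \<in> KK n" using KKU by blast
      then have "x \<otimes> \<one> \<in> Om n" unfolding Om_def by (intro set_multI compact_open_one[OF U0]) auto
      then show "x \<in> (\<Union>m. Om m)" using x by auto
    qed
  qed
  have OOinc: "Om m \<subseteq> Om n" if "m \<le> n" for m n
    unfolding Om_def using that by (intro mono_set_mult) (auto intro: order_trans)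
  define Q where "Q m = q ` Om m" for m
  have Qs: "Q m \<in> sets M" for m unfolding Q_def by (rule qo[OF OOo])
  have QU: "(\<Union>m. Q m) = space M" unfolding Q_def spM OOU[symmetric] by auto
  have "incseq Q" unfolding Q_def incseq_def using OOinc by (auto intro!: image_mono)
  then have Qlim: "(\<lambda>m. measure M (Q m)) \<longlonglongrightarrow> 1"
    using M.finite_Lim_measure_incseq[of Q] Qs QU M.prob_space by (simp add: image_subset_iff)
  have full: "\<exists>E\<in>sets M. measure M E = 1 \<and> (\<forall>x\<in>carrier G. q x \<in> E \<longrightarrow> visits H g x)"
    if g: "\<And>n. g n \<in> carrier G" for g :: "nat \<Rightarrow> 'a"
  proof -
    \<comment> \<open>The points of the coset space that \<open>g n\<close> moves into
      \<open>Q m\<close>. Invariance gives this set the measure of \<open>Q m\<close>, whatever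
      \<open>n\<close> is.\<close>
    define A where "A m n = q ` (inv (g n) <# Om m)" for m n
    have As: "A m n \<in> sets M" for m n unfolding A_def using g by (intro qo openin_l_coset OOo) auto
    have Am: "measure M (A m n) = measure M (Q m)" for m n
      unfolding A_def Q_def measure_def using inv'[OF _ OOo] g by simp
    define L where "L m = (\<Inter>N. \<Union>n\<in>{N..}. A m n)" for m
    have Ts: "(\<Union>n\<in>{N..}. A m n) \<in> sets M" for m N using As by auto
    have Ls: "L m \<in> sets M" for m unfolding L_def using Ts by auto
    \<comment> \<open>Every tail union contains a set of measure \<open>measure M (Q m)\<close>; in
      a finite measure space the bound passes to the decreasing intersection
      \<open>L m\<close>.\<close>
    have Lm: "measure M (Q m) \<le> measure M (L m)" for m
    proof -
      have "(\<lambda>N. measure M (\<Union>n\<in>{N..}. A m n)) \<longlonglongrightarrow> measure M (L m)"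
        unfolding L_def
      proof (rule M.finite_Lim_measure_decseq)
        show "decseq (\<lambda>N. \<Union>n\<in>{N..}. A m n)" unfolding decseq_def by (intro allI impI UN_mono) auto
      qed (use Ts in blast)
      moreover have "measure M (Q m) \<le> measure M (\<Union>n\<in>{N..}. A m n)" for N
        unfolding Am[of m N, symmetric] by (rule M.finite_measure_mono[OF _ Ts]) auto
      ultimately show ?thesis by (intro LIMSEQ_le_const) auto
    qed
    define E where "E = (\<Union>m. L m)"
    have Es: "E \<in> sets M" unfolding E_def using Ls by auto
    have "measure M (Q m) \<le> measure M E" for m
      using Lm[of m] M.finite_measure_mono[OF _ Es, of "L m"] unfolding E_def by force
    then have "1 \<le> measure M E" using LIMSEQ_le_const2[OF Qlim] by blast
    then have "measure M E = 1" using M.prob_le_1[of E] by simp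
    moreover have "visits H g x" if x: "x \<in> carrier G" "q x \<in> E" for x
    proof -
      obtain m where m: "q x \<in> L m" using x by (auto simp: E_def)
      have "g n \<otimes> x \<in> Om m <#> H" if qA: "q x \<in> A m n" for n
      proof -
        obtain y where y: "y \<in> Om m" "q x = q (inv (g n) \<otimes> y)" using qA by (auto simp: A_def l_coset_iff)
        have yc: "y \<in> carrier G" using y OOc by blast
        have "x \<in> (inv (g n) \<otimes> y) <# H" 
          using iffD1[OF coset_eq_iff[OF H x(1)] y(2)[unfolded q_def]] yc g[of n] by simp
        then obtain h where h: "h \<in> H" "x = inv (g n) \<otimes> y \<otimes> h" by (auto simp: l_coset_iff)
        have "g n \<otimes> x = y \<otimes> h" unfolding h(2) using yc h(1) Hc g[of n] by (auto simp: m_assoc subset_iff)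
        then show ?thesis using y(1) h(1) by (simp add: set_multI)
      qed
      then have sub: "{n. q x \<in> A m n} \<subseteq> {n. g n \<otimes> x \<in> Om m <#> H}" by blast
      have "\<exists>n\<ge>N. q x \<in> A m n" for N using m unfolding L_def by auto
      then have "infinite {n. q x \<in> A m n}" unfolding infinite_nat_iff_unbounded_le by blast
      then have "infinite {n. g n \<otimes> x \<in> Om m <#> H}" using sub infinite_super by blast
      then show ?thesis unfolding visits_def using OOk by blast
    qed
    ultimately show ?thesis using Es by blast
  qed
  \<comment> \<open>If a nonempty open set had a null image, so would all its translates. Finitely
    many of them cover the compact \<open>Om m\<close>, so every \<open>Q m\<close> and thus the
    whole space would be null.\<close>
  have pos: "emeasure M (q ` V) \<noteq> 0" if V: "openin T V" "V \<noteq> {}" for V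
  proof
    assume z: "emeasure M (q ` V) = 0"
    have Vc: "V \<subseteq> carrier G" by (rule openin_subset_carrier[OF V(1)])
    have n1: "q ` (f <# V) \<in> null_sets M" if "f \<in> carrier G" for f
      using inv'[OF that V(1)] z qo[OF openin_l_coset[OF that V(1)]] by auto
    have "Q m \<in> null_sets M" for m
    proof -
      obtain F where F: "finite F" "F \<subseteq> carrier G" "Om m \<subseteq> F <#> V"
        by (rule compact_cover_translates[OF OOk V])
      have "(\<Union>f\<in>F. q ` (f <# V)) \<in> null_sets M" using F n1 by (intro null_sets_UN' countable_finite) auto
      moreover have "Q m \<subseteq> (\<Union>f\<in>F. q ` (f <# V))"
        unfolding Q_def using F(3) by (force simp: set_mult_iff l_coset_iff subset_iff)
      ultimately show ?thesis using Qs null_sets_subset by blast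
    qed
    then have "(\<Union>m. Q m) \<in> null_sets M" by (intro null_sets_UN) auto
    then show False using QU M.emeasure_space_1 by (simp add: null_setsD1)
  qed
  show ?thesis unfolding recurrent_def
  proof (intro allI impI)
    fix g :: "nat \<Rightarrow> 'a" and U w assume a: "\<forall>n. g n \<in> carrier G" "openin T U" "U \<noteq> {}" "w \<in> carrier G"
    have Uc: "U \<subseteq> carrier G" by (rule openin_subset_carrier[OF a(2)])
    obtain E1 where E1: "E1 \<in> sets M" "measure M E1 = 1" "\<And>x. x \<in> carrier G \<Longrightarrow> q x \<in> E1 \<Longrightarrow> visits H g x"
      using full[of g] a(1) by blast
    \<comment> \<open>Visits of \<open>w \<otimes> u\<close> under \<open>g\<close> are visits of
      \<open>u\<close> under the sequence \<open>g n \<otimes> w\<close>, so both requirements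
      concern the same point \<open>u\<close>.\<close>
    obtain E2 where E2: "E2 \<in> sets M" "measure M E2 = 1"
      "\<And>x. x \<in> carrier G \<Longrightarrow> q x \<in> E2 \<Longrightarrow> visits H (\<lambda>n. g n \<otimes> w) x"
      using full[of "\<lambda>n. g n \<otimes> w"] a(1,4) by blast
    have "AE x in M. x \<in> E1" "AE x in M. x \<in> E2" using M.prob_eq_1 E1 E2 by auto
    then have ae: "AE x in M. x \<in> E1 \<and> x \<in> E2" by eventually_elim simp
    have "q ` U \<inter> (E1 \<inter> E2) \<noteq> {}"
    proof
      assume e: "q ` U \<inter> (E1 \<inter> E2) = {}"
      have "AE x in M. x \<notin> q ` U" using ae by eventually_elim (use e in blast)
      then have "emeasure M (q ` U) = 0" using AE_iff_null_sets[OF qo[OF a(2)]] by auto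
      then show False using pos[OF a(2,3)] by simp
    qed
    then obtain u where u: "u \<in> U" "q u \<in> E1" "q u \<in> E2" by blast
    have uc: "u \<in> carrier G" using u(1) Uc by blast
    have "visits H (\<lambda>n. g n \<otimes> w) u" by (rule E2(3)[OF uc u(3)])
    then have "visits H g (w \<otimes> u)" using a(1,4) uc by (simp add: visits_def m_assoc)
    then show "\<exists>u\<in>U. visits H g u \<and> visits H g (w \<otimes> u)" using E1(3)[OF uc u(2)] u(1) by blast
  qed
qed

text \<open>For representatives \<open>c n\<close> of infinitely many right cosets, recurrence of
  their inverses at a point \<open>x\<close> of \<open>P\<close> gives infinitely many returns to
  \<open>K <#> H\<close>. That set lies in finitely many left cosets of \<open>P\<close>, because
  \<open>H\<close> is in \<open>F <#> B\<close> with \<open>B\<close> inside \<open>P\<close> and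
  \<open>P\<close> is open. Two returns to one left coset show that two of the right cosets are
  equal.\<close>

lemma recurrent_finite_index:
  assumes rec: "recurrent H" and P: "subgroup P G" "openin T P" and BP: "B \<subseteq> P"
    and F: "finite F" "F \<subseteq> carrier G" and HF: "H \<subseteq> F <#> B"
  shows "finite (rcosets P)"
proof (rule ccontr)
  assume inf: "infinite (rcosets P)"
  have Pc: "P \<subseteq> carrier G" by (rule subgroup.subset[OF P(1)])
  note Pm = subgroup.m_closed[OF P(1)] and Pi = subgroup.m_inv_closed[OF P(1)]
  obtain r :: "nat \<Rightarrow> 'a set" where r: "inj r" "range r \<subseteq> rcosets P"
    using infinite_countable_subset[OF inf] by blast
  have "\<forall>n. \<exists>c. c \<in> carrier G \<and> r n = P #> c" using r(2) by (auto simp: RCOSETS_def)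
  then obtain c where c: "\<And>n. c n \<in> carrier G" "\<And>n. r n = P #> c n" by metis
  obtain x where x: "x \<in> P" "visits H (\<lambda>n. inv (c n)) x"
    using rec[unfolded recurrent_def, rule_format, of "\<lambda>n. inv (c n)" P \<one>] c(1) P(2)
      subgroup.one_closed[OF P(1)] by auto
  have xc: "x \<in> carrier G" using x Pc by blast
  obtain K where K: "compactin T K" "infinite {n. inv (c n) \<otimes> x \<in> K <#> H}" using x(2) by (auto simp: visits_def)
  have Kc: "K \<subseteq> carrier G" by (rule compactin_subset_carrier[OF K(1)])
  have KF: "compactin T (K <#> F)" by (intro compactin_set_mult K(1) finite_imp_compactin) (use F in auto)
  obtain F' where F': "finite F'" "F' \<subseteq> K <#> F" "K <#> F \<subseteq> F' <#> P" by (rule compact_finite_cover[OF KF P])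
  have F'c: "F' \<subseteq> carrier G" using F'(2) compactin_subset_carrier[OF KF] by blast
  have "K <#> H \<subseteq> F' <#> P"
  proof
    fix z assume "z \<in> K <#> H"
    then obtain k h where kh: "k \<in> K" "h \<in> H" "z = k \<otimes> h" by (auto simp: set_mult_iff)
    obtain f b where fb: "f \<in> F" "b \<in> B" "h = f \<otimes> b" using HF kh(2) unfolding subset_iff set_mult_iff by blast
    have "k \<otimes> f \<in> F' <#> P" using F'(3) set_multI[OF kh(1) fb(1)] by blast
    then obtain f' p where f': "f' \<in> F'" "p \<in> P" "k \<otimes> f = f' \<otimes> p" by (auto simp: set_mult_iff)
    have cc: "k \<in> carrier G" "f \<in> carrier G" "b \<in> carrier G" "f' \<in> carrier G" "p \<in> carrier G"
      using kh Kc fb F BP Pc f' F'c by auto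
    have "z = (k \<otimes> f) \<otimes> b" unfolding kh(3) fb(3) using cc by (simp add: m_assoc)
    also have "\<dots> = f' \<otimes> (p \<otimes> b)" unfolding f'(3) using cc by (simp add: m_assoc)
    finally show "z \<in> F' <#> P" using f'(1) Pm[OF f'(2)] fb(2) BP by (auto intro!: set_multI)
  qed
  then have "{n. inv (c n) \<otimes> x \<in> K <#> H} \<subseteq> (\<Union>f\<in>F'. {n. inv (c n) \<otimes> x \<in> f <# P})"
    by (fastforce simp: set_mult_iff l_coset_iff)
  then have "\<exists>f\<in>F'. infinite {n. inv (c n) \<otimes> x \<in> f <# P}"
    using K(2) F'(1) by (meson finite_UN finite_subset)
  then obtain f where f: "f \<in> F'" "infinite {n. inv (c n) \<otimes> x \<in> f <# P}" by blast
  have fcar: "f \<in> carrier G" using f F'c by blast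
  obtain n where n: "inv (c n) \<otimes> x \<in> f <# P" using infinite_imp_nonempty[OF f(2)] by blast
  obtain m where m: "m > n" "inv (c m) \<otimes> x \<in> f <# P" using f(2) unfolding infinite_nat_iff_unbounded by auto
  obtain p1 p2 where p: "p1 \<in> P" "inv (c n) \<otimes> x = f \<otimes> p1" "p2 \<in> P" "inv (c m) \<otimes> x = f \<otimes> p2"
    using n m(2) by (auto simp: l_coset_iff)
  have pc: "p1 \<in> carrier G" "p2 \<in> carrier G" using p Pc by auto
  have "c n \<otimes> inv (c m) = x \<otimes> inv (inv (c n) \<otimes> x) \<otimes> (inv (c m) \<otimes> x) \<otimes> inv x"
    using c(1)[of n] c(1)[of m] xc by (simp add: group_nf)
  also have "\<dots> = x \<otimes> (inv p1 \<otimes> p2) \<otimes> inv x"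
    unfolding p(2,4) using xc pc fcar by (simp add: group_nf)
  also have "\<dots> \<in> P" using x(1) p(1,3) Pm Pi by simp
  finally have "P #> c n = P #> c m"
    using coset_mult_inv1[OF _ c(1)[of n] c(1)[of m] Pc] coset_join2[OF _ P(1)] c(1) by simp
  then have "r n = r m" by (simp add: c(2))
  then show False using r(1) m(1) by (auto dest: injD)
qed

end

section \<open>Existence of the regionally compact radical\<close>
lemma (in topological_group) subgroup_topological_group:
  assumes H: "subgroup H G" shows "topological_group (G\<lparr>carrier := H\<rparr>) (subtopology T H)"
proof -
  have Hc: "H \<subseteq> carrier G" by (rule subgroup.subset[OF H])
  interpret H: group "G\<lparr>carrier := H\<rparr>" by (rule subgroup_imp_group[OF H])
  show ?thesis
  proof
    show "topspace (subtopology T H) = carrier (G\<lparr>carrier := H\<rparr>)" using Hc by auto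
    have "continuous_map (subtopology (prod_topology T T) (H \<times> H)) (subtopology T H) (\<lambda>(x, y). x \<otimes> y)"
    proof (rule continuous_map_into_subtopology)
      show "continuous_map (subtopology (prod_topology T T) (H \<times> H)) T (\<lambda>(x, y). x \<otimes> y)"
        by (rule continuous_map_from_subtopology[OF continuous_mult])
      show "(\<lambda>(x, y). x \<otimes> y) \<in> topspace (subtopology (prod_topology T T) (H \<times> H)) \<rightarrow> H"
        using subgroup.m_closed[OF H] by auto
    qed
    then show "continuous_map (prod_topology (subtopology T H) (subtopology T H)) (subtopology T H)
        (\<lambda>(x, y). x \<otimes>\<^bsub>G\<lparr>carrier := H\<rparr>\<^esub> y)"
      by (simp add: subtopology_Times)
    have "continuous_map (subtopology T H) (subtopology T H) (\<lambda>x. inv x)"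
    proof (rule continuous_map_into_subtopology)
      show "continuous_map (subtopology T H) T (\<lambda>x. inv x)"
        by (rule continuous_map_from_subtopology[OF continuous_inv])
      show "(\<lambda>x. inv x) \<in> topspace (subtopology T H) \<rightarrow> H"
        using subgroup.m_inv_closed[OF H] by auto
    qed
    then show "continuous_map (subtopology T H) (subtopology T H) (\<lambda>x. inv\<^bsub>G\<lparr>carrier := H\<rparr>\<^esub> x)"
      by (rule continuous_map_eq) (use H in auto)
  qed
qed

lemma (in locally_compact_group) closed_subgroup_locally_compact_group:
  assumes H: "subgroup H G" "closedin T H"
  shows "locally_compact_group (G\<lparr>carrier := H\<rparr>) (subtopology T H)"
  by (intro locally_compact_group.intro subgroup_topological_group H locally_compact_group_axioms.intro
      locally_compact_space_closed_subset locally_compact Hausdorff_space_subtopology Hausdorff)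

lemma bdd_in_subtopology:
  assumes "closedin T H" shows "bdd_in (subtopology T H) S \<longleftrightarrow> bdd_in T S \<and> S \<subseteq> H"
proof
  assume "bdd_in (subtopology T H) S"
  then show "bdd_in T S \<and> S \<subseteq> H" by (auto simp: bdd_in_def compactin_subtopology)
next
  assume a: "bdd_in T S \<and> S \<subseteq> H"
  then obtain K where "compactin T K" "S \<subseteq> K" by (auto simp: bdd_in_def)
  then have "compactin (subtopology T H) (K \<inter> H)" "S \<subseteq> K \<inter> H"
    using a compact_Int_closedin[OF _ assms] by (auto simp: compactin_subtopology)
  then show "bdd_in (subtopology T H) S" by (auto simp: bdd_in_def)
qed

lemma bdd_in_subtopologyD: "bdd_in (subtopology T H) S \<Longrightarrow> bdd_in T S"
  by (auto simp: bdd_in_def compactin_subtopology)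

text \<open>Schreier's lemma for a finitely generated group that is covered by finitely many cosets
  of \<open>N\<close>. Up to finitely many right factors it is generated by finitely many elements
  of \<open>N\<close>, so boundedness of finitely generated subgroups can be tested inside
  \<open>N\<close>.\<close>

lemma (in group) Schreier:
  assumes F: "finite F" "F \<subseteq> carrier G" and N: "subgroup N G" and K: "finite K" "K \<subseteq> carrier G"
    and FN: "generate G F \<subseteq> N <#> K"
  obtains Y R where "finite Y" "Y \<subseteq> N" "finite R" "R \<subseteq> carrier G" "generate G F \<subseteq> generate G Y <#> R"
proof -
  define E where "E = generate G F"
  have E: "subgroup E G" unfolding E_def by (rule generate_is_subgroup[OF F(2)])
  have Ec: "E \<subseteq> carrier G" by (rule subgroup.subset[OF E])
  have Nc: "N \<subseteq> carrier G" by (rule subgroup.subset[OF N])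
  note Em = subgroup.m_closed[OF E] and Ei = subgroup.m_inv_closed[OF E]
  \<comment> \<open>The representatives are taken in \<open>E\<close>, so that multiplying them by
    generators stays in \<open>E\<close>, where representatives exist again.\<close>
  define R where "R = (\<lambda>k. SOME t. t \<in> E \<and> t \<in> N #> k) ` {k \<in> K. \<exists>t. t \<in> E \<and> t \<in> N #> k}"
  have some: "(SOME t. t \<in> E \<and> t \<in> N #> k) \<in> E \<and> (SOME t. t \<in> E \<and> t \<in> N #> k) \<in> N #> k"
    if "\<exists>t. t \<in> E \<and> t \<in> N #> k" for k using someI_ex[OF that] .
  have R: "finite R" "R \<subseteq> E" using K(1) some by (auto simp: R_def)
  have Rc: "R \<subseteq> carrier G" using R Ec by blast
  have tr: "\<exists>t\<in>R. x \<otimes> inv t \<in> N" if x: "x \<in> E" for x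
  proof -
    have "x \<in> N <#> K" using x FN by (auto simp: E_def)
    then obtain n k where nk: "n \<in> N" "k \<in> K" "x = n \<otimes> k" by (auto simp: set_mult_iff)
    then have ex: "\<exists>t. t \<in> E \<and> t \<in> N #> k" using x by (auto simp: r_coset_def)
    define t where "t = (SOME t. t \<in> E \<and> t \<in> N #> k)"
    have t: "t \<in> R" "t \<in> N #> k" using some[OF ex] ex nk(2) unfolding t_def R_def by auto
    then obtain n' where n': "n' \<in> N" "t = n' \<otimes> k" by (auto simp: r_coset_def)
    have c: "n \<in> carrier G" "k \<in> carrier G" "n' \<in> carrier G" using nk n' Nc K by auto
    have "x \<otimes> inv t = n \<otimes> inv n'" unfolding nk(3) n'(2) using c by (simp add: group_nf)
    then have "x \<otimes> inv t \<in> N" using subgroup.m_closed[OF N nk(1) subgroup.m_inv_closed[OF N n'(1)]] by simp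
    then show ?thesis using t(1) by blast
  qed
  define S where "S = F \<union> (\<lambda>x. inv x) ` F"
  have SE: "S \<subseteq> E" using Ei generate.incl[of _ F] by (auto simp: S_def E_def)
  \<comment> \<open>Schreier generators. The elements of \<open>R\<close> that lie in
    \<open>N\<close> are added because the representative of the coset of the identity need not be
    the identity; it is used to write the identity as an element of \<open>GY <#> R\<close>.\<close>
  define Y where "Y = ((\<lambda>(t, s, t'). t \<otimes> s \<otimes> inv t') ` (R \<times> S \<times> R) \<union> R) \<inter> N"
  have Y: "finite Y" "Y \<subseteq> N" using F(1) R(1) by (auto simp: Y_def S_def)
  have Yc: "Y \<subseteq> carrier G" using Y Nc by blast
  define GY where "GY = generate G Y"
  have GY: "subgroup GY G" unfolding GY_def by (rule generate_is_subgroup[OF Yc])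
  have GYc: "GY \<subseteq> carrier G" by (rule subgroup.subset[OF GY])
  have step: "z \<otimes> s \<in> GY <#> R" if z: "z \<in> GY <#> R" and s: "s \<in> S" for z s
  proof -
    obtain y t where yt: "y \<in> GY" "t \<in> R" "z = y \<otimes> t" using z by (auto simp: set_mult_iff)
    have "t \<otimes> s \<in> E" using Em yt(2) R(2) s SE by blast
    then obtain t' where t': "t' \<in> R" "t \<otimes> s \<otimes> inv t' \<in> N" using tr by blast
    have c: "y \<in> carrier G" "t \<in> carrier G" "s \<in> carrier G" "t' \<in> carrier G"
      using yt GYc Rc s SE Ec t' by auto
    have "t \<otimes> s \<otimes> inv t' \<in> Y" using yt(2) s t' by (force simp: Y_def)
    then have "t \<otimes> s \<otimes> inv t' \<in> GY" unfolding GY_def by (rule generate.incl)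
    then have "y \<otimes> (t \<otimes> s \<otimes> inv t') \<in> GY" using subgroup.m_closed[OF GY yt(1)] by blast
    moreover have "z \<otimes> s = (y \<otimes> (t \<otimes> s \<otimes> inv t')) \<otimes> t'" unfolding yt(3) using c by (simp add: group_nf)
    ultimately show ?thesis using t'(1) by (simp add: set_multI)
  qed
  have GYRc: "z \<in> carrier G" if "z \<in> GY <#> R" for z using that GYc Rc by (auto simp: set_mult_iff)
  have right: "\<forall>z\<in>GY <#> R. z \<otimes> x \<in> GY <#> R" if "x \<in> generate G F" for x
    using that
  proof induction
    case one
    then show ?case using GYRc by auto
  next
    case (incl h)
    then show ?case using step by (auto simp: S_def)
  next
    case (inv h)
    then show ?case using step by (auto simp: S_def)
  next
    case (eng h1 h2)
    have c: "h1 \<in> carrier G" "h2 \<in> carrier G" using eng(1,2) generate_in_carrier[OF F(2)] by auto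
    then have "z \<otimes> (h1 \<otimes> h2) = (z \<otimes> h1) \<otimes> h2" if "z \<in> GY <#> R" for z using GYRc[OF that] by (simp add: m_assoc)
    then show ?case using eng(3,4) by simp
  qed
  have one: "\<one> \<in> GY <#> R"
  proof -
    obtain t where t: "t \<in> R" "\<one> \<otimes> inv t \<in> N" using tr[OF subgroup.one_closed[OF E]] by blast
    have tc: "t \<in> carrier G" using t Rc by blast
    have "t \<in> N" using subgroup.m_inv_closed[OF N t(2)] tc by simp
    then have "t \<in> Y" using t(1) by (simp add: Y_def)
    then have "inv t \<in> GY" unfolding GY_def by (rule generate.inv)
    moreover have "inv t \<otimes> t = \<one>" using tc by simp
    ultimately show ?thesis using t(1) set_multI[of "inv t" GY t R] by simp
  qed
  have "generate G F \<subseteq> GY <#> R"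
  proof
    fix x assume x: "x \<in> generate G F"
    have "\<one> \<otimes> x \<in> GY <#> R" using right[OF x] one by blast
    then show "x \<in> GY <#> R" using generate_in_carrier[OF F(2) x] by simp
  qed
  then show thesis using that[OF Y R(1) Rc] by (simp add: GY_def)
qed

section \<open>Normal subgroups with bounded finitely generated subgroups\<close>

context hausdorff_group
begin

text \<open>The algebraic core of regional compactness, measured in the ambient group and without
  closedness of \<open>N\<close>. In this form products and unions can be formed before their
  topology is known.\<close>

definition loc_bounded :: "'a set \<Rightarrow> bool" where
  "loc_bounded N \<longleftrightarrow> N \<lhd> G \<and> (\<forall>F. finite F \<longrightarrow> F \<subseteq> N \<longrightarrow> bdd_in T (generate G F))"

lemma normal_set_mult:
  assumes N: "N \<lhd> G" and M: "M \<lhd> G" shows "N <#> M \<lhd> G"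
proof -
  have Ns: "subgroup N G" and Ms: "subgroup M G" using N M normal_imp_subgroup by auto
  have Nc: "N \<subseteq> carrier G" and Mc: "M \<subseteq> carrier G" using subgroup.subset[OF Ns] subgroup.subset[OF Ms] by auto
  have conjby: "conjby g x \<in> K" if "K \<lhd> G" "g \<in> carrier G" "x \<in> K" for K g x
    using normal.inv_op_closed2[OF that] by (simp add: conjby_def)
  show ?thesis
  proof (rule normal_invI)
    show "subgroup (N <#> M) G"
      by (rule subgroup_set_mult(1)[OF is_group Ns Ms]) (use conjby[OF N] Mc in auto)
    fix x h assume x: "x \<in> carrier G" and h: "h \<in> N <#> M"
    then obtain n m where nm: "n \<in> N" "m \<in> M" "h = n \<otimes> m" by (auto simp: set_mult_iff)
    have "x \<otimes> h \<otimes> inv x = conjby x n \<otimes> conjby x m"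
      unfolding nm(3) using x nm Nc Mc by (auto simp: conjby_def group_nf subset_iff)
    then show "x \<otimes> h \<otimes> inv x \<in> N <#> M" using conjby[OF N x nm(1)] conjby[OF M x nm(2)] by (simp add: set_multI)
  qed
qed

text \<open>The \<open>M\<close>-components of a finite set \<open>F\<close> generate a bounded
  group, which is covered by finitely many cosets of \<open>V\<close>. As \<open>V\<close> lies in
  the normal subgroup \<open>N\<close>, the group generated by \<open>F\<close> meets only finitely
  many cosets of \<open>N\<close>, and \<open>Schreier\<close> reduces the question to finitely
  generated subgroups of \<open>N\<close>.\<close>

lemma loc_bounded_set_mult:
  assumes N: "loc_bounded N" and M: "loc_bounded M" and V: "compact_open V" "V \<subseteq> N"
  shows "loc_bounded (N <#> M)"
proof -
  have Nn: "N \<lhd> G" and Mn: "M \<lhd> G" using N M by (auto simp: loc_bounded_def)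
  have Ns: "subgroup N G" and Ms: "subgroup M G" using Nn Mn normal_imp_subgroup by auto
  have Nc: "N \<subseteq> carrier G" and Mc: "M \<subseteq> carrier G" using subgroup.subset[OF Ns] subgroup.subset[OF Ms] by auto
  have cjN: "conjby g x \<in> N" if "g \<in> carrier G" "x \<in> N" for g x
    using normal.inv_op_closed2[OF Nn that] by (simp add: conjby_def)
  have "bdd_in T (generate G F)" if F: "finite F" "F \<subseteq> N <#> M" for F
  proof -
    have Fc: "F \<subseteq> carrier G" using F(2) set_mult_closed[OF Nc Mc] by blast
    have "\<forall>f\<in>F. \<exists>n m. n \<in> N \<and> m \<in> M \<and> f = n \<otimes> m" using F(2) unfolding subset_iff set_mult_iff by blast
    then obtain \<nu> \<mu> where d: "\<And>f. f \<in> F \<Longrightarrow> \<nu> f \<in> N \<and> \<mu> f \<in> M \<and> f = \<nu> f \<otimes> \<mu> f" by metis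
    define E2 where "E2 = generate G (\<mu> ` F)"
    have E2: "subgroup E2 G" unfolding E2_def by (rule generate_is_subgroup) (use d Mc in auto)
    have E2c: "E2 \<subseteq> carrier G" by (rule subgroup.subset[OF E2])
    have "finite (\<mu> ` F)" "\<mu> ` F \<subseteq> M" using F(1) d by auto
    then have "bdd_in T E2" unfolding E2_def using M[unfolded loc_bounded_def] by blast
    then obtain K where K: "compactin T K" "E2 \<subseteq> K" by (auto simp: bdd_in_def)
    obtain F' where F': "finite F'" "F' \<subseteq> K" "K \<subseteq> F' <#> V"
      by (rule compact_finite_cover[OF K(1) compact_openD(1,3)[OF V(1)]])
    have F'c: "F' \<subseteq> carrier G" using F'(2) compactin_subset_carrier[OF K(1)] by blast
    have "F' <#> V \<subseteq> N <#> F'"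
    proof
      fix x assume "x \<in> F' <#> V"
      then obtain f v where fv: "f \<in> F'" "v \<in> V" "x = f \<otimes> v" by (auto simp: set_mult_iff)
      have c: "f \<in> carrier G" "v \<in> N" "v \<in> carrier G" using fv F'c V Nc by auto
      have "x = conjby f v \<otimes> f" unfolding fv(3) using c by (simp add: conjby_def m_assoc)
      then show "x \<in> N <#> F'" using cjN[OF c(1,2)] fv(1) by (simp add: set_multI)
    qed
    then have E2F: "E2 \<subseteq> N <#> F'" using K(2) F'(3) by blast
    have sg: "subgroup (N <#> E2) G"
      by (rule subgroup_set_mult(1)[OF is_group Ns E2]) (use cjN E2c in auto)
    have "F \<subseteq> N <#> E2"
    proof
      fix f assume f: "f \<in> F"
      have "\<mu> f \<in> E2" unfolding E2_def using f by (auto intro: generate.incl)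
      then have "\<nu> f \<otimes> \<mu> f \<in> N <#> E2" by (intro set_multI) (use d[OF f] in blast)+
      moreover have "\<nu> f \<otimes> \<mu> f = f" by (rule sym[OF conjunct2[OF conjunct2[OF d[OF f]]]])
      ultimately show "f \<in> N <#> E2" by (simp only:)
    qed
    then have "generate G F \<subseteq> N <#> E2" by (rule generate_subgroup_incl[OF _ sg])
    also have "N <#> E2 \<subseteq> N <#> F'"
    proof
      fix x assume "x \<in> N <#> E2"
      then obtain n e where ne: "n \<in> N" "e \<in> E2" "x = n \<otimes> e" by (auto simp: set_mult_iff)
      then obtain n' f where nf: "n' \<in> N" "f \<in> F'" "e = n' \<otimes> f" using E2F unfolding subset_iff set_mult_iff by blast
      have "x = (n \<otimes> n') \<otimes> f" using ne nf Nc F'c by (auto simp: m_assoc subset_iff)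
      then show "x \<in> N <#> F'" using subgroup.m_closed[OF Ns ne(1) nf(1)] nf(2) by (simp add: set_multI)
    qed
    finally have sub: "generate G F \<subseteq> N <#> F'" .
    obtain Y R where YR: "finite Y" "Y \<subseteq> N" "finite R" "R \<subseteq> carrier G" "generate G F \<subseteq> generate G Y <#> R"
      by (rule Schreier[OF F(1) Fc Ns F'(1) F'c sub])
    have "bdd_in T (generate G Y)" using N YR(1,2) by (auto simp: loc_bounded_def)
    moreover have "bdd_in T R" by (intro compactin_imp_bdd_in finite_imp_compactin) (use YR in auto)
    ultimately show ?thesis using bdd_in_subset[OF bdd_in_set_mult YR(5)] by blast
  qed
  then show ?thesis using normal_set_mult[OF Nn Mn] by (simp add: loc_bounded_def)
qed

end

context locally_compact_group
begin

lemma loc_bounded_of_regionally_compact: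
  assumes N: "N \<lhd> G" and rc: "regionally_compact (G\<lparr>carrier := N\<rparr>) (subtopology T N)"
  shows "loc_bounded N"
  unfolding loc_bounded_def
proof (intro conjI allI impI N)
  fix F assume F: "finite F" "F \<subseteq> N"
  have Ns: "subgroup N G" by (rule normal_imp_subgroup[OF N])
  have "relatively_compactin (subtopology T N) (generate (G\<lparr>carrier := N\<rparr>) F)"
    using rc F by (simp add: regionally_compact_def)
  then have "bdd_in (subtopology T N) (generate G F)"
    using relatively_compactin_iff_bdd_in[OF Hausdorff_space_subtopology[OF Hausdorff]]
      generate_consistent[OF F(2) Ns] by simp
  then show "bdd_in T (generate G F)" by (rule bdd_in_subtopologyD)
qed

lemma regionally_compact_of_loc_bounded:
  assumes N: "loc_bounded N" and o: "openin T N"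
  shows "regionally_compact (G\<lparr>carrier := N\<rparr>) (subtopology T N)"
proof -
  have Ns: "subgroup N G" using N normal_imp_subgroup by (auto simp: loc_bounded_def)
  have cl: "closedin T N" by (rule closedin_open_subgroup[OF Ns o])
  show ?thesis
    unfolding regionally_compact_def
  proof (intro conjI allI impI closed_subgroup_locally_compact_group Ns cl)
    fix F assume F: "finite F" "F \<subseteq> carrier (G\<lparr>carrier := N\<rparr>)"
    then have F': "F \<subseteq> N" by simp
    have "bdd_in T (generate G F)" using N F(1) F' by (simp add: loc_bounded_def)
    moreover have "generate G F \<subseteq> N" by (rule generate_subgroup_incl[OF F' Ns])
    ultimately show "relatively_compactin (subtopology T N) (generate (G\<lparr>carrier := N\<rparr>) F)"
      using relatively_compactin_iff_bdd_in[OF Hausdorff_space_subtopology[OF Hausdorff]]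
        generate_consistent[OF F' Ns] bdd_in_subtopology[OF cl] by simp
  qed
qed

text \<open>The locally bounded normal subgroups containing \<open>V\<close> are directed, since the
  product of two of them is again one, and their union is the radical. Containing the open group
  \<open>V\<close> makes it open, hence closed and locally compact, as regional compactness
  requires. A competitor \<open>N\<close> that does not contain \<open>V\<close> is absorbed through
  \<open>V <#> N\<close>.\<close>

lemma RC_radical_greatest:
  assumes V: "compact_open V" "V \<lhd> G"
  shows "loc_bounded (RC_radical G T)" "V \<subseteq> RC_radical G T" "\<And>N. loc_bounded N \<Longrightarrow> N \<subseteq> RC_radical G T"
proof -
  have lfV: "loc_bounded V"
    unfolding loc_bounded_def
  proof (intro conjI allI impI V(2))
    fix F assume F: "finite F" "F \<subseteq> V"
    have "generate G F \<subseteq> V" by (rule generate_subgroup_incl[OF F(2) compact_openD(1)[OF V(1)]])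
    then show "bdd_in T (generate G F)"
      using bdd_in_subset[OF compactin_imp_bdd_in[OF compact_openD(2)[OF V(1)]]] by blast
  qed
  define \<N> where "\<N> = {N. loc_bounded N \<and> V \<subseteq> N}"
  define R where "R = \<Union>\<N>"
  have Nn: "N \<lhd> G" if "loc_bounded N" for N using that by (simp add: loc_bounded_def)
  have Ns: "subgroup N G" if "loc_bounded N" for N using Nn[OF that] normal_imp_subgroup by blast
  have Nc: "N \<subseteq> carrier G" if "loc_bounded N" for N by (rule subgroup.subset[OF Ns[OF that]])
  have sub1: "N \<subseteq> N <#> M" if "loc_bounded N" "loc_bounded M" for N M
  proof
    fix x assume x: "x \<in> N"
    have "x \<otimes> \<one> \<in> N <#> M" by (rule set_multI[OF x subgroup.one_closed[OF Ns[OF that(2)]]])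
    then show "x \<in> N <#> M" using x Nc[OF that(1)] by auto
  qed
  have sub2: "M \<subseteq> N <#> M" if "loc_bounded N" "loc_bounded M" for N M
  proof
    fix x assume x: "x \<in> M"
    have "\<one> \<otimes> x \<in> N <#> M" by (rule set_multI[OF subgroup.one_closed[OF Ns[OF that(1)]] x])
    then show "x \<in> N <#> M" using x Nc[OF that(2)] by auto
  qed
  have V\<N>: "V \<in> \<N>" using lfV by (simp add: \<N>_def)
  have dir: "\<exists>K\<in>\<N>. N \<subseteq> K \<and> M \<subseteq> K" if "N \<in> \<N>" "M \<in> \<N>" for N M
  proof -
    have l: "loc_bounded N" "loc_bounded M" "V \<subseteq> N" using that by (auto simp: \<N>_def)
    have "N <#> M \<in> \<N>" using loc_bounded_set_mult[OF l(1,2) V(1) l(3)] sub1[OF l(1,2)] l(3) by (auto simp: \<N>_def)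
    then show ?thesis using sub1[OF l(1,2)] sub2[OF l(1,2)] by blast
  qed
  have finR: "\<exists>K\<in>\<N>. F \<subseteq> K" if "finite F" "F \<subseteq> R" for F
    using that
  proof (induction F)
    case empty
    then show ?case using V\<N> by blast
  next
    case (insert x F)
    then obtain K where K: "K \<in> \<N>" "F \<subseteq> K" by auto
    obtain M where M: "M \<in> \<N>" "x \<in> M" using insert.prems by (auto simp: R_def)
    obtain L where L: "L \<in> \<N>" "K \<subseteq> L" "M \<subseteq> L" using dir[OF K(1) M(1)] by blast
    then show ?case using K M by blast
  qed
  have inR: "x \<in> R" if "x \<in> N" "N \<in> \<N>" for x N using that by (auto simp: R_def)
  have Rn: "R \<lhd> G"
  proof (rule normal_invI)
    show "subgroup R G"
    proof
      show "R \<subseteq> carrier G" using Nc by (auto simp: R_def \<N>_def)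
      show "\<one> \<in> R" using inR[OF compact_open_one[OF V(1)] V\<N>] .
      show "inv x \<in> R" if "x \<in> R" for x
        using that subgroup.m_inv_closed[OF Ns] by (auto simp: R_def \<N>_def)
      show "x \<otimes> y \<in> R" if xy: "x \<in> R" "y \<in> R" for x y
      proof -
        obtain K where K: "K \<in> \<N>" "{x, y} \<subseteq> K" using finR[of "{x, y}"] xy by auto
        then have "x \<otimes> y \<in> K" using subgroup.m_closed[OF Ns] by (auto simp: \<N>_def)
        then show ?thesis using inR K by blast
      qed
    qed
    fix x h assume x: "x \<in> carrier G" and h: "h \<in> R"
    obtain K where K: "K \<in> \<N>" "h \<in> K" using h by (auto simp: R_def)
    then have "x \<otimes> h \<otimes> inv x \<in> K" using normal.inv_op_closed2[OF Nn x] by (auto simp: \<N>_def)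
    then show "x \<otimes> h \<otimes> inv x \<in> R" using inR K by blast
  qed
  have lfR: "loc_bounded R"
    unfolding loc_bounded_def
  proof (intro conjI allI impI Rn)
    fix F assume F: "finite F" "F \<subseteq> R"
    then obtain K where "K \<in> \<N>" "F \<subseteq> K" using finR by blast
    then show "bdd_in T (generate G F)" using F(1) by (auto simp: \<N>_def loc_bounded_def)
  qed
  have VR: "V \<subseteq> R" using V\<N> by (auto simp: R_def)
  have great: "N \<subseteq> R" if N: "loc_bounded N" for N
  proof -
    have "loc_bounded (V <#> N)" by (rule loc_bounded_set_mult[OF lfV N V(1)]) simp
    then have "V <#> N \<in> \<N>" using sub1[OF lfV N] by (simp add: \<N>_def)
    then show ?thesis using sub2[OF lfV N] by (auto simp: R_def)
  qed
  have oR: "openin T R"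
    by (rule openin_subgroup_of_open[OF normal_imp_subgroup[OF Rn] compact_openD(3)[OF V(1)] _ VR])
      (use compact_open_one[OF V(1)] in blast)
  have "RC_radical G T = R"
    unfolding RC_radical_def
  proof (rule Greatest_equality)
    show "R \<lhd> G \<and> regionally_compact (G\<lparr>carrier := R\<rparr>) (subtopology T R)"
      using Rn regionally_compact_of_loc_bounded[OF lfR oR] by simp
    show "N \<subseteq> R" if "N \<lhd> G \<and> regionally_compact (G\<lparr>carrier := N\<rparr>) (subtopology T N)" for N
      using great loc_bounded_of_regionally_compact that by blast
  qed
  then show "loc_bounded (RC_radical G T)" "V \<subseteq> RC_radical G T" "\<And>N. loc_bounded N \<Longrightarrow> N \<subseteq> RC_radical G T"
    using lfR VR great by auto
qed

end

section \<open>Independence modulo a normalized subgroup\<close>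
context group
begin

lemma commute_mod_sym:
  assumes U: "subgroup U G" and x: "x \<in> Normalizer U" and y: "y \<in> Normalizer U" and c: "conjby x y \<in> y <# U"
  shows "conjby y x \<in> x <# U"
proof -
  have Uc: "U \<subseteq> carrier G" by (rule subgroup.subset[OF U])
  have cc: "x \<in> carrier G" "y \<in> carrier G" using x y NormalizerD(2) by auto
  obtain u where u: "u \<in> U" "conjby x y = y \<otimes> u" using c by (auto simp: l_coset_iff)
  have uc: "u \<in> carrier G" using u Uc by blast
  have xy: "x \<otimes> y = y \<otimes> u \<otimes> x"
  proof -
    have "x \<otimes> y = conjby x y \<otimes> x" using cc by (simp add: conjby_def m_assoc)
    then show ?thesis by (simp only: u(2))
  qed
  have "inv u \<in> U" by (rule subgroup.m_inv_closed[OF U u(1)])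
  then have "conjby y (inv u) \<in> U" by (rule Normalizer_conjby[OF y])
  then have m: "conjby (inv x) (conjby y (inv u)) \<in> U"
    by (rule Normalizer_conjby[OF subgroup.m_inv_closed[OF subgroup_Normalizer[OF Uc] x]])
  have "y \<otimes> x = conjby y (inv u) \<otimes> (y \<otimes> u \<otimes> x)" using cc uc by (simp add: conjby_def group_nf)
  also have "\<dots> = conjby y (inv u) \<otimes> (x \<otimes> y)" by (simp only: xy)
  finally have yx: "y \<otimes> x = conjby y (inv u) \<otimes> (x \<otimes> y)" .
  have "conjby y x = (y \<otimes> x) \<otimes> inv y" by (simp add: conjby_def)
  also have "\<dots> = x \<otimes> conjby (inv x) (conjby y (inv u))" unfolding yx using cc uc by (simp add: conjby_def group_nf)
  finally show ?thesis using m unfolding l_coset_iff by blast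
qed

lemma subgroup_commutes_mod_self:
  assumes U: "subgroup U G" and y: "y \<in> Normalizer U" and u: "u \<in> U"
  shows "conjby u y \<in> y <# U"
proof -
  have Uc: "U \<subseteq> carrier G" by (rule subgroup.subset[OF U])
  have c: "y \<in> carrier G" "u \<in> carrier G" using NormalizerD(2)[OF y] u Uc by auto
  have "conjby (inv y) u \<in> U" by (rule Normalizer_conjby[OF subgroup.m_inv_closed[OF subgroup_Normalizer[OF Uc] y] u])
  then have "conjby (inv y) u \<otimes> inv u \<in> U" using subgroup.m_closed[OF U] subgroup.m_inv_closed[OF U u] by blast
  moreover have "conjby u y = y \<otimes> (conjby (inv y) u \<otimes> inv u)" using c by (simp add: conjby_def group_nf)
  ultimately show ?thesis unfolding l_coset_iff by blast
qed

end

text \<open>For a family that commutes modulo \<open>U\<close>, linear independence modulo \<open>U\<close> can be expressed without exponent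
  vectors: no positive power of a member lies in the subgroup generated by \<open>U\<close> and its predecessors.\<close>

definition (in group) indep_mod :: "'a set \<Rightarrow> nat \<Rightarrow> (nat \<Rightarrow> 'a) \<Rightarrow> bool" where
  "indep_mod U n a \<longleftrightarrow> (\<forall>i<n. a i \<in> Normalizer U) \<and> (\<forall>i<n. \<forall>j<n. conjby (a i) (a j) \<in> a j <# U) \<and>
     (\<forall>i<n. \<forall>m>0::nat. a i [^] m \<notin> generate G (a ` {..<i} \<union> U))"

section \<open>The free abelian quotient attached to an independent family\<close>

locale indep_mod_family = group G for G (structure) +
  fixes U :: "'a set" and n :: nat and a :: "nat \<Rightarrow> 'a"
  assumes U: "subgroup U G" and indep_mod: "indep_mod U n a"
begin

definition "A = generate G (a ` {..<n} \<union> U)"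

lemma Uc: "U \<subseteq> carrier G" by (rule subgroup.subset[OF U])

lemma aN: "i < n \<Longrightarrow> a i \<in> Normalizer U" using indep_mod by (simp add: indep_mod_def)

lemma ac: "i < n \<Longrightarrow> a i \<in> carrier G" using NormalizerD(2)[OF aN] .

lemma comm: "i < n \<Longrightarrow> j < n \<Longrightarrow> conjby (a i) (a j) \<in> a j <# U" using indep_mod by (simp add: indep_mod_def)

lemma free: "i < n \<Longrightarrow> m > 0 \<Longrightarrow> a i [^] (m::nat) \<notin> generate G (a ` {..<i} \<union> U)"
  using indep_mod by (simp add: indep_mod_def)

lemma gen_carrier: "k \<le> n \<Longrightarrow> a ` {..<k} \<union> U \<subseteq> carrier G"
  using ac Uc by fastforce

lemma subgroup_A: "subgroup A G"
  unfolding A_def by (rule generate_is_subgroup[OF gen_carrier]) simp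

lemma A_carrier: "A \<subseteq> carrier G" by (rule subgroup.subset[OF subgroup_A])

lemma UA: "U \<subseteq> A" and aA: "i < n \<Longrightarrow> a i \<in> A"
  by (auto simp: A_def intro: generate.incl)

lemma A_Normalizer: "A \<subseteq> Normalizer U"
  unfolding A_def
  by (rule generate_subgroup_incl[OF _ subgroup_Normalizer[OF Uc]]) (use aN subgroup_subset_Normalizer[OF U] in auto)

text \<open>Commutation modulo \<open>U\<close> is extended from generators to \<open>A\<close> in
  one argument at a time: \<open>subgroup_commute_mod\<close> handles the conjugating element, and
  \<open>commute_mod_sym\<close> exchanges the two arguments.\<close>

lemma A_commute:
  assumes x: "x \<in> A" and y: "y \<in> A" shows "conjby x y \<in> y <# U"
proof -
  have 1: "A \<subseteq> {g \<in> Normalizer U. conjby g (a j) \<in> a j <# U}" if j: "j < n" for j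
    unfolding A_def
  proof (rule generate_subgroup_incl[OF _ subgroup_commute_mod[OF U ac[OF j]]])
    show "a ` {..<n} \<union> U \<subseteq> {g \<in> Normalizer U. conjby g (a j) \<in> a j <# U}"
      using aN comm j subgroup_subset_Normalizer[OF U] subgroup_commutes_mod_self[OF U aN[OF j]] by auto
  qed
  have xN: "x \<in> Normalizer U" using x A_Normalizer by blast
  have "A \<subseteq> {g \<in> Normalizer U. conjby g x \<in> x <# U}"
    unfolding A_def
  proof (rule generate_subgroup_incl[OF _ subgroup_commute_mod[OF U NormalizerD(2)[OF xN]]])
    have "conjby (a j) x \<in> x <# U" if j: "j < n" for j
      using commute_mod_sym[OF U xN aN[OF j]] 1[OF j] x by blast
    then show "a ` {..<n} \<union> U \<subseteq> {g \<in> Normalizer U. conjby g x \<in> x <# U}"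
      using aN subgroup_subset_Normalizer[OF U] subgroup_commutes_mod_self[OF U xN] by auto
  qed
  then have "conjby y x \<in> x <# U" using y by blast
  then show ?thesis using commute_mod_sym[OF U _ xN] y A_Normalizer by blast
qed

abbreviation "GA \<equiv> G\<lparr>carrier := A\<rparr>"

lemma group_GA: "group GA" by (rule subgroup_imp_group[OF subgroup_A])

lemma normal_U: "U \<lhd> GA"
proof -
  interpret GA: group GA by (rule group_GA)
  show ?thesis
  proof (rule GA.normal_invI)
    show "subgroup U GA" by (rule subgroup_incl[OF U subgroup_A UA])
    fix x h assume x: "x \<in> carrier GA" and h: "h \<in> U"
    then have "x \<in> Normalizer U" using A_Normalizer by auto
    then have "conjby x h \<in> U" using h by (rule Normalizer_conjby)
    then show "x \<otimes>\<^bsub>GA\<^esub> h \<otimes>\<^bsub>GA\<^esub> inv\<^bsub>GA\<^esub> x \<in> U" using x subgroup_A by (simp add: conjby_def)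
  qed
qed

definition "Q = GA Mod U"
definition "\<pi> x = U #> x"

lemma carrier_Q: "carrier Q = \<pi> ` A"
  by (auto simp: Q_def FactGroup_def RCOSETS_def \<pi>_def)

lemma hom_\<pi>: "\<pi> \<in> hom GA Q"
proof -
  interpret N: normal U GA by (rule normal_U)
  show ?thesis using N.r_coset_hom_Mod by (simp add: Q_def \<pi>_def[abs_def])
qed

lemma group_Q: "group Q"
  unfolding Q_def by (rule normal.factorgroup_is_group[OF normal_U])

lemma group_hom_\<pi>: "group_hom GA Q \<pi>"
  using group_GA group_Q hom_\<pi> by (simp add: group_hom_def group_hom_axioms_def)

lemma \<pi>_mult: "x \<in> A \<Longrightarrow> y \<in> A \<Longrightarrow> \<pi> (x \<otimes> y) = \<pi> x \<otimes>\<^bsub>Q\<^esub> \<pi> y"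
  using hom_mult[OF hom_\<pi>, of x y] by simp

lemma \<pi>_eq_iff:
  assumes c: "x \<in> carrier G" "y \<in> carrier G" shows "\<pi> x = \<pi> y \<longleftrightarrow> x \<otimes> inv y \<in> U"
proof -
  have xy: "x \<otimes> inv y \<in> carrier G" using c by simp
  show ?thesis unfolding \<pi>_def
  proof
    assume "U #> x = U #> y"
    from coset_mult_inv2[OF this c Uc] show "x \<otimes> inv y \<in> U" by (rule coset_join1[OF _ xy U])
  next
    assume "x \<otimes> inv y \<in> U"
    from coset_join2[OF xy U this] show "U #> x = U #> y" by (rule coset_mult_inv1[OF _ c Uc])
  qed
qed

lemma one_Q: "\<one>\<^bsub>Q\<^esub> = \<pi> \<one>"
  using Uc by (simp add: Q_def FactGroup_def \<pi>_def)

lemma \<pi>_one_iff: "x \<in> carrier G \<Longrightarrow> \<pi> x = \<one>\<^bsub>Q\<^esub> \<longleftrightarrow> x \<in> U"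
  using \<pi>_eq_iff[of x \<one>] by (simp add: one_Q)

lemma comm_group_Q: "comm_group Q"
proof (rule group.group_comm_groupI[OF group_Q])
  fix X Y assume "X \<in> carrier Q" "Y \<in> carrier Q"
  then obtain x y where xy: "x \<in> A" "y \<in> A" "X = \<pi> x" "Y = \<pi> y" by (auto simp: carrier_Q)
  have c: "x \<in> carrier G" "y \<in> carrier G" using xy A_carrier by auto
  obtain u where u: "u \<in> U" "conjby x y = y \<otimes> u" using A_commute[OF xy(1,2)] by (auto simp: l_coset_iff)
  have uc: "u \<in> carrier G" using u Uc by blast
  have "x \<otimes> y = conjby x y \<otimes> x" using c by (simp add: conjby_def m_assoc)
  then have "(x \<otimes> y) \<otimes> inv (y \<otimes> x) = conjby y u" unfolding u(2) using c uc by (simp add: conjby_def group_nf)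
  moreover have "conjby y u \<in> U" using Normalizer_conjby[OF _ u(1)] xy(2) A_Normalizer by blast
  ultimately have "\<pi> (x \<otimes> y) = \<pi> (y \<otimes> x)" using c by (subst \<pi>_eq_iff) auto
  then show "X \<otimes>\<^bsub>Q\<^esub> Y = Y \<otimes>\<^bsub>Q\<^esub> X" using xy by (simp add: \<pi>_mult)
qed

text \<open>The basis is indexed by its own elements, to match the index sets in
  \<open>free_abelian_subgroup_rank\<close>.\<close>

abbreviation "X \<equiv> (\<lambda>i. \<pi> (a i)) ` {..<n}"
abbreviation "F \<equiv> free_Abelian_group X"

lemma inj_x: "inj_on (\<lambda>i. \<pi> (a i)) {..<n}"
proof (rule linorder_inj_onI)
  fix j i :: nat assume ij: "j < i" "j \<in> {..<n}" "i \<in> {..<n}"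
  have c: "a i \<in> carrier G" "a j \<in> carrier G" using ij ac by auto
  show "\<pi> (a j) \<noteq> \<pi> (a i)"
  proof
    assume "\<pi> (a j) = \<pi> (a i)"
    then have "a i \<otimes> inv (a j) \<in> U" using \<pi>_eq_iff c by metis
    then have "(a i \<otimes> inv (a j)) \<otimes> a j \<in> generate G (a ` {..<i} \<union> U)"
      using ij(1) by (intro generate.eng generate.incl) auto
    then have "a i [^] (1::nat) \<in> generate G (a ` {..<i} \<union> U)" using c by (simp add: m_assoc)
    then show False using free[of i 1] ij(3) by simp
  qed
qed auto

lemma card_X: "finite X" "card X = n"
  using card_image[OF inj_x] by auto

text \<open>The universal property of the free abelian group supplies the map, and the generators of
  \<open>A\<close> make it surjective. A nontrivial relation would express a nonzero power of its
  member of largest index through \<open>U\<close> and earlier members, against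
  independence.\<close>

lemma free_quotient: obtains h where "h \<in> iso F Q"
proof -
  interpret Q: comm_group Q by (rule comm_group_Q)
  have XQ: "id ` X \<subseteq> carrier Q" using aA by (auto simp: carrier_Q)
  obtain h where h: "h \<in> hom F Q" "\<And>x. x \<in> X \<Longrightarrow> h (frag_of x) = id x"
    by (rule Q.free_Abelian_group_universal[OF XQ]) blast
  interpret h: group_hom F Q h by (simp add: group_hom_def group_hom_axioms_def h(1) group_Q)
  interpret p: group_hom GA Q \<pi> by (rule group_hom_\<pi>)
  have ha: "h (frag_of (\<pi> (a i))) = \<pi> (a i)" if "i < n" for i using h(2) that by simp
  have surj: "A \<subseteq> {x \<in> A. \<pi> x \<in> h ` carrier F}"
  proof -
    have img: "subgroup (h ` carrier F) Q" by (rule h.img_is_subgroup)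
    have "x \<in> A \<and> \<pi> x \<in> h ` carrier F" if "x \<in> A" for x
      using that[unfolded A_def]
    proof induction
      case one
      then show ?case using subgroup.one_closed[OF subgroup_A] subgroup.one_closed[OF img] by (simp add: one_Q)
    next
      case (incl x)
      then consider i where "i < n" "x = a i" | "x \<in> U" by auto
      then show ?case
      proof cases
        case 1
        have "\<pi> (a i) \<in> h ` carrier F" using ha[OF 1(1)] 1(1) by (intro image_eqI[of _ _ "frag_of (\<pi> (a i))"]) auto
        then show ?thesis using 1 aA by simp
      next
        case 2
        then have "\<pi> x = \<one>\<^bsub>Q\<^esub>" using \<pi>_one_iff Uc by blast
        then show ?thesis using 2 UA subgroup.one_closed[OF img] by auto
      qed
    next
      case (inv x)
      have *: "x \<in> A \<and> \<pi> x \<in> h ` carrier F"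
      proof -
        consider i where "i < n" "x = a i" | "x \<in> U" using inv by auto
        then show ?thesis
        proof cases
          case 1
          have "\<pi> (a i) \<in> h ` carrier F" using ha[OF 1(1)] 1(1) by (intro image_eqI[of _ _ "frag_of (\<pi> (a i))"]) auto
          then show ?thesis using 1 aA by simp
        next
          case 2
          then have "\<pi> x = \<one>\<^bsub>Q\<^esub>" using \<pi>_one_iff Uc by blast
          then show ?thesis using 2 UA subgroup.one_closed[OF img] by auto
        qed
      qed
      then have "\<pi> (inv x) = inv\<^bsub>Q\<^esub> (\<pi> x)" using p.hom_inv[of x] subgroup_A by simp
      then show ?case using * subgroup.m_inv_closed[OF subgroup_A] subgroup.m_inv_closed[OF img] by simp
    next
      case (eng x y)
      then show ?case using subgroup.m_closed[OF subgroup_A] subgroup.m_closed[OF img] by (simp add: \<pi>_mult)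
    qed
    then show ?thesis by blast
  qed
  have inj: "c = 0" if c: "Poly_Mapping.keys c \<subseteq> X" and hc: "h c = \<one>\<^bsub>Q\<^esub>" for c
  proof (rule ccontr)
    assume "c \<noteq> 0"
    then have ne: "Poly_Mapping.keys c \<noteq> {}" by simp
    define I where "I = {i. i < n \<and> \<pi> (a i) \<in> Poly_Mapping.keys c}"
    obtain y where y: "y \<in> Poly_Mapping.keys c" using ne by blast
    then obtain j where "j < n" "y = \<pi> (a j)" using c by auto
    then have "j \<in> I" using y by (simp add: I_def)
    then have I: "finite I" "I \<noteq> {}" by (auto simp: I_def)
    \<comment> \<open>With the largest index in the support, all remaining terms of \<open>c\<close>
      come from predecessors of \<open>a i\<close>, which is the situation that \<open>free\<close>
      excludes.\<close>
    define i where "i = Max I"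
    have iI: "i \<in> I" unfolding i_def by (rule Max_in[OF I])
    have i: "i < n" "\<pi> (a i) \<in> Poly_Mapping.keys c" using iI by (auto simp: I_def)
    define e where "e = Poly_Mapping.lookup c (\<pi> (a i))"
    have e: "e \<noteq> 0" using i(2) by (simp add: e_def in_keys_iff)
    define x where "x = \<pi> (a i)"
    define c' where "c' = c - frag_cmul e (frag_of x)"
    have lc': "Poly_Mapping.lookup c' y = Poly_Mapping.lookup c y - (if y = x then e else 0)" for y
      by (simp add: c'_def lookup_minus)
    have keys': "Poly_Mapping.keys c' \<subseteq> (\<lambda>j. \<pi> (a j)) ` {..<i}"
    proof
      fix y assume y: "y \<in> Poly_Mapping.keys c'"
      then have "Poly_Mapping.lookup c' y \<noteq> 0" by (simp add: in_keys_iff)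
      then have yx: "y \<noteq> x" "y \<in> Poly_Mapping.keys c"
        using lc'[of y] by (auto simp: e_def x_def in_keys_iff split: if_splits)
      then obtain j where j: "j < n" "y = \<pi> (a j)" using c by auto
      then have "j \<in> I" using yx by (simp add: I_def)
      then have "j \<le> i" unfolding i_def using I(1) by simp
      moreover have "j \<noteq> i" using yx(1) j by (auto simp: x_def)
      ultimately show "y \<in> (\<lambda>j. \<pi> (a j)) ` {..<i}" using j by auto
    qed
    have subX: "(\<lambda>j. \<pi> (a j)) ` {..<i} \<subseteq> X" using i(1) by auto
    define Gi where "Gi = generate G (a ` {..<i} \<union> U)"
    have Gi: "subgroup Gi G" unfolding Gi_def by (rule generate_is_subgroup[OF gen_carrier]) (use i in simp)
    have GiA: "Gi \<subseteq> A" unfolding Gi_def A_def by (rule mono_generate) (use i in auto)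
    have "\<exists>b\<in>Gi. h c' = \<pi> b"
    proof (rule free_Abelian_group_induct[OF keys'])
      show "\<exists>b\<in>Gi. h 0 = \<pi> b" using h.hom_one subgroup.one_closed[OF Gi] by (auto simp: one_Q)
      show "\<exists>b\<in>Gi. h (frag_of y) = \<pi> b" if y: "y \<in> (\<lambda>j. \<pi> (a j)) ` {..<i}" for y
      proof -
        obtain j where j: "j < i" "y = \<pi> (a j)" using y by auto
        then have "h (frag_of y) = \<pi> (a j)" using ha i(1) by simp
        moreover have "a j \<in> Gi" unfolding Gi_def using j by (auto intro: generate.incl)
        ultimately show ?thesis by blast
      qed
      show "\<exists>b\<in>Gi. h (y - z) = \<pi> b"
        if yz: "Poly_Mapping.keys y \<subseteq> (\<lambda>j. \<pi> (a j)) ` {..<i}" "Poly_Mapping.keys z \<subseteq> (\<lambda>j. \<pi> (a j)) ` {..<i}"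
          "\<exists>b\<in>Gi. h y = \<pi> b" "\<exists>b\<in>Gi. h z = \<pi> b" for y z
      proof -
        obtain b b' where b: "b \<in> Gi" "h y = \<pi> b" "b' \<in> Gi" "h z = \<pi> b'" using yz(3,4) by blast
        have F: "y \<in> carrier F" "z \<in> carrier F" using yz(1,2) subX by (auto simp del: image_subset_iff)
        have "h (y - z) = h (y \<otimes>\<^bsub>F\<^esub> inv\<^bsub>F\<^esub> z)" using F by simp
        also have "\<dots> = h y \<otimes>\<^bsub>Q\<^esub> inv\<^bsub>Q\<^esub> (h z)" using h.hom_mult[OF F(1) h.G.inv_closed[OF F(2)]] h.hom_inv[OF F(2)] by simp
        also have "\<dots> = \<pi> (b \<otimes> inv b')"
        proof -
          have "b' \<in> A" "b \<in> A" using b GiA by auto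
          moreover have "inv b' \<in> A" using subgroup.m_inv_closed[OF subgroup_A] b(3) GiA by blast
          ultimately show ?thesis unfolding b(2,4) using p.hom_inv[of b'] subgroup_A by (simp add: \<pi>_mult)
        qed
        finally show ?thesis using subgroup.m_closed[OF Gi b(1) subgroup.m_inv_closed[OF Gi b(3)]] by blast
      qed
    qed
    then obtain b where b: "b \<in> Gi" "h c' = \<pi> b" by blast
    have bA: "b \<in> A" using b GiA by blast
    have bc: "b \<in> carrier G" using bA A_carrier by blast
    have c'F: "c' \<in> carrier F" using keys' subX by (auto simp del: image_subset_iff)
    have xF: "frag_of x \<in> carrier F" using i by (auto simp: x_def)
    have aiA: "a i \<in> A" by (rule aA[OF i(1)])
    have powA: "a i [^] e \<in> A" by (rule subgroup_int_pow_closed[OF subgroup_A aiA])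
    have "c = c' \<otimes>\<^bsub>F\<^esub> (frag_of x [^]\<^bsub>F\<^esub> e)" using i by (simp add: c'_def x_def)
    then have "h c = h c' \<otimes>\<^bsub>Q\<^esub> (h (frag_of x) [^]\<^bsub>Q\<^esub> e)"
      using h.hom_mult[OF c'F h.G.int_pow_closed[OF xF]] h.hom_int_pow[OF xF] by simp
    also have "h (frag_of x) = \<pi> (a i)" using ha[OF i(1)] by (simp add: x_def)
    also have "\<pi> (a i) [^]\<^bsub>Q\<^esub> e = \<pi> (a i [^] e)"
      using p.hom_int_pow[of "a i" e] aiA int_pow_consistent[OF subgroup_A aiA] by simp
    also have "h c' \<otimes>\<^bsub>Q\<^esub> \<pi> (a i [^] e) = \<pi> (b \<otimes> a i [^] e)" unfolding b(2) by (rule \<pi>_mult[OF bA powA, symmetric])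
    finally have "\<pi> (b \<otimes> a i [^] e) = \<one>\<^bsub>Q\<^esub>" using hc by simp
    then have "b \<otimes> a i [^] e \<in> U" using \<pi>_one_iff bc ac[OF i(1)] by simp
    then have "b \<otimes> a i [^] e \<in> Gi" unfolding Gi_def by (auto intro: generate.incl)
    then have "inv b \<otimes> (b \<otimes> a i [^] e) \<in> Gi" using subgroup.m_closed[OF Gi subgroup.m_inv_closed[OF Gi b(1)]] by blast
    then have pow: "a i [^] e \<in> Gi" using bc ac[OF i(1)] by simp
    \<comment> \<open>\<open>free\<close> concerns positive powers, so a negative exponent is
      treated by inversion.\<close>
    obtain k :: nat where k: "e = int k \<or> e = - int k" by (metis int_cases2)
    have "a i [^] k \<in> Gi"
    proof (cases "e = int k")
      case True
      show ?thesis using pow unfolding True int_pow_int .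
    next
      case False
      then have ek: "e = - int k" using k by blast
      have "inv (a i [^] k) \<in> Gi" using pow unfolding ek int_pow_neg[OF ac[OF i(1)]] int_pow_int .
      from subgroup.m_inv_closed[OF Gi this] show ?thesis using ac[OF i(1)] by simp
    qed
    moreover have "k > 0" using e k by auto
    ultimately show False using free[OF i(1)] by (simp add: Gi_def)
  qed
  have "h \<in> iso F Q"
  proof (rule isoI[OF h(1)])
    have "inj_on h (carrier F)"
      unfolding h.inj_on_one_iff using inj by simp
    moreover have "h ` carrier F = carrier Q"
    proof
      show "h ` carrier F \<subseteq> carrier Q" using h.hom_closed by blast
      show "carrier Q \<subseteq> h ` carrier F" unfolding carrier_Q using surj by blast
    qed
    ultimately show "bij_betw h (carrier F) (carrier Q)" by (simp add: bij_betw_def)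
  qed
  then show thesis by (rule that)
qed

lemma Q_iso_free: "Q \<cong> F"
proof -
  obtain h where "h \<in> iso F Q" by (rule free_quotient)
  then have "F \<cong> Q" by (rule is_isoI)
  then show ?thesis by (rule group.iso_sym[rotated]) simp
qed

lemma rank_Q: "enat n \<le> free_abelian_subgroup_rank Q"
proof -
  interpret Q: group Q by (rule group_Q)
  have "subgroup (carrier Q) Q" by (rule Q.subgroup_self)
  moreover have "Q\<lparr>carrier := carrier Q\<rparr> \<cong> F" using Q_iso_free by simp
  ultimately have "ecard X \<in> {ecard X | (B :: 'a set set) (X :: 'a set set).
            subgroup B Q \<and> Q\<lparr>carrier := B\<rparr> \<cong> free_Abelian_group X}" by blast
  then have "ecard X \<le> free_abelian_subgroup_rank Q" unfolding free_abelian_subgroup_rank_def by (rule Sup_upper)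
  then show ?thesis using card_X by (simp add: ecard_def)
qed

text \<open>Free abelian groups have no torsion. This keeps the radical of \<open>A\<close> from
  being larger than \<open>U\<close>.\<close>

lemma torsion_free:
  assumes x: "x \<in> A" and m: "m > 0" and xm: "x [^] (m::nat) \<in> U"
  shows "x \<in> U"
proof -
  obtain h where h: "h \<in> iso F Q" by (rule free_quotient)
  interpret h: group_hom F Q h using h by (simp add: group_hom_def group_hom_axioms_def group_Q iso_def)
  interpret p: group_hom GA Q \<pi> by (rule group_hom_\<pi>)
  have bij: "bij_betw h (carrier F) (carrier Q)" using h by (simp add: iso_def)
  have xc: "x \<in> carrier G" using x A_carrier by blast
  have "\<pi> x \<in> h ` carrier F" using bij x by (auto simp: bij_betw_def carrier_Q)
  then obtain c where c: "c \<in> carrier F" "\<pi> x = h c" by blast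
  have "h (c [^]\<^bsub>F\<^esub> m) = \<pi> x [^]\<^bsub>Q\<^esub> m" using h.hom_nat_pow[OF c(1)] c(2) by simp
  also have "\<dots> = \<pi> (x [^] m)" using p.hom_nat_pow[of x m] x by (simp add: nat_pow_consistent[symmetric])
  also have "\<dots> = \<one>\<^bsub>Q\<^esub>" using \<pi>_one_iff xm xc by simp
  also have "\<dots> = h \<one>\<^bsub>F\<^esub>" by (rule h.hom_one[symmetric])
  finally have "h (c [^]\<^bsub>F\<^esub> m) = h \<one>\<^bsub>F\<^esub>" .
  moreover have "c [^]\<^bsub>F\<^esub> m \<in> carrier F" using h.G.nat_pow_closed[OF c(1)] .
  ultimately have "c [^]\<^bsub>F\<^esub> m = \<one>\<^bsub>F\<^esub>" using bij h.G.one_closed unfolding bij_betw_def inj_on_def by blast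
  then have z: "frag_cmul (int m) c = 0" by simp
  then have "c = 0" using m by simp
  then have "\<pi> x = h \<one>\<^bsub>F\<^esub>" using c(2) by simp
  then have "\<pi> x = \<one>\<^bsub>Q\<^esub>" by (simp only: h.hom_one)
  then show ?thesis using \<pi>_one_iff[OF xc] by simp
qed

end

section \<open>Bounded conjugacy rank and thin families\<close>
text \<open>No value lies strictly between \<open>n - 1\<close> and \<open>n\<close>, so values
  below \<open>n\<close> have a supremum below \<open>n\<close>. For \<open>n = 0\<close> the empty
  set would be a counterexample.\<close>

lemma enat_le_Sup:
  assumes "0 < n" "enat n \<le> Sup S" shows "\<exists>s\<in>S. enat n \<le> s"
proof (rule ccontr)
  assume "\<not> ?thesis"
  then have lt: "s < enat n" if "s \<in> S" for s using that by (auto simp: not_le)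
  have "s \<le> enat (n - 1)" if "s \<in> S" for s
    using lt[OF that] by (cases s) auto
  then have "Sup S \<le> enat (n - 1)" by (rule Sup_least)
  then have "enat n \<le> enat (n - 1)" using assms(2) by (rule order_trans[rotated])
  then show False using assms(1) by simp
qed

definition (in topological_group) open_finite_index :: "'a set \<Rightarrow> bool" where
  "open_finite_index P \<longleftrightarrow> subgroup P G \<and> openin T P \<and> finite (rcosets P)"

text \<open>The BC-centralizer refers to the group generated by the members without
  \<open>U\<close>. The clause thus survives a change of the compact open subgroup, as happens
  between \<open>H\<close> and \<open>G\<close>.\<close>

definition (in topological_group) thin_family :: "nat \<Rightarrow> bool" where
  "thin_family n \<longleftrightarrow> (\<exists>U a. compact_open U \<and> indep_mod U n a \<and> open_finite_index (BC_centralizer G T (generate G (a ` {..<n}))))"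

lemma (in group) rcosets_mono_finite:
  assumes P: "subgroup P G" and Q: "subgroup Q G" and PQ: "P \<subseteq> Q" and fin: "finite (rcosets P)"
  shows "finite (rcosets Q)"
proof -
  have Pc: "P \<subseteq> carrier G" and Qc: "Q \<subseteq> carrier G" using subgroup.subset[OF P] subgroup.subset[OF Q] by auto
  have "rcosets Q \<subseteq> (\<lambda>C. Q <#> C) ` (rcosets P)"
  proof
    fix D assume "D \<in> rcosets Q"
    then obtain x where x: "x \<in> carrier G" "D = Q #> x" by (auto simp: RCOSETS_def)
    have "Q <#> P = Q"
    proof
      show "Q <#> P \<subseteq> Q" using subgroup.m_closed[OF Q] PQ by (auto simp: set_mult_iff subset_iff)
      show "Q \<subseteq> Q <#> P"
      proof
        fix q assume q: "q \<in> Q"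
        have "q \<otimes> \<one> \<in> Q <#> P" by (rule set_multI[OF q subgroup.one_closed[OF P]])
        then show "q \<in> Q <#> P" using q Qc by auto
      qed
    qed
    then have "D = Q <#> (P #> x)" using x Pc Qc by (simp add: r_coset_eq_set_mult set_mult_assoc[symmetric])
    moreover have "P #> x \<in> rcosets P" using x by (auto simp: RCOSETS_def)
    ultimately show "D \<in> (\<lambda>C. Q <#> C) ` (rcosets P)" by blast
  qed
  then show ?thesis using fin finite_surj by blast
qed

lemma (in group) finite_index_power:
  assumes P: "subgroup P G" and fin: "finite (rcosets P)" and c: "c \<in> carrier G"
  obtains p :: nat where "p > 0" "c [^] p \<in> P"
proof -
  have Pc: "P \<subseteq> carrier G" by (rule subgroup.subset[OF P])
  have "(\<lambda>k::nat. P #> (c [^] k)) ` UNIV \<subseteq> rcosets P" using c by (auto simp: RCOSETS_def)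
  then have "finite (range (\<lambda>k::nat. P #> (c [^] k)))" using fin finite_subset by blast
  then have "\<not> inj (\<lambda>k::nat. P #> (c [^] k))" using finite_imageD by blast
  then obtain k l :: nat where kl: "k < l" "P #> (c [^] k) = P #> (c [^] l)"
    unfolding inj_def by (metis linorder_neqE_nat)
  have "c [^] l \<otimes> inv (c [^] k) \<in> P"
    by (rule coset_join1[OF coset_mult_inv2[OF kl(2)[symmetric]]]) (use c P Pc in auto)
  moreover have "c [^] l = c [^] (l - k) \<otimes> c [^] k" using kl(1) c by (simp add: nat_pow_mult)
  ultimately have "c [^] (l - k) \<in> P" using c by (simp add: m_assoc)
  then show thesis using that[of "l - k"] kl(1) by simp
qed

context hausdorff_group
begin

lemma BC_centralizer_iff:
  "g \<in> BC_centralizer G T A \<longleftrightarrow> g \<in> carrier G \<and> bdd_in T ((\<lambda>h. conjby h g) ` A)"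
proof -
  have "{h \<otimes> g \<otimes> inv h | h. h \<in> A} = (\<lambda>h. conjby h g) ` A" by (auto simp: conjby_def)
  then show ?thesis unfolding BC_centralizer_def by (simp add: relatively_compactin_iff_bdd_in[OF Hausdorff'])
qed

lemma subgroup_BC_centralizer:
  assumes A: "A \<subseteq> carrier G" shows "subgroup (BC_centralizer G T A) G"
proof
  let ?P = "BC_centralizer G T A"
  show "?P \<subseteq> carrier G" by (auto simp: BC_centralizer_iff)
  have "(\<lambda>h. conjby h \<one>) ` A \<subseteq> {\<one>}" using A by auto
  then show "\<one> \<in> ?P" unfolding BC_centralizer_iff using bdd_in_subset[OF bdd_in_singleton[OF one_closed]] by blast
  show "x \<otimes> y \<in> ?P" if xy: "x \<in> ?P" "y \<in> ?P" for x y
  proof -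
    have "(\<lambda>h. conjby h (x \<otimes> y)) ` A \<subseteq> (\<lambda>h. conjby h x) ` A <#> (\<lambda>h. conjby h y) ` A"
      using xy A by (auto simp: conjby_mult BC_centralizer_iff subset_iff intro!: set_multI)
    then show ?thesis using xy bdd_in_subset[OF bdd_in_set_mult] unfolding BC_centralizer_iff by blast
  qed
  show "inv x \<in> ?P" if x: "x \<in> ?P" for x
  proof -
    have "(\<lambda>h. conjby h (inv x)) ` A \<subseteq> (\<lambda>x. inv x) ` (\<lambda>h. conjby h x) ` A"
      using x A by (auto simp: conjby_inv BC_centralizer_iff subset_iff)
    then show ?thesis using x bdd_in_subset[OF bdd_in_inv_image] unfolding BC_centralizer_iff by blast
  qed
qed

lemma BC_centralizer_antimono: "A \<subseteq> B \<Longrightarrow> BC_centralizer G T B \<subseteq> BC_centralizer G T A"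
  unfolding subset_iff BC_centralizer_iff using bdd_in_subset by (metis image_mono subset_iff)

text \<open>Conjugating further by an element of \<open>U\<close> changes an orbit only by a factor
  from \<open>U\<close> on the left and one from its inverses on the right, both bounded.\<close>

lemma BC_centralizer_set_mult:
  assumes U: "compactin T U" and A: "A \<subseteq> carrier G"
  shows "BC_centralizer G T A \<subseteq> BC_centralizer G T (U <#> A)"
proof
  fix g assume g: "g \<in> BC_centralizer G T A"
  have Uc: "U \<subseteq> carrier G" by (rule compactin_subset_carrier[OF U])
  have gc: "g \<in> carrier G" using g by (simp add: BC_centralizer_iff)
  have "(\<lambda>h. conjby h g) ` (U <#> A) \<subseteq> U <#> (\<lambda>h. conjby h g) ` A <#> (\<lambda>x. inv x) ` U"
  proof
    fix y assume "y \<in> (\<lambda>h. conjby h g) ` (U <#> A)"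
    then obtain u h where uh: "u \<in> U" "h \<in> A" "y = conjby (u \<otimes> h) g" by (auto simp: set_mult_iff)
    have "y = u \<otimes> conjby h g \<otimes> inv u" unfolding uh(3) using uh Uc A gc by (auto simp: conjby_def group_nf subset_iff)
    then show "y \<in> U <#> (\<lambda>h. conjby h g) ` A <#> (\<lambda>x. inv x) ` U" using uh by (auto intro!: set_multI)
  qed
  moreover have "bdd_in T (U <#> (\<lambda>h. conjby h g) ` A <#> (\<lambda>x. inv x) ` U)"
    using g by (intro bdd_in_set_mult bdd_in_inv_image compactin_imp_bdd_in[OF U]) (simp add: BC_centralizer_iff)
  ultimately show "g \<in> BC_centralizer G T (U <#> A)" using gc bdd_in_subset by (simp add: BC_centralizer_iff)
qed

lemma normalized_subset_BC_centralizer: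
  assumes U: "compact_open U" and A: "A \<subseteq> Normalizer U" shows "U \<subseteq> BC_centralizer G T A"
proof
  fix u assume u: "u \<in> U"
  have "(\<lambda>h. conjby h u) ` A \<subseteq> U" using Normalizer_conjby[OF _ u] A by auto
  then show "u \<in> BC_centralizer G T A"
    unfolding BC_centralizer_iff
    using u compact_open_subset[OF U] bdd_in_subset[OF compactin_imp_bdd_in[OF compact_openD(2)[OF U]]] by auto
qed

lemma open_finite_index_mono:
  assumes P: "open_finite_index P" and PQ: "P \<subseteq> Q" and Q: "subgroup Q G" shows "open_finite_index Q"
proof -
  have "openin T Q"
    by (rule openin_subgroup_of_open[OF Q _ _ PQ]) (use P subgroup.one_closed in \<open>auto simp: open_finite_index_def\<close>)
  moreover have "finite (rcosets Q)" using rcosets_mono_finite[OF _ Q PQ] P by (simp add: open_finite_index_def)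
  ultimately show ?thesis using Q by (simp add: open_finite_index_def)
qed

lemma compact_power:
  assumes x: "x \<in> carrier G" and U: "compact_open U" and K: "compactin T K" "range (\<lambda>n::nat. x [^] n) \<subseteq> K"
  obtains m :: nat where "m > 0" "x [^] m \<in> U"
proof -
  have "x [^] n \<in> K" for n :: nat using K(2) by blast
  from compact_returns[where f = "\<lambda>n. x [^] n", OF K(1) U infinite_UNIV_nat this]
  obtain p q :: nat where pq: "p < q" "inv (x [^] p) \<otimes> x [^] q \<in> U" .
  have "x [^] q = x [^] p \<otimes> x [^] (q - p)" using pq(1) x by (simp add: nat_pow_mult)
  then have "inv (x [^] p) \<otimes> x [^] q = x [^] (q - p)" using x by simp
  then show thesis using that[of "q - p"] pq by simp
qed

end

section \<open>Comparison of thin families with the rank\<close>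

context locally_compact_group
begin

lemma compact_open_subgroup_iff:
  assumes H: "subgroup H G"
  shows "topological_group.compact_open (G\<lparr>carrier := H\<rparr>) (subtopology T H) V \<longleftrightarrow>
    subgroup V G \<and> compactin T V \<and> V \<subseteq> H \<and> openin (subtopology T H) V"
proof -
  interpret H: topological_group "G\<lparr>carrier := H\<rparr>" "subtopology T H" by (rule subgroup_topological_group[OF H])
  have "subgroup V (G\<lparr>carrier := H\<rparr>) \<longleftrightarrow> subgroup V G \<and> V \<subseteq> H"
    using subgroup_incl[OF _ H] incl_subgroup[OF H] subgroup.subset[of V "G\<lparr>carrier := H\<rparr>"] by auto
  then show ?thesis unfolding H.compact_open_def by (auto simp: compactin_subtopology)
qed

text \<open>The members normalize \<open>U\<close>, so the larger group lies in the product of the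
  compact \<open>U\<close> with the group they generate, and \<open>BC_centralizer_set_mult\<close>
  applies.\<close>

lemma open_finite_index_BC_centralizer_extend:
  assumes U: "compact_open U" and ind: "indep_mod U n a"
    and open_finite_index: "open_finite_index (BC_centralizer G T (generate G (a ` {..<n})))"
  shows "open_finite_index (BC_centralizer G T (generate G (a ` {..<n} \<union> U)))"
proof -
  have Us: "subgroup U G" by (rule compact_openD(1)[OF U])
  interpret I: indep_mod_family G U n a by (rule indep_mod_family.intro[OF is_group indep_mod_family_axioms.intro[OF Us ind]])
  define A where "A = I.A"
  have Ac: "A \<subseteq> carrier G" unfolding A_def by (rule I.A_carrier)
  define A0 where "A0 = generate G (a ` {..<n})"
  have ac: "a ` {..<n} \<subseteq> carrier G" using I.ac by auto
  have A0: "subgroup A0 G" unfolding A0_def by (rule generate_is_subgroup[OF ac])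
  have A0c: "A0 \<subseteq> carrier G" by (rule subgroup.subset[OF A0])
  have "A \<subseteq> U <#> A0" unfolding A_def I.A_def A0_def
    by (rule generate_normalized[OF Us]) (use I.aN in auto)
  then have "BC_centralizer G T (U <#> A0) \<subseteq> BC_centralizer G T A" by (rule BC_centralizer_antimono)
  then have "BC_centralizer G T A0 \<subseteq> BC_centralizer G T A"
    using BC_centralizer_set_mult[OF compact_openD(2)[OF U] A0c] by blast
  from open_finite_index_mono[OF open_finite_index[folded A0_def] this subgroup_BC_centralizer[OF Ac]]
  have lA: "open_finite_index (BC_centralizer G T A)" .
  then show ?thesis by (simp add: A_def I.A_def)
qed

text \<open>The group \<open>A\<close> generated by the members and \<open>U\<close> is open, hence
  closed, and it is compactly generated and thin. Its radical is exactly \<open>U\<close>, so the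
  thin rank is read off from the free abelian quotient by \<open>U\<close>.\<close>

lemma rank_ge_of_thin_family:
  assumes tf: "thin_family n" shows "enat n \<le> BC_rank G T"
proof -
  obtain U a where U: "compact_open U" and ind: "indep_mod U n a"
    and open_finite_index: "open_finite_index (BC_centralizer G T (generate G (a ` {..<n})))"
    using tf by (auto simp: thin_family_def)
  have Us: "subgroup U G" by (rule compact_openD(1)[OF U])
  interpret I: indep_mod_family G U n a by (rule indep_mod_family.intro[OF is_group indep_mod_family_axioms.intro[OF Us ind]])
  define A where "A = I.A"
  have A: "subgroup A G" unfolding A_def by (rule I.subgroup_A)
  have Ac: "A \<subseteq> carrier G" by (rule subgroup.subset[OF A])
  have oA: "openin T A"
    by (rule openin_subgroup_of_open[OF A compact_openD(3)[OF U] _ I.UA[folded A_def]])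
      (use compact_open_one[OF U] in blast)
  have clA: "closedin T A" by (rule closedin_open_subgroup[OF A oA])
  have lA: "open_finite_index (BC_centralizer G T A)"
    using open_finite_index_BC_centralizer_extend[OF U ind open_finite_index] by (simp add: A_def I.A_def)
  have "g <# U #> inv g = U" if "g \<in> A" for g
    using l_coset_r_coset_eq_conjby_image[OF _ I.Uc] NormalizerD[of g U] I.A_Normalizer that Ac unfolding A_def by auto
  then have thin: "thin_on A G T"
    using A clA lA compact_openD[OF U] unfolding thin_on_def closed_subgroup_def open_finite_index_def by blast
  have "compactin T (a ` {..<n} \<union> U)"
    using I.ac by (intro compactin_Un compact_openD(2)[OF U] finite_imp_compactin) auto
  then have cg: "compactly_generated_subgroup A G T"
    unfolding compactly_generated_subgroup_def A_def I.A_def by blast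
  interpret HA: locally_compact_group "G\<lparr>carrier := A\<rparr>" "subtopology T A"
    by (rule closed_subgroup_locally_compact_group[OF A clA])
  have coU: "HA.compact_open U"
    unfolding compact_open_subgroup_iff[OF A]
    using Us compact_openD(2,3)[OF U] I.UA[folded A_def] openin_subtopology_Int[of T U A]
    by (simp add: Int_absorb2)
  have nU: "U \<lhd> G\<lparr>carrier := A\<rparr>" using I.normal_U by (simp add: A_def)
  note rad = HA.RC_radical_greatest[OF coU nU]
  \<comment> \<open>The powers of an element of the radical stay in a compact set, so some positive
    power is in \<open>U\<close>; the quotient by \<open>U\<close> has no torsion.\<close>
  have "RC_radical (G\<lparr>carrier := A\<rparr>) (subtopology T A) \<subseteq> U"
  proof
    fix x assume x: "x \<in> RC_radical (G\<lparr>carrier := A\<rparr>) (subtopology T A)"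
    have "bdd_in (subtopology T A) (generate (G\<lparr>carrier := A\<rparr>) {x})"
      using rad(1) x unfolding HA.loc_bounded_def by blast
    have "RC_radical (G\<lparr>carrier := A\<rparr>) (subtopology T A) \<lhd> G\<lparr>carrier := A\<rparr>"
      using rad(1) unfolding HA.loc_bounded_def by (rule conjunct1)
    from subgroup.subset[OF normal_imp_subgroup[OF this]] have xA: "x \<in> A" using x by auto
    have "bdd_in T (generate G {x})"
      using \<open>bdd_in (subtopology T A) _\<close> generate_consistent[of "{x}" A] A xA bdd_in_subtopologyD[of T A] by simp
    then obtain K where K: "compactin T K" "generate G {x} \<subseteq> K" by (auto simp: bdd_in_def)
    have xc: "x \<in> carrier G" using xA Ac by blast
    have "x [^] (k::nat) \<in> generate G {x}" for k
    proof -
      have "x [^] int k \<in> generate G {x}" unfolding generate_pow[OF xc] by blast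
      then show ?thesis by (simp add: int_pow_int)
    qed
    then have "range (\<lambda>k::nat. x [^] k) \<subseteq> K" using K(2) by blast
    then obtain m :: nat where "m > 0" "x [^] m \<in> U" by (rule compact_power[OF xc U K(1)])
    then show "x \<in> U" using I.torsion_free xA unfolding A_def by blast
  qed
  then have radU: "RC_radical (G\<lparr>carrier := A\<rparr>) (subtopology T A) = U" using rad(2) by blast
  have "enat n \<le> thin_rank G T A"
    unfolding thin_rank_def radU using I.rank_Q by (simp add: I.Q_def A_def)
  also have "\<dots> \<le> BC_rank G T"
    unfolding BC_rank_def by (rule Sup_upper) (use thin cg in blast)
  finally show ?thesis .
qed

text \<open>Lifts \<open>c i\<close> of basis elements are independent modulo the radical but need
  not commute modulo \<open>U\<close>. Powers repair this: finite index of \<open>P\<close> puts a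
  power of each lift into \<open>P\<close>, where conjugation orbits are bounded, and boundedness
  makes further powers commute modulo \<open>U\<close>. Positive powers keep independence.\<close>

lemma thin_family_of_rank_ge:
  assumes n: "0 < n" "enat n \<le> BC_rank G T" shows "thin_family n"
proof -
  obtain A where thin: "thin_on A G T" and rk: "enat n \<le> thin_rank G T A"
    using enat_le_Sup[OF n(1) n(2)[unfolded BC_rank_def]] by blast
  have A: "subgroup A G" and clA: "closedin T A" using thin by (auto simp: thin_on_def closed_subgroup_def)
  have Ac: "A \<subseteq> carrier G" by (rule subgroup.subset[OF A])
  obtain U where Uall: "subgroup U G" "compactin T U" "openin T U" "\<forall>a\<in>A. a <# U #> inv a = U"
    using thin unfolding thin_on_def by blast
  have U: "compact_open U" using Uall by (simp add: compact_open_def)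
  have Uc: "U \<subseteq> carrier G" by (rule compact_open_subset[OF U])
  have AN: "A \<subseteq> Normalizer U"
    using Uall(4) l_coset_r_coset_eq_conjby_image[OF _ Uc] Ac by (auto simp: Normalizer_def subset_iff)
  define P where "P = BC_centralizer G T A"
  have P: "subgroup P G" "openin T P" "finite (rcosets P)" using thin by (auto simp: thin_on_def P_def)
  let ?GA = "G\<lparr>carrier := A\<rparr>"
  let ?TA = "subtopology T A"
  interpret HA: locally_compact_group ?GA ?TA by (rule closed_subgroup_locally_compact_group[OF A clA])
  have coUA: "HA.compact_open (U \<inter> A)"
    unfolding compact_open_subgroup_iff[OF A]
    using subgroups_Inter_pair[OF Uall(1) A] compact_Int_closedin[OF Uall(2) clA] openin_subtopology_Int[OF Uall(3)]
    by simp
  have nUA: "U \<inter> A \<lhd> ?GA"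
  proof (rule HA.normal_invI)
    show "subgroup (U \<inter> A) ?GA" using coUA unfolding HA.compact_open_def by blast
    fix x h assume x: "x \<in> carrier ?GA" and h: "h \<in> U \<inter> A"
    then have "conjby x h \<in> U" using Normalizer_conjby[of x U h] AN by auto
    moreover have "conjby x h \<in> A" unfolding conjby_def
      using x h subgroup.m_closed[OF A] subgroup.m_inv_closed[OF A] by simp
    ultimately show "x \<otimes>\<^bsub>?GA\<^esub> h \<otimes>\<^bsub>?GA\<^esub> inv\<^bsub>?GA\<^esub> x \<in> U \<inter> A" using x A by (simp add: conjby_def)
  qed
  define R where "R = RC_radical ?GA ?TA"
  note rad = HA.RC_radical_greatest[OF coUA nUA, folded R_def]
  have Rn: "R \<lhd> ?GA" using rad(1) by (simp add: HA.loc_bounded_def)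
  have Rs': "subgroup R ?GA" by (rule normal_imp_subgroup[OF Rn])
  have RA: "R \<subseteq> A" using subgroup.subset[OF Rs'] by simp
  have Rs: "subgroup R G" by (rule incl_subgroup[OF A Rs'])
  interpret N: normal R ?GA by (rule Rn)
  define Q where "Q = ?GA Mod R"
  have gQ: "group Q" unfolding Q_def by (rule N.factorgroup_is_group)
  define \<pi> where "\<pi> = (\<lambda>x. R #> x)"
  have hom_\<pi>: "\<pi> \<in> hom ?GA Q" using N.r_coset_hom_Mod by (simp add: Q_def \<pi>_def)
  interpret p: group_hom ?GA Q \<pi> using hom_\<pi> gQ HA.is_group by (simp add: group_hom_def group_hom_axioms_def)
  have \<pi>R: "\<pi> r = \<one>\<^bsub>Q\<^esub>" if "r \<in> R" for r
    using coset_join2[OF subgroup.mem_carrier[OF Rs that] Rs that] by (simp add: \<pi>_def Q_def FactGroup_def)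
  have "enat n \<le> free_abelian_subgroup_rank Q" using rk by (simp add: thin_rank_def Q_def R_def)
  from enat_le_Sup[OF n(1) this[unfolded free_abelian_subgroup_rank_def]]
  obtain B X where BX: "subgroup B Q" "Q\<lparr>carrier := B\<rparr> \<cong> free_Abelian_group (X :: 'a set set)" "enat n \<le> ecard X"
    by auto
  have "\<exists>X0\<subseteq>X. finite X0 \<and> card X0 = n"
  proof (cases "finite X")
    case True
    then have "n \<le> card X" using BX(3) by (simp add: ecard_def)
    then show ?thesis using True by (meson finite_subset obtain_subset_with_card_n)
  next
    case False
    then show ?thesis by (meson infinite_arbitrarily_large)
  qed
  then obtain X0 where X0: "X0 \<subseteq> X" "finite X0" "card X0 = n" by blast
  obtain x where x: "bij_betw x {0..<n} X0" using ex_bij_betw_nat_finite[OF X0(2)] X0(3) by auto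
  have xX: "x i \<in> X" if "i < n" for i using x X0(1) that by (auto simp: bij_betw_def)
  have xinj: "x i \<noteq> x j" if "i < n" "j < n" "i \<noteq> j" for i j
    using x that by (auto simp: bij_betw_def inj_on_def)
  let ?F = "free_Abelian_group X"
  let ?QB = "Q\<lparr>carrier := B\<rparr>"
  obtain \<phi> where \<phi>: "\<phi> \<in> iso ?QB ?F" using BX(2) by (auto simp: is_iso_def)
  have gQB: "group ?QB" by (rule group.subgroup_imp_group[OF gQ BX(1)])
  interpret f: group_hom ?QB ?F \<phi> using \<phi> gQB by (simp add: group_hom_def group_hom_axioms_def iso_def)
  have bij: "bij_betw \<phi> B (carrier ?F)" using \<phi> by (simp add: iso_def)
  have BQ: "B \<subseteq> carrier Q" by (rule subgroup.subset[OF BX(1)])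
  have "\<exists>c\<in>A. \<pi> c \<in> B \<and> \<phi> (\<pi> c) = frag_of (x i)" if i: "i < n" for i
  proof -
    have "frag_of (x i) \<in> \<phi> ` B" using bij xX[OF i] by (simp add: bij_betw_def)
    then obtain y where y: "y \<in> B" "\<phi> y = frag_of (x i)" by force
    then have "y \<in> carrier Q" using BQ by blast
    then obtain c where "c \<in> A" "y = \<pi> c" by (auto simp: Q_def FactGroup_def RCOSETS_def \<pi>_def)
    then show ?thesis using y by blast
  qed
  then have "\<forall>i. \<exists>c. i < n \<longrightarrow> c \<in> A \<and> \<pi> c \<in> B \<and> \<phi> (\<pi> c) = frag_of (x i)" by blast
  then obtain c where c: "\<And>i. i < n \<Longrightarrow> c i \<in> A" "\<And>i. i < n \<Longrightarrow> \<pi> (c i) \<in> B"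
    "\<And>i. i < n \<Longrightarrow> \<phi> (\<pi> (c i)) = frag_of (x i)" by metis
  have cc: "c i \<in> carrier G" if "i < n" for i using c(1)[OF that] Ac by blast
  \<comment> \<open>The subgroup of elements with vanishing \<open>x i\<close>-coordinate. It
    contains the radical and the lifts of lower index, but no positive power of
    \<open>c i\<close>.\<close>
  define S where "S i = {g \<in> A. \<pi> g \<in> B \<and> Poly_Mapping.lookup (\<phi> (\<pi> g)) (x i) = 0}" for i
  have S: "subgroup (S i) ?GA" for i
  proof
    show "S i \<subseteq> carrier ?GA" by (auto simp: S_def)
    have "\<phi> (\<pi> \<one>\<^bsub>?GA\<^esub>) = 0" using f.hom_one by (simp only: p.hom_one) simp
    moreover have "\<pi> \<one>\<^bsub>?GA\<^esub> \<in> B" using subgroup.one_closed[OF BX(1)] by (simp only: p.hom_one)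
    ultimately show "\<one>\<^bsub>?GA\<^esub> \<in> S i" using HA.one_closed by (simp add: S_def)
    show "g \<otimes>\<^bsub>?GA\<^esub> h \<in> S i" if gh: "g \<in> S i" "h \<in> S i" for g h
    proof -
      have A': "g \<in> A" "h \<in> A" and B': "\<pi> g \<in> B" "\<pi> h \<in> B" using gh by (auto simp: S_def)
      have e: "\<pi> (g \<otimes> h) = \<pi> g \<otimes>\<^bsub>Q\<^esub> \<pi> h" using p.hom_mult[of g h] A' by simp
      have "\<phi> (\<pi> (g \<otimes> h)) = \<phi> (\<pi> g) + \<phi> (\<pi> h)" using f.hom_mult[of "\<pi> g" "\<pi> h"] B' by (simp add: e)
      then show ?thesis
        using gh subgroup.m_closed[OF BX(1) B'] subgroup.m_closed[OF A A'] by (simp add: S_def e lookup_add)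
    qed
    show "inv\<^bsub>?GA\<^esub> g \<in> S i" if g: "g \<in> S i" for g
    proof -
      have A': "g \<in> A" and B': "\<pi> g \<in> B" using g by (auto simp: S_def)
      have e: "\<pi> (inv g) = inv\<^bsub>Q\<^esub> (\<pi> g)" using p.hom_inv[of g] A' A by simp
      have iB: "inv\<^bsub>Q\<^esub> (\<pi> g) \<in> B" by (rule subgroup.m_inv_closed[OF BX(1) B'])
      have "\<phi> (inv\<^bsub>?QB\<^esub> (\<pi> g)) = inv\<^bsub>?F\<^esub> (\<phi> (\<pi> g))" using f.hom_inv[of "\<pi> g"] B' by simp
      moreover have "inv\<^bsub>?QB\<^esub> (\<pi> g) = inv\<^bsub>Q\<^esub> (\<pi> g)" by (rule group.m_inv_consistent[OF gQ BX(1) B'])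
      moreover have "\<phi> (\<pi> g) \<in> carrier ?F" using f.hom_closed[of "\<pi> g"] B' by simp
      ultimately have "\<phi> (\<pi> (inv g)) = - \<phi> (\<pi> g)" by (simp add: e)
      then show ?thesis using g A' A iB subgroup.m_inv_closed[OF A A'] by (simp add: S_def e lookup_uminus)
    qed
  qed
  have cfree: "c i [^] m \<notin> generate G (c ` {..<i} \<union> R)" if i: "i < n" and m: "m > 0" for i and m :: nat
  proof
    assume a: "c i [^] m \<in> generate G (c ` {..<i} \<union> R)"
    have sub: "c ` {..<i} \<union> R \<subseteq> S i"
    proof
      fix y assume "y \<in> c ` {..<i} \<union> R"
      then consider j where "j < i" "y = c j" | "y \<in> R" by auto
      then show "y \<in> S i"
      proof cases
        case 1
        then have "j < n" using i by simp
        then show ?thesis using c[OF \<open>j < n\<close>] xinj[OF \<open>j < n\<close> i] 1 by (auto simp: S_def)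
      next
        case 2
        have "\<phi> \<one>\<^bsub>?QB\<^esub> = 0" using f.hom_one by simp
        then show ?thesis using \<pi>R[OF 2] 2 RA subgroup.one_closed[OF BX(1)] by (auto simp: S_def)
      qed
    qed
    have "generate G (c ` {..<i} \<union> R) \<subseteq> S i"
      by (rule generate_subgroup_incl[OF sub incl_subgroup[OF A S]])
    then have "c i [^] m \<in> S i" using a by blast
    then have z: "Poly_Mapping.lookup (\<phi> (\<pi> (c i [^] m))) (x i) = 0" by (simp add: S_def)
    have "\<pi> (c i [^] m) = \<pi> (c i) [^]\<^bsub>Q\<^esub> m"
      using p.hom_nat_pow[of "c i" m] c(1)[OF i] by (simp add: nat_pow_consistent[symmetric])
    also have "\<dots> = \<pi> (c i) [^]\<^bsub>?QB\<^esub> m" by (rule monoid.nat_pow_consistent[OF group.is_monoid[OF gQ]])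
    finally have "\<phi> (\<pi> (c i [^] m)) = frag_of (x i) [^]\<^bsub>?F\<^esub> m"
      using f.hom_nat_pow[of "\<pi> (c i)" m] c(2,3)[OF i] by simp
    then have "Poly_Mapping.lookup (\<phi> (\<pi> (c i [^] m))) (x i) = int m" by simp
    then show False using z m by simp
  qed
  have "\<exists>p::nat. p > 0 \<and> c i [^] p \<in> P" if "i < n" for i
    by (rule finite_index_power[OF P(1,3) cc[OF that]]) blast
  then have "\<forall>i. \<exists>p::nat. i < n \<longrightarrow> p > 0 \<and> c i [^] p \<in> P" by blast
  then obtain p :: "nat \<Rightarrow> nat" where p: "\<And>i. i < n \<Longrightarrow> p i > 0" "\<And>i. i < n \<Longrightarrow> c i [^] p i \<in> P" by metis
  define z where "z i = c i [^] p i" for i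
  have Apow: "g [^] (k::nat) \<in> A" if "g \<in> A" for g k
    using subgroup_int_pow_closed[OF A that, of "int k"] by (simp add: int_pow_int)
  have zA: "z i \<in> A" "z i \<in> P" "z i \<in> carrier G" "z i \<in> Normalizer U" if "i < n" for i
    using Apow[OF c(1)[OF that], of "p i"] p(2)[OF that] Ac AN by (auto simp: z_def)
  have NUs: "subgroup (Normalizer U) G" by (rule subgroup_Normalizer[OF Uc])
  \<comment> \<open>The conjugates of \<open>z i\<close> by powers of \<open>z j\<close> stay in a
    compact set. Two of them agree modulo \<open>U\<close>, and conjugating back by the smaller
    power shows that the power given by the difference fixes \<open>z i\<close> modulo
    \<open>U\<close>.\<close>
  have "\<exists>q::nat. q > 0 \<and> conjby (z j [^] q) (z i) \<in> z i <# U" if ij: "i < n" "j < n" for i j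
  proof -
    have "bdd_in T ((\<lambda>h. conjby h (z i)) ` A)" using zA(2)[OF ij(1)] by (simp add: P_def BC_centralizer_iff)
    then obtain K where K: "compactin T K" "(\<lambda>h. conjby h (z i)) ` A \<subseteq> K" by (auto simp: bdd_in_def)
    have "conjby (z j [^] k) (z i) \<in> K" for k :: nat using K(2) Apow[OF zA(1)[OF ij(2)]] by auto
    from compact_returns[where f = "\<lambda>k. conjby (z j [^] k) (z i)", OF K(1) U infinite_UNIV_nat this]
    obtain k l :: nat where l: "k < l" and w: "inv (conjby (z j [^] k) (z i)) \<otimes> conjby (z j [^] l) (z i) \<in> U" .
    define g where "g = z j [^] k"
    have gc: "g \<in> carrier G" using zA(3)[OF ij(2)] by (simp add: g_def)
    have gN: "g \<in> Normalizer U" using Apow[OF zA(1)[OF ij(2)], of k] AN by (auto simp: g_def)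
    have zi: "z i \<in> carrier G" "z j \<in> carrier G" using zA(3) ij by auto
    have gl: "g \<otimes> z j [^] (l - k) = z j [^] l" using l zi by (simp add: g_def nat_pow_mult)
    have "conjby g (conjby (z j [^] (l - k)) (z i)) = conjby (z j [^] l) (z i)" using gc zi by (simp add: conjby_conjby gl)
    from arg_cong[OF this, of "conjby (inv g)"]
    have "conjby (z j [^] (l - k)) (z i) = conjby (inv g) (conjby (z j [^] l) (z i))" using gc zi by simp
    moreover have "conjby (inv g) (inv (conjby g (z i)) \<otimes> conjby (z j [^] l) (z i)) = inv (z i) \<otimes> conjby (inv g) (conjby (z j [^] l) (z i))"
      using gc zi by (simp add: conjby_mult conjby_inv)
    ultimately have "conjby (z j [^] (l - k)) (z i) = z i \<otimes> conjby (inv g) (inv (conjby g (z i)) \<otimes> conjby (z j [^] l) (z i))"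
      using gc zi by simp
    moreover have "conjby (inv g) (inv (conjby g (z i)) \<otimes> conjby (z j [^] l) (z i)) \<in> U"
      by (rule Normalizer_conjby[OF subgroup.m_inv_closed[OF NUs gN]]) (use w in \<open>simp add: g_def\<close>)
    ultimately show ?thesis using l by (intro exI[of _ "l - k"]) (auto simp: l_coset_iff)
  qed
  then have "\<forall>i j. \<exists>q::nat. i < n \<longrightarrow> j < n \<longrightarrow> q > 0 \<and> conjby (z j [^] q) (z i) \<in> z i <# U" by blast
  then obtain q :: "nat \<Rightarrow> nat \<Rightarrow> nat" where q: "\<And>i j. i < n \<Longrightarrow> j < n \<Longrightarrow> q i j > 0"
    "\<And>i j. i < n \<Longrightarrow> j < n \<Longrightarrow> conjby (z j [^] q i j) (z i) \<in> z i <# U" by metis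
  \<comment> \<open>The product is divisible by every \<open>q i j\<close>, so one exponent for
    \<open>z j\<close> serves all \<open>z i\<close> simultaneously.\<close>
  define q' where "q' j = (\<Prod>i<n. q i j)" for j
  have q'pos: "q' j > 0" if "j < n" for j unfolding q'_def using q(1) that by (intro prod_pos) auto
  define a where "a j = z j [^] q' j" for j
  have Npow: "g [^] (k::nat) \<in> M" if "subgroup M G" "g \<in> M" for g k M
    using subgroup_int_pow_closed[OF that, of "int k"] by (simp add: int_pow_int)
  have aN: "a i \<in> Normalizer U" "a i \<in> carrier G" "a i \<in> A" if "i < n" for i
    using Npow[OF NUs zA(4)[OF that]] zA(3)[OF that] Apow[OF zA(1)[OF that]] by (auto simp: a_def)
  have az: "conjby (a j) (z i) \<in> z i <# U" if ij: "i < n" "j < n" for i j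
  proof -
    have "q i j dvd q' j" unfolding q'_def using ij by (intro dvd_prodI) auto
    then obtain k where k: "q' j = q i j * k" by (rule dvdE)
    have "(z j [^] q i j) [^] k \<in> {g \<in> Normalizer U. conjby g (z i) \<in> z i <# U}"
      by (rule Npow[OF subgroup_commute_mod[OF Uall(1) zA(3)[OF ij(1)]]])
        (use q(2)[OF ij] Npow[OF NUs zA(4)[OF ij(2)]] in simp)
    then show ?thesis using zA(3)[OF ij(2)] by (simp add: a_def k nat_pow_pow)
  qed
  \<comment> \<open>After exchanging the arguments, \<open>z i\<close> lies in the stabilizer of the
    coset of \<open>a j\<close>; being a group, it contains the power \<open>a i\<close>.\<close>
  have comm: "conjby (a i) (a j) \<in> a j <# U" if ij: "i < n" "j < n" for i j
  proof -
    have "z i \<in> {g \<in> Normalizer U. conjby g (a j) \<in> a j <# U}"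
      using commute_mod_sym[OF Uall(1) aN(1)[OF ij(2)] zA(4)[OF ij(1)] az[OF ij]] zA(4)[OF ij(1)] by simp
    from Npow[OF subgroup_commute_mod[OF Uall(1) aN(2)[OF ij(2)]] this, of "q' i"]
    show ?thesis by (simp add: a_def)
  qed
  have ac: "a i = c i [^] (p i * q' i)" if "i < n" for i
    using cc[OF that] by (simp add: a_def z_def nat_pow_pow)
  have afree: "a i [^] m \<notin> generate G (a ` {..<i} \<union> U)" if i: "i < n" and m: "m > 0" for i and m :: nat
  proof
    assume "a i [^] m \<in> generate G (a ` {..<i} \<union> U)"
    define D where "D = generate G (a ` {..<i})"
    have aic: "a ` {..<i} \<subseteq> carrier G" using aN(2) i by auto
    have D: "subgroup D G" unfolding D_def by (rule generate_is_subgroup[OF aic])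
    have DA: "D \<subseteq> A" unfolding D_def by (rule generate_subgroup_incl[OF _ A]) (use aN(3) i in auto)
    have "generate G (a ` {..<i} \<union> U) \<subseteq> U <#> D" unfolding D_def
      by (rule generate_normalized[OF Uall(1)]) (use aN(1) i in auto)
    then have "a i [^] m \<in> U <#> D" using \<open>a i [^] m \<in> _\<close> by blast
    then obtain u d where ud: "u \<in> U" "d \<in> D" "a i [^] m = u \<otimes> d" by (auto simp: set_mult_iff)
    have dc: "d \<in> carrier G" "u \<in> carrier G" "d \<in> A" using ud DA Ac Uc by auto
    have amA: "a i [^] m \<in> A" by (rule Apow[OF aN(3)[OF i]])
    \<comment> \<open>The factor \<open>u\<close> lies in \<open>A\<close> and in \<open>U\<close>,
      hence in the radical. A relation modulo \<open>U\<close> thus becomes one modulo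
      \<open>R\<close>, where the lifts are independent.\<close>
    have "u = a i [^] m \<otimes> inv d" unfolding ud(3) using dc by (simp add: m_assoc)
    then have "u \<in> A" using subgroup.m_closed[OF A amA subgroup.m_inv_closed[OF A dc(3)]] by simp
    then have uR: "u \<in> R" using rad(2) ud(1) by blast
    have cic: "c ` {..<i} \<union> R \<subseteq> carrier G" using cc i RA Ac by fastforce
    define E where "E = generate G (c ` {..<i} \<union> R)"
    have E: "subgroup E G" unfolding E_def by (rule generate_is_subgroup[OF cic])
    have "a ` {..<i} \<subseteq> E"
    proof
      fix y assume "y \<in> a ` {..<i}"
      then obtain j where j: "j < i" "y = a j" by auto
      have "c j \<in> E" unfolding E_def using j by (auto intro: generate.incl)
      then show "y \<in> E" using ac[of j] j i Npow[OF E] by simp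
    qed
    then have "D \<subseteq> E" unfolding D_def by (rule generate_subgroup_incl[OF _ E])
    moreover have "u \<in> E" unfolding E_def using uR by (auto intro: generate.incl)
    ultimately have "a i [^] m \<in> E" unfolding ud(3) using ud(2) subgroup.m_closed[OF E] by blast
    then have "c i [^] (p i * q' i * m) \<in> generate G (c ` {..<i} \<union> R)"
      using cc[OF i] by (simp add: ac[OF i] nat_pow_pow E_def)
    then show False using cfree[OF i] p(1)[OF i] q'pos[OF i] m by simp
  qed
  have "indep_mod U n a" unfolding indep_mod_def using aN(1) comm afree by blast
  moreover have "open_finite_index (BC_centralizer G T (generate G (a ` {..<n})))"
  proof (rule open_finite_index_mono[of P])
    show "open_finite_index P" using P by (simp add: open_finite_index_def)
    have "generate G (a ` {..<n}) \<subseteq> A" by (rule generate_subgroup_incl[OF _ A]) (use aN(3) in auto)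
    then show "P \<subseteq> BC_centralizer G T (generate G (a ` {..<n}))" unfolding P_def by (rule BC_centralizer_antimono)
    show "subgroup (BC_centralizer G T (generate G (a ` {..<n}))) G"
      by (rule subgroup_BC_centralizer, rule generate_incl) (use aN(2) in auto)
  qed
  ultimately show ?thesis using U unfolding thin_family_def by blast
qed

end

section \<open>Transfer of thin families\<close>
context locally_compact_group
begin

text \<open>Lattices are assumed discrete, whereas the rank comparison is for closed subgroups. With
  a neighbourhood \<open>V\<close> whose quotients \<open>inv s \<otimes> t\<close> lie in
  \<open>O1\<close>, a translate of \<open>V\<close> meets \<open>D\<close> in at most one point.
  For \<open>x\<close> outside \<open>D\<close> that point can be removed from the translate, which
  remains a neighbourhood of \<open>x\<close>.\<close>

lemma discrete_subgroup_closed: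
  assumes D: "discrete_subgroup D G T" shows "closed_subgroup D G T"
proof -
  have Ds: "subgroup D G" and sub: "subtopology T D = discrete_topology D"
    using D by (auto simp: discrete_subgroup_def)
  have Dc: "D \<subseteq> carrier G" by (rule subgroup.subset[OF Ds])
  have "openin (subtopology T D) {\<one>}" unfolding sub using subgroup.one_closed[OF Ds] by simp
  then obtain O1 where O1: "openin T O1" "{\<one>} = O1 \<inter> D" by (auto simp: openin_subtopology)
  have cont: "continuous_map (prod_topology T T) T (\<lambda>z. inv (fst z) \<otimes> snd z)"
  proof (intro continuous_map_mult continuous_map_snd)
    show "continuous_map (prod_topology T T) T (\<lambda>z. inv (fst z))"
      using continuous_map_compose[OF continuous_map_fst continuous_inv] by (simp add: o_def)
  qed
  have "openin (prod_topology T T) {z \<in> topspace (prod_topology T T). inv (fst z) \<otimes> snd z \<in> O1}"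
    by (rule openin_continuous_map_preimage[OF cont O1(1)])
  moreover have "(\<one>, \<one>) \<in> {z \<in> topspace (prod_topology T T). inv (fst z) \<otimes> snd z \<in> O1}"
    using O1(2) by auto
  ultimately obtain M N where MN: "openin T M" "openin T N" "\<one> \<in> M" "\<one> \<in> N"
    "M \<times> N \<subseteq> {z \<in> topspace (prod_topology T T). inv (fst z) \<otimes> snd z \<in> O1}"
    unfolding openin_prod_topology_alt by meson
  define V where "V = M \<inter> N"
  have V: "openin T V" "\<one> \<in> V" using MN by (auto simp: V_def)
  have Vc: "V \<subseteq> carrier G" by (rule openin_subset_carrier[OF V(1)])
  have VV: "inv s \<otimes> t \<in> O1" if "s \<in> V" "t \<in> V" for s t using that MN(5) by (auto simp: V_def)
  have "openin T (carrier G - D)"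
  proof (subst openin_subopen, intro ballI)
    fix x assume x: "x \<in> carrier G - D"
    have xc: "x \<in> carrier G" using x by blast
    have uniq: "g = h" if gh: "g \<in> D \<inter> (x <# V)" "h \<in> D \<inter> (x <# V)" for g h
    proof -
      obtain s t where st: "s \<in> V" "g = x \<otimes> s" "t \<in> V" "h = x \<otimes> t" using gh by (auto simp: l_coset_iff)
      have c: "s \<in> carrier G" "t \<in> carrier G" using st Vc by auto
      have "inv g \<otimes> h = inv s \<otimes> t" unfolding st(2,4) using xc c by (simp add: group_nf)
      then have "inv g \<otimes> h \<in> O1" using VV st by simp
      moreover have "inv g \<otimes> h \<in> D" using gh subgroup.m_closed[OF Ds subgroup.m_inv_closed[OF Ds]] by blast
      ultimately have "inv g \<otimes> h = \<one>" using O1(2) by blast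
      then show "g = h" using gh Dc by (metis IntD1 inv_closed inv_equality inv_inv subsetD)
    qed
    have fin: "finite (D \<inter> (x <# V))"
    proof (cases "D \<inter> (x <# V) = {}")
      case False
      then obtain g where "g \<in> D \<inter> (x <# V)" by blast
      then have "D \<inter> (x <# V) \<subseteq> {g}" using uniq by blast
      then show ?thesis using finite_subset by blast
    qed simp
    have oxV: "openin T (x <# V)" by (rule openin_l_coset[OF xc V(1)])
    have "compactin T (D \<inter> (x <# V))" by (intro finite_imp_compactin fin) (use Dc in auto)
    then have "openin T ((x <# V) - D \<inter> (x <# V))" using oxV compactin_imp_closed by blast
    moreover have "x \<in> (x <# V) - D \<inter> (x <# V)"
    proof -
      have "x \<otimes> \<one> \<in> x <# V" using V(2) unfolding l_coset_iff by blast
      then show ?thesis using x by auto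
    qed
    moreover have "(x <# V) - D \<inter> (x <# V) \<subseteq> carrier G - D" using openin_subset_carrier[OF oxV] by blast
    ultimately show "\<exists>W. openin T W \<and> x \<in> W \<and> W \<subseteq> carrier G - D" by blast
  qed
  then show ?thesis using Ds Dc by (simp add: closed_subgroup_def closedin_def)
qed

end

lemma (in group) mult_pow_normalizer:
  assumes U: "subgroup U G" and v: "v \<in> U" and b: "b \<in> Normalizer U"
  shows "\<exists>w\<in>U. (v \<otimes> b) [^] (m::nat) = w \<otimes> b [^] m"
proof (induction m)
  case 0
  show ?case using subgroup.one_closed[OF U] by (intro bexI[of _ \<one>]) auto
next
  case (Suc m)
  have Uc: "U \<subseteq> carrier G" by (rule subgroup.subset[OF U])
  have bc: "b \<in> carrier G" by (rule NormalizerD(2)[OF b])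
  obtain w where w: "w \<in> U" "(v \<otimes> b) [^] m = w \<otimes> b [^] m" using Suc by blast
  have c: "v \<in> carrier G" "w \<in> carrier G" using v w Uc by auto
  have "b [^] int m \<in> Normalizer U" by (rule subgroup_int_pow_closed[OF subgroup_Normalizer[OF Uc] b])
  then have "conjby (b [^] m) v \<in> U" using Normalizer_conjby[OF _ v] by (simp add: int_pow_int)
  then have 1: "w \<otimes> conjby (b [^] m) v \<in> U" by (rule subgroup.m_closed[OF U w(1)])
  have "(v \<otimes> b) [^] Suc m = (w \<otimes> b [^] m) \<otimes> (v \<otimes> b)" by (simp add: w(2))
  also have "\<dots> = (w \<otimes> conjby (b [^] m) v) \<otimes> (b [^] m \<otimes> b)" using c bc by (simp add: conjby_def group_nf)
  finally have "(v \<otimes> b) [^] Suc m = (w \<otimes> conjby (b [^] m) v) \<otimes> b [^] Suc m" using bc by simp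
  then show ?case using 1 by blast
qed

lemma enat_le_of_nat_bounds:
  assumes "\<And>n. enat n \<le> x \<Longrightarrow> enat n \<le> y" shows "x \<le> (y :: enat)"
proof (cases x)
  case (enat n)
  then show ?thesis using assms[of n] by simp
next
  case infinity
  show ?thesis
  proof (cases y)
    case (enat m)
    then show ?thesis using assms[of "Suc m"] infinity by simp
  qed simp
qed

section \<open>A recurrent closed subgroup and its ambient group\<close>

locale recurrent_subgroup = tdlc_group G T for G (structure) and T :: "'a topology" +
  fixes H :: "'a set"
  assumes H: "subgroup H G" and clH: "closedin T H" and rec: "recurrent H"
begin

abbreviation "GH \<equiv> G\<lparr>carrier := H\<rparr>"
abbreviation "TH \<equiv> subtopology T H"

lemma Hc: "H \<subseteq> carrier G" by (rule subgroup.subset[OF H])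

sublocale H: locally_compact_group GH TH
  by (rule closed_subgroup_locally_compact_group[OF H clH])

lemma H_conjby [simp]: "g \<in> H \<Longrightarrow> H.conjby g x = conjby g x"
  using H by (simp add: H.conjby_def conjby_def)

lemma H_Normalizer: "H.Normalizer V = Normalizer V \<inter> H"
  using Hc by (auto simp: H.Normalizer_def Normalizer_def)

lemma H_indep_mod_iff:
  assumes V: "V \<subseteq> H" shows "H.indep_mod V n a \<longleftrightarrow> indep_mod V n a \<and> (\<forall>i<n. a i \<in> H)"
proof (cases "\<forall>i<n. a i \<in> H")
  case True
  have "generate GH (a ` {..<i} \<union> V) = generate G (a ` {..<i} \<union> V)" if "i < n" for i
    using True V that by (intro generate_consistent H) auto
  then show ?thesis using True unfolding H.indep_mod_def indep_mod_def H_Normalizer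
    by (auto simp: nat_pow_consistent[symmetric])
next
  case False
  then show ?thesis by (auto simp: H.indep_mod_def H_Normalizer)
qed

lemma H_BC_centralizer: "A \<subseteq> H \<Longrightarrow> BC_centralizer GH TH A = BC_centralizer G T A \<inter> H"
proof -
  assume A: "A \<subseteq> H"
  have eq: "(\<lambda>h. H.conjby h g) ` A = (\<lambda>h. conjby h g) ` A" for g using A by (intro image_cong) auto
  have in_H: "(\<lambda>h. conjby h g) ` A \<subseteq> H" if "g \<in> H" for g
    using that A subgroup.m_closed[OF H] subgroup.m_inv_closed[OF H] by (auto simp: conjby_def subset_iff)
  show ?thesis
    unfolding set_eq_iff Int_iff BC_centralizer_iff H.BC_centralizer_iff eq
    using in_H Hc by (auto simp: bdd_in_subtopology[OF clH])
qed

lemma H_thin_family: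
  assumes tf: "thin_family n" shows "H.thin_family n"
proof -
  obtain U a where U: "compact_open U" and ind: "indep_mod U n a"
    and large0: "open_finite_index (BC_centralizer G T (generate G (a ` {..<n})))"
    using tf by (auto simp: thin_family_def)
  have Us: "subgroup U G" by (rule compact_openD(1)[OF U])
  note Um = subgroup.m_closed[OF Us] and Ui = subgroup.m_inv_closed[OF Us]
  interpret I: indep_mod_family G U n a by (rule indep_mod_family.intro[OF is_group indep_mod_family_axioms.intro[OF Us ind]])
  have open_finite_index: "open_finite_index (BC_centralizer G T I.A)"
    using open_finite_index_BC_centralizer_extend[OF U ind large0] by (simp add: I.A_def)
  have "\<exists>h v m. h \<in> H \<and> v \<in> U \<and> m > 0 \<and> h = v \<otimes> a i [^] (m::nat)" if i: "i < n" for i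
  proof -
    have ac: "a i \<in> carrier G" by (rule I.ac[OF i])
    obtain x where x: "x \<in> U" "visits H (\<lambda>k. a i [^] k) x"
      using rec[unfolded recurrent_def, rule_format, of "\<lambda>k. a i [^] k" U \<one>] ac compact_openD(3)[OF U]
        compact_open_one[OF U] by auto
    obtain K where K: "compactin T K" "infinite {k::nat. a i [^] k \<otimes> x \<in> K <#> H}" using x(2) by (auto simp: visits_def)
    have Kc: "K \<subseteq> carrier G" by (rule compactin_subset_carrier[OF K(1)])
    have xc: "x \<in> carrier G" using x I.Uc by blast
    define I0 where "I0 = {k::nat. a i [^] k \<otimes> x \<in> K <#> H}"
    have "\<forall>k\<in>I0. \<exists>y h. y \<in> K \<and> h \<in> H \<and> a i [^] k \<otimes> x = y \<otimes> h" by (auto simp: I0_def set_mult_iff)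
    then obtain \<kappa> \<eta> where d: "\<And>k. k \<in> I0 \<Longrightarrow> \<kappa> k \<in> K \<and> \<eta> k \<in> H \<and> a i [^] k \<otimes> x = \<kappa> k \<otimes> \<eta> k" by metis
    have I0: "infinite I0" using K(2) by (simp add: I0_def)
    \<comment> \<open>The pigeonhole is applied to inverses because the quotient of two elements of
      \<open>H\<close> below contains \<open>\<kappa> k \<otimes> inv (\<kappa> l)\<close>.\<close>
    have "inv (\<kappa> k) \<in> (\<lambda>x. inv x) ` K" if "k \<in> I0" for k using d[OF that] by blast
    from compact_returns[where f = "\<lambda>k. inv (\<kappa> k)", OF compactin_inv_image[OF K(1)] U I0 this]
    obtain k l where k: "k \<in> I0" and l: "l \<in> I0" "k < l" and t: "inv (inv (\<kappa> k)) \<otimes> inv (\<kappa> l) \<in> U" .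
    have c: "\<kappa> k \<in> carrier G" "\<kappa> l \<in> carrier G" "\<eta> k \<in> carrier G" "\<eta> l \<in> carrier G"
      using d[OF k] d[OF l(1)] Kc Hc by auto
    have t': "\<kappa> k \<otimes> inv (\<kappa> l) \<in> U" using t c by simp
    define g where "g = a i [^] k"
    have gc: "g \<in> carrier G" using ac by (simp add: g_def)
    have NU: "subgroup (Normalizer U) G" by (rule subgroup_Normalizer[OF I.Uc])
    have "a i [^] int k \<in> Normalizer U" by (rule subgroup_int_pow_closed[OF NU I.aN[OF i]])
    then have gN: "g \<in> Normalizer U" by (simp add: int_pow_int g_def)
    have "a i [^] int (l - k) \<in> Normalizer U" by (rule subgroup_int_pow_closed[OF NU I.aN[OF i]])
    then have bN: "a i [^] (l - k) \<in> Normalizer U" by (simp only: int_pow_int)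
    have gl: "a i [^] l = g \<otimes> a i [^] (l - k)" using l(2) ac by (simp add: g_def nat_pow_mult)
    have \<eta>k: "\<eta> k = inv (\<kappa> k) \<otimes> (g \<otimes> x)"
    proof -
      have "\<eta> k = inv (\<kappa> k) \<otimes> (\<kappa> k \<otimes> \<eta> k)" using c by simp
      then show ?thesis using d[OF k] by (simp add: g_def)
    qed
    have \<eta>l: "\<eta> l = inv (\<kappa> l) \<otimes> (g \<otimes> a i [^] (l - k) \<otimes> x)"
    proof -
      have "\<eta> l = inv (\<kappa> l) \<otimes> (\<kappa> l \<otimes> \<eta> l)" using c by simp
      then show ?thesis using d[OF l(1)] by (simp add: gl)
    qed
    \<comment> \<open>All three factors lie in \<open>U\<close>: powers of \<open>a i\<close>
      normalize \<open>U\<close>, and \<open>x\<close> was sought inside \<open>U\<close> for this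
      purpose.\<close>
    define w where "w = inv x \<otimes> conjby (inv g) (\<kappa> k \<otimes> inv (\<kappa> l)) \<otimes> conjby (a i [^] (l - k)) x"
    have "inv (\<eta> k) \<otimes> \<eta> l = w \<otimes> a i [^] (l - k)"
      unfolding \<eta>k \<eta>l w_def using c gc xc ac by (simp add: conjby_def group_nf)
    moreover have "inv (\<eta> k) \<otimes> \<eta> l \<in> H"
      using d[OF k] d[OF l(1)] subgroup.m_closed[OF H] subgroup.m_inv_closed[OF H] by blast
    moreover have "w \<in> U"
    proof -
      have "conjby (inv g) (\<kappa> k \<otimes> inv (\<kappa> l)) \<in> U"
        by (rule Normalizer_conjby[OF subgroup.m_inv_closed[OF NU gN] t'])
      moreover have "conjby (a i [^] (l - k)) x \<in> U" by (rule Normalizer_conjby[OF bN x(1)])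
      ultimately show ?thesis unfolding w_def using Um Ui x(1) by simp
    qed
    moreover have "l - k > 0" using l(2) by simp
    ultimately show ?thesis by blast
  qed
  then have "\<forall>i. \<exists>h v m. i < n \<longrightarrow> h \<in> H \<and> v \<in> U \<and> m > 0 \<and> h = v \<otimes> a i [^] (m::nat)" by blast
  then obtain h v m where hvm: "\<And>i. i < n \<Longrightarrow> h i \<in> H \<and> v i \<in> U \<and> m i > 0 \<and> h i = v i \<otimes> a i [^] (m i :: nat)"
    by metis
  have hA: "h i \<in> I.A" if "i < n" for i
  proof -
    have "a i [^] int (m i) \<in> I.A" by (rule subgroup_int_pow_closed[OF I.subgroup_A I.aA[OF that]])
    then have "v i \<otimes> a i [^] m i \<in> I.A" using subgroup.m_closed[OF I.subgroup_A] I.UA hvm[OF that] by (auto simp: int_pow_int)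
    then show ?thesis using hvm[OF that] by simp
  qed
  have hH: "h i \<in> H" if "i < n" for i using hvm[OF that] by blast
  have hN: "h i \<in> Normalizer U" if "i < n" for i using hA[OF that] I.A_Normalizer by blast
  have hc: "h i \<in> carrier G" if "i < n" for i by (rule NormalizerD(2)[OF hN[OF that]])
  define V where "V = U \<inter> H"
  have VH: "V \<subseteq> H" by (simp add: V_def)
  have Vs: "subgroup V G" unfolding V_def by (rule subgroups_Inter_pair[OF Us H])
  have V: "H.compact_open V"
    unfolding compact_open_subgroup_iff[OF H]
    using Vs VH compact_Int_closedin[OF compact_openD(2)[OF U] clH] openin_subtopology_Int[OF compact_openD(3)[OF U]]
    by (simp add: V_def)
  \<comment> \<open>Commutators lie in \<open>U\<close> by commutation in \<open>I.A\<close> and in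
    \<open>H\<close> trivially, hence in \<open>V\<close>. For independence, a power of
    \<open>h i\<close> is a power of \<open>a i\<close> up to a factor in \<open>U\<close>, so a
    relation among the \<open>h i\<close> would give one among the \<open>a i\<close>.\<close>
  have indV: "indep_mod V n h"
    unfolding indep_mod_def
  proof (intro conjI allI impI)
    fix i assume i: "i < n"
    have "h i \<in> Normalizer H" using subgroup_subset_Normalizer[OF H] hvm[OF i] by blast
    then have "conjby (h i) ` V = V"
      unfolding V_def conjby_image_inj[OF hc[OF i] I.Uc Hc] by (simp only: NormalizerD(1) hN[OF i])
    then show "h i \<in> Normalizer V" using hc[OF i] by (simp add: Normalizer_def)
    fix j assume j: "j < n"
    obtain u where u: "u \<in> U" "conjby (h i) (h j) = h j \<otimes> u" using I.A_commute[OF hA[OF i] hA[OF j]] by (auto simp: l_coset_iff)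
    have "u = inv (h j) \<otimes> conjby (h i) (h j)" unfolding u(2) using hc[OF j] u(1) I.Uc by auto
    moreover have "inv (h j) \<otimes> conjby (h i) (h j) \<in> H"
      unfolding conjby_def using hH[OF i] hH[OF j] subgroup.m_closed[OF H] subgroup.m_inv_closed[OF H] by simp
    ultimately have "u \<in> V" using u(1) by (simp add: V_def)
    then show "conjby (h i) (h j) \<in> h j <# V" using u(2) unfolding l_coset_iff by blast
  next
    fix i and k :: nat assume i: "i < n" and k: "0 < k"
    define E where "E = generate G (a ` {..<i} \<union> U)"
    have E: "subgroup E G" unfolding E_def by (rule generate_is_subgroup[OF I.gen_carrier]) (use i in simp)
    have UE: "U \<subseteq> E" and aE: "\<And>j. j < i \<Longrightarrow> a j \<in> E" by (auto simp: E_def intro: generate.incl)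
    have "h j \<in> E" if "j < i" for j
    proof -
      have jn: "j < n" using that i by simp
      have "a j [^] int (m j) \<in> E" by (rule subgroup_int_pow_closed[OF E aE[OF that]])
      then have "v j \<otimes> a j [^] m j \<in> E" using subgroup.m_closed[OF E] UE hvm[OF jn] by (auto simp: int_pow_int)
      then show ?thesis using hvm[OF jn] by simp
    qed
    then have "generate G (h ` {..<i} \<union> V) \<subseteq> E"
      by (intro generate_subgroup_incl[OF _ E]) (use UE in \<open>auto simp: V_def\<close>)
    moreover have "h i [^] k \<notin> E"
    proof
      assume hk: "h i [^] k \<in> E"
      have ac: "a i \<in> carrier G" by (rule I.ac[OF i])
      have "a i [^] int (m i) \<in> Normalizer U" by (rule subgroup_int_pow_closed[OF subgroup_Normalizer[OF I.Uc] I.aN[OF i]])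
      then have bN: "a i [^] m i \<in> Normalizer U" by (simp only: int_pow_int)
      have vU: "v i \<in> U" using hvm[OF i] by blast
      obtain w where w: "w \<in> U" "(v i \<otimes> a i [^] m i) [^] k = w \<otimes> (a i [^] m i) [^] k"
        using mult_pow_normalizer[OF Us vU bN] by blast
      have "h i [^] k = w \<otimes> a i [^] (m i * k)" using w(2) hvm[OF i] ac by (simp add: nat_pow_pow)
      moreover have "w \<in> carrier G" using w(1) I.Uc by blast
      ultimately have "a i [^] (m i * k) = inv w \<otimes> h i [^] k" using ac by simp
      then have "a i [^] (m i * k) \<in> E" using subgroup.m_closed[OF E] subgroup.m_inv_closed[OF E] w(1) UE hk by auto
      then show False using I.free[OF i, of "m i * k"] k hvm[OF i] by (simp add: E_def)
    qed
    ultimately show "h i [^] k \<notin> generate G (h ` {..<i} \<union> V)" by blast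
  qed
  have indH: "H.indep_mod V n h" using indV hH H_indep_mod_iff[OF VH] by simp
  define D where "D = generate G (h ` {..<n})"
  have hH': "h ` {..<n} \<subseteq> H" using hH by auto
  have DH: "D \<subseteq> H" unfolding D_def by (rule generate_subgroup_incl[OF hH' H])
  have DA: "D \<subseteq> I.A" unfolding D_def by (rule generate_subgroup_incl[OF _ I.subgroup_A]) (use hA in auto)
  define P where "P = BC_centralizer G T D"
  have "open_finite_index P"
    unfolding P_def
    by (rule open_finite_index_mono[OF open_finite_index BC_centralizer_antimono[OF DA] subgroup_BC_centralizer]) (use DH Hc in blast)
  then have P: "subgroup P G" "openin T P" "finite (rcosets P)" by (auto simp: open_finite_index_def)
  \<comment> \<open>The right cosets of \<open>P \<inter> H\<close> in \<open>H\<close> are the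
    traces on \<open>H\<close> of right cosets of \<open>P\<close>.\<close>
  have "H.open_finite_index (P \<inter> H)"
    unfolding H.open_finite_index_def
  proof (intro conjI)
    show "subgroup (P \<inter> H) GH" by (rule subgroup_incl[OF subgroups_Inter_pair[OF P(1) H] H]) simp
    show "openin TH (P \<inter> H)" by (rule openin_subtopology_Int[OF P(2)])
    have "rcosets\<^bsub>GH\<^esub> (P \<inter> H) \<subseteq> (\<lambda>C. C \<inter> H) ` (rcosets P)"
    proof
      fix C assume "C \<in> rcosets\<^bsub>GH\<^esub> (P \<inter> H)"
      then obtain x where x: "x \<in> H" "C = (P \<inter> H) #> x" by (auto simp: RCOSETS_def)
      have xc: "x \<in> carrier G" using x Hc by blast
      have "C = (P #> x) \<inter> H"
      proof
        show "C \<subseteq> (P #> x) \<inter> H" unfolding x(2) using x(1) subgroup.m_closed[OF H] by (auto simp: r_coset_def)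
        show "(P #> x) \<inter> H \<subseteq> C"
        proof
          fix y assume y: "y \<in> (P #> x) \<inter> H"
          then obtain p where p: "p \<in> P" "y = p \<otimes> x" by (auto simp: r_coset_def)
          have "p \<in> carrier G" using p subgroup.subset[OF P(1)] by blast
          then have "p = y \<otimes> inv x" using p xc by (simp add: m_assoc)
          then have "p \<in> H" using y x(1) subgroup.m_closed[OF H] subgroup.m_inv_closed[OF H] by simp
          then show "y \<in> C" using p x(2) by (auto simp: r_coset_def)
        qed
      qed
      moreover have "P #> x \<in> rcosets P" using xc by (auto simp: RCOSETS_def)
      ultimately show "C \<in> (\<lambda>C. C \<inter> H) ` (rcosets P)" by blast
    qed
    then show "finite (rcosets\<^bsub>GH\<^esub> (P \<inter> H))" using P(3) finite_surj by blast
  qed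
  then have "H.open_finite_index (BC_centralizer GH TH (generate GH (h ` {..<n})))"
    using H_BC_centralizer[OF DH] generate_consistent[OF hH' H] by (simp add: P_def D_def)
  then show ?thesis using V indH unfolding H.thin_family_def by blast
qed

lemma thin_family_of_H:
  assumes tf: "H.thin_family n" shows "thin_family n"
proof -
  obtain V a where V: "H.compact_open V" and indH: "H.indep_mod V n a"
    and largeH: "H.open_finite_index (BC_centralizer GH TH (generate GH (a ` {..<n})))"
    using tf by (auto simp: H.thin_family_def)
  have V': "subgroup V G" "compactin T V" "V \<subseteq> H" using V unfolding compact_open_subgroup_iff[OF H] by auto
  have ind: "indep_mod V n a" and aH: "\<And>i. i < n \<Longrightarrow> a i \<in> H" using indH H_indep_mod_iff[OF V'(3)] by auto
  interpret I: indep_mod_family G V n a by (rule indep_mod_family.intro[OF is_group indep_mod_family_axioms.intro[OF V'(1) ind]])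
  obtain U0 where U0: "compact_open U0" by (rule van_Dantzig)
  have aHs: "a ` {..<n} \<subseteq> H" using aH by auto
  define D where "D = generate G (a ` {..<n})"
  have D: "subgroup D G" unfolding D_def by (rule generate_is_subgroup) (use aHs Hc in blast)
  have DH: "D \<subseteq> H" unfolding D_def by (rule generate_subgroup_incl[OF aHs H])
  have Dc: "D \<subseteq> carrier G" using DH Hc by blast
  define B where "B = BC_centralizer G T D \<inter> H"
  have "BC_centralizer GH TH (generate GH (a ` {..<n})) = B"
    using H_BC_centralizer[OF DH] generate_consistent[OF aHs H] by (simp add: B_def D_def)
  then have finB: "finite (rcosets\<^bsub>GH\<^esub> B)" and BsH: "subgroup B GH" using largeH by (auto simp: H.open_finite_index_def)
  have Bs: "subgroup B G" by (rule incl_subgroup[OF H BsH])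
  have Bc: "B \<subseteq> carrier G" by (rule subgroup.subset[OF Bs])
  \<comment> \<open>Finite index is stated with right cosets of \<open>B\<close>, while the
    recurrence lemmas want \<open>F <#> B\<close>; inverses of coset representatives convert one
    into the other.\<close>
  define F where "F = (\<lambda>C. inv (SOME x. x \<in> H \<and> C = B #> x)) ` (rcosets\<^bsub>GH\<^esub> B)"
  have some: "(SOME x. x \<in> H \<and> C = B #> x) \<in> H \<and> C = B #> (SOME x. x \<in> H \<and> C = B #> x)" if "C \<in> rcosets\<^bsub>GH\<^esub> B" for C
  proof (rule someI_ex)
    show "\<exists>x. x \<in> H \<and> C = B #> x" using that by (auto simp: RCOSETS_def)
  qed
  have F: "finite F" "F \<subseteq> carrier G" using finB some Hc by (auto simp: F_def)
  have HFB: "H \<subseteq> F <#> B"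
  proof
    fix h assume h: "h \<in> H"
    have ih: "inv h \<in> H" by (rule subgroup.m_inv_closed[OF H h])
    define C where "C = B #> inv h"
    have C: "C \<in> rcosets\<^bsub>GH\<^esub> B" using ih by (auto simp: C_def RCOSETS_def)
    define y where "y = (SOME x. x \<in> H \<and> C = B #> x)"
    have y: "y \<in> H" "C = B #> y" using some[OF C] unfolding y_def by blast+
    have "inv h \<in> C" unfolding C_def r_coset_def using subgroup.one_closed[OF Bs] ih Hc by force
    then obtain b where b: "b \<in> B" "inv h = b \<otimes> y" unfolding y(2) r_coset_def by blast
    have c: "b \<in> carrier G" "y \<in> carrier G" "h \<in> carrier G" using b y h Bc Hc by auto
    have "h = inv (inv h)" using c by simp
    also have "\<dots> = inv y \<otimes> inv b" unfolding b(2) using c by (simp add: inv_mult_group)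
    finally have "h = inv y \<otimes> inv b" .
    moreover have "inv y \<in> F" unfolding F_def y_def using C by blast
    moreover have "inv b \<in> B" by (rule subgroup.m_inv_closed[OF Bs b(1)])
    ultimately show "h \<in> F <#> B" by (simp add: set_multI)
  qed
  have bB: "bdd_in T (range (\<lambda>k. conjpow (a i) k b))" if i: "i < n" and b: "b \<in> B" for i b
  proof -
    have "a i \<in> D" unfolding D_def using i by (auto intro: generate.incl)
    then have "a i [^] (k::int) \<in> D" for k by (rule subgroup_int_pow_closed[OF D])
    then have "range (\<lambda>k. conjpow (a i) k b) \<subseteq> (\<lambda>h. conjby h b) ` D" by (auto simp: conjpow_def)
    moreover have "bdd_in T ((\<lambda>h. conjby h b) ` D)" using b by (simp add: B_def BC_centralizer_iff)
    ultimately show ?thesis using bdd_in_subset by blast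
  qed
  have "\<exists>W. compact_open W \<and> (\<forall>k. conjpow (a i) k ` W = W)" if i: "i < n" for i
    by (rule normalizes_compact_open[OF U0 aH[OF i] H rec F Bc HFB bB[OF i]]) blast+
  from common_compact_open[of V U0 n a, OF V'(2,1) U0 I.aN I.comm this]
  obtain W where W: "compact_open W" "V \<subseteq> W" "\<And>j. j < n \<Longrightarrow> a j \<in> Normalizer W" by auto
  have Ws: "subgroup W G" by (rule compact_openD(1)[OF W(1)])
  have Wc: "W \<subseteq> carrier G" by (rule compact_open_subset[OF W(1)])
  have DN: "D \<subseteq> Normalizer W" unfolding D_def by (rule generate_subgroup_incl[OF _ subgroup_Normalizer[OF Wc]]) (use W(3) in auto)
  have "indep_mod W n a"
    unfolding indep_mod_def
  proof (intro conjI allI impI W(3))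
    fix i j assume ij: "i < n" "j < n"
    show "conjby (a i) (a j) \<in> a j <# W" using I.comm[OF ij] W(2) by (auto simp: l_coset_iff)
  next
    fix i and k :: nat assume i: "i < n" and k: "0 < k"
    have ac: "a i \<in> carrier G" by (rule I.ac[OF i])
    show "a i [^] k \<notin> generate G (a ` {..<i} \<union> W)"
    proof
      assume mem: "a i [^] k \<in> generate G (a ` {..<i} \<union> W)"
      define Di where "Di = generate G (a ` {..<i})"
      have aic: "a ` {..<i} \<subseteq> carrier G" using I.ac i by auto
      have Di: "subgroup Di G" unfolding Di_def by (rule generate_is_subgroup[OF aic])
      have DiD: "Di \<subseteq> D" unfolding Di_def D_def by (rule mono_generate) (use i in auto)
      have "generate G (a ` {..<i} \<union> W) \<subseteq> W <#> Di" unfolding Di_def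
        by (rule generate_normalized[OF Ws]) (use W(3) i in auto)
      then have "a i [^] k \<in> W <#> Di" using mem by blast
      then obtain w d where wd: "w \<in> W" "d \<in> Di" "a i [^] k = w \<otimes> d" by (auto simp: set_mult_iff)
      have c: "w \<in> carrier G" "d \<in> carrier G" using wd Wc DiD Dc by auto
      define E where "E = generate G (a ` {..<i} \<union> V)"
      have E: "subgroup E G" unfolding E_def by (rule generate_is_subgroup[OF I.gen_carrier]) (use i in simp)
      have EA: "E \<subseteq> I.A" unfolding E_def I.A_def by (rule mono_generate) (use i in auto)
      have VE: "V \<subseteq> E" by (auto simp: E_def intro: generate.incl)
      have DiE: "Di \<subseteq> E" unfolding Di_def E_def by (rule mono_generate) auto
      have dE: "d \<in> E" using wd DiE by blast
      have akA: "a i [^] int k \<in> I.A" by (rule subgroup_int_pow_closed[OF I.subgroup_A I.aA[OF i]])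
      have weq: "w = a i [^] k \<otimes> inv d" unfolding wd(3) using c by (simp add: m_assoc)
      have wA: "w \<in> I.A" unfolding weq
        using akA dE EA subgroup.m_closed[OF I.subgroup_A] subgroup.m_inv_closed[OF I.subgroup_A] by (auto simp: int_pow_int)
      have akH: "a i [^] int k \<in> H" by (rule subgroup_int_pow_closed[OF H aH[OF i]])
      have wH: "w \<in> H" unfolding weq
        using akH wd(2) DiD DH subgroup.m_closed[OF H] subgroup.m_inv_closed[OF H] by (auto simp: int_pow_int)
      \<comment> \<open>Independence modulo \<open>V\<close> must be upgraded to the larger group
        \<open>W\<close>. The element \<open>w\<close> lies in the compact group
        \<open>W \<inter> H\<close>, in which \<open>V\<close> is open, so a positive power of
        \<open>w\<close> falls back into \<open>V\<close>.\<close>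
      have KH: "compactin TH (W \<inter> H)"
        using compact_Int_closedin[OF compact_openD(2)[OF W(1)] clH] by (simp add: compactin_subtopology)
      have "w [^] (q::nat) \<in> W \<inter> H" for q
        using subgroup_int_pow_closed[OF subgroups_Inter_pair[OF Ws H], of w "int q"] wd(1) wH by (simp add: int_pow_int)
      then have rng: "range (\<lambda>q::nat. w [^]\<^bsub>GH\<^esub> q) \<subseteq> W \<inter> H" by (auto simp: nat_pow_consistent[symmetric])
      have wGH: "w \<in> carrier GH" using wH by simp
      obtain q :: nat where q: "q > 0" "w [^]\<^bsub>GH\<^esub> q \<in> V" by (rule H.compact_power[OF wGH V KH rng])
      have wq: "w [^] q \<in> V" using q(2) by (simp add: nat_pow_consistent[symmetric])
      \<comment> \<open>Moving \<open>w\<close> past an element of \<open>E\<close> costs only a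
        factor from \<open>V\<close>, which is part of \<open>E\<close>. The power of
        \<open>w \<otimes> d\<close> is thus the power of \<open>w\<close> times an element of
        \<open>E\<close>.\<close>
      have "\<exists>e\<in>E. (w \<otimes> d) [^] (r::nat) = w [^] r \<otimes> e" for r
      proof (induction r)
        case 0
        show ?case using subgroup.one_closed[OF E] by (intro bexI[of _ \<one>]) auto
      next
        case (Suc r)
        then obtain e where e: "e \<in> E" "(w \<otimes> d) [^] r = w [^] r \<otimes> e" by blast
        have ec: "e \<in> carrier G" using e subgroup.subset[OF E] by blast
        have iwA: "inv w \<in> I.A" by (rule subgroup.m_inv_closed[OF I.subgroup_A wA])
        obtain s where s: "s \<in> V" "conjby (inv w) e = e \<otimes> s"
          using I.A_commute[OF iwA] e(1) EA by (auto simp: l_coset_iff subset_iff)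
        have "conjby (inv w) e \<in> E" unfolding s(2) using subgroup.m_closed[OF E e(1)] s(1) VE by blast
        then have "conjby (inv w) e \<otimes> d \<in> E" using subgroup.m_closed[OF E _ dE] by blast
        moreover have "(w \<otimes> d) [^] Suc r = w [^] Suc r \<otimes> (conjby (inv w) e \<otimes> d)"
          using c ec by (simp add: e(2) conjby_def group_nf)
        ultimately show ?case by blast
      qed
      then obtain e where e: "e \<in> E" "(w \<otimes> d) [^] q = w [^] q \<otimes> e" by blast
      have "a i [^] (k * q) = (w \<otimes> d) [^] q" unfolding wd(3)[symmetric] using ac by (simp add: nat_pow_pow)
      also have "\<dots> \<in> E" unfolding e(2) using subgroup.m_closed[OF E _ e(1)] wq VE by blast
      finally show False using I.free[OF i, of "k * q"] k q(1) by (simp add: E_def)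
    qed
  qed
  moreover have "open_finite_index (BC_centralizer G T D)"
  proof -
    define P where "P = BC_centralizer G T D"
    have P: "subgroup P G" unfolding P_def by (rule subgroup_BC_centralizer[OF Dc])
    have oP: "openin T P"
    proof (rule openin_subgroup_of_open[OF P compact_openD(3)[OF W(1)]])
      show "W \<subseteq> P" unfolding P_def by (rule normalized_subset_BC_centralizer[OF W(1) DN])
      show "W \<noteq> {}" using compact_open_one[OF W(1)] by blast
    qed
    have "B \<subseteq> P" by (simp add: B_def P_def)
    from recurrent_finite_index[OF rec P oP this F HFB] show ?thesis
      using P oP by (simp add: open_finite_index_def P_def)
  qed
  ultimately show ?thesis using W(1) unfolding thin_family_def D_def by blast
qed

text \<open>Both ranks are compared through the finite bounds \<open>n\<close> below them. The bound
  \<open>0\<close> always holds; positive bounds are thin families, which transfer both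
  ways.\<close>

lemma BC_rank_eq: "BC_rank GH TH = BC_rank G T"
proof -
  have iff: "enat n \<le> BC_rank GH TH \<longleftrightarrow> enat n \<le> BC_rank G T" for n
  proof (cases "n = 0")
    case True
    then show ?thesis by (simp flip: zero_enat_def)
  next
    case False
    then show ?thesis
      using rank_ge_of_thin_family thin_family_of_rank_ge H.rank_ge_of_thin_family H.thin_family_of_rank_ge
        H_thin_family thin_family_of_H by blast
  qed
  show ?thesis
  proof (rule antisym)
    show "BC_rank GH TH \<le> BC_rank G T" by (rule enat_le_of_nat_bounds) (use iff in blast)
    show "BC_rank G T \<le> BC_rank GH TH" by (rule enat_le_of_nat_bounds) (use iff in blast)
  qed
qed

end

theorem theorem1p3:
  fixes G :: "('a, 'b) monoid_scheme" and T :: "'a topology" and H :: "'a set"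
  assumes "tdlc_group G T"
    and "sigma_compact_space T"
    and "closed_subgroup H G T"
  shows "(finite_covolume H G T \<longrightarrow>
            BC_rank (G\<lparr>carrier := H\<rparr>) (subtopology T H) = BC_rank G T) \<and>
         (cocompact H G T \<longrightarrow>
            BC_rank (G\<lparr>carrier := H\<rparr>) (subtopology T H) = BC_rank G T) \<and>
         (\<forall>\<Gamma> \<Delta>. lattice_subgroup \<Gamma> G T \<and> lattice_subgroup \<Delta> G T \<longrightarrow>
            BC_rank (G\<lparr>carrier := \<Gamma>\<rparr>) (subtopology T \<Gamma>) = BC_rank G T \<and>
            BC_rank G T = BC_rank (G\<lparr>carrier := \<Delta>\<rparr>) (subtopology T \<Delta>))"
proof -
  interpret tdlc_group G T by (rule assms(1))
  obtain U where U: "compact_open U" by (rule van_Dantzig)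
  have main: "BC_rank (G\<lparr>carrier := K\<rparr>) (subtopology T K) = BC_rank G T"
    if K: "closed_subgroup K G T" and rec: "recurrent K" for K
  proof -
    interpret recurrent_subgroup G T K
      by (intro recurrent_subgroup.intro tdlc_group_axioms recurrent_subgroup_axioms.intro)
        (use K rec in \<open>simp_all add: closed_subgroup_def\<close>)
    show ?thesis by (rule BC_rank_eq)
  qed
  have fc: "BC_rank (G\<lparr>carrier := K\<rparr>) (subtopology T K) = BC_rank G T"
    if K: "closed_subgroup K G T" and fc: "finite_covolume K G T" for K
    using main[OF K finite_covolume_recurrent[OF assms(2) _ U fc]] K by (simp add: closed_subgroup_def)
  have cc: "BC_rank (G\<lparr>carrier := H\<rparr>) (subtopology T H) = BC_rank G T" if "cocompact H G T"
    using main[OF assms(3) cocompact_recurrent[OF _ U that]] assms(3) by (simp add: closed_subgroup_def)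
  \<comment> \<open>A lattice is closed because it is discrete, so it falls under the finite
    covolume case.\<close>
  have lat: "BC_rank (G\<lparr>carrier := K\<rparr>) (subtopology T K) = BC_rank G T" if "lattice_subgroup K G T" for K
    using fc[OF discrete_subgroup_closed] that by (simp add: lattice_subgroup_def)
  show ?thesis using fc[OF assms(3)] cc lat by simp
qed

end
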